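(* Let $p\in[0,1]$ and let $\mathcal{N}_p$ be the $p$-dephasing qubit channel. Every point on the CQ trade-off curve of $\mathcal{N}_p$ has the form \[ \big(1-H_2(\mu),\ H_2(\mu)-H_2(\gamma(\mu,p))\big) \] for some $\mu\in[0,1/2]$, and every point on the CE trade-off curve of $\mathcal{N}_p$ has the form \[ \big(1+H_2(\mu)-H_2(\gamma(\mu,p)),\ H_2(\mu)\big) \] for some $\mu\in[0,1/2]$, where $\gamma(\mu,p)\equiv\frac12+\frac12\sqrt{1-16\cdot\frac p2\left(1-\frac p2\right)\mu(1-\mu)}$.
   Context: The $p$-dephasing qubit channel is $\mathcal{N}_p(\sigma)=(1-p)\sigma+\frac p2(\sigma+Z\sigma Z)$ with $Z$ the Pauli $Z$ matrix. $H_2$ is the binary entropy function (base 2). An admissible state for a channel $\mathcal{N}^{A'\to B}$ with isometric extension $U_{\mathcal{N}}^{A'\to BE}$ is $\rho^{XABE}=\sum_x p_X(x)|x\rangle\langle x|^X\otimes U_{\mathcal{N}}(\phi_x^{AA'})U_{\mathcal{N}}^\dagger$ ($X$ finite, $p_X$ a probability distribution, $A$ finite-dimensional, $\phi_x$ pure). The CQ capacity region is $\mathcal{C}_{\mathrm{CQ}}(\mathcal{N})=\overline{\bigcup_{k\ge1}\frac1k\mathcal{C}^{(1)}_{\mathrm{CQ}}(\mathcal{N}^{\otimes k})}$ where $\mathcal{C}^{(1)}_{\mathrm{CQ}}(\mathcal{M})$ is the union over admissible $\rho$ for $\mathcal{M}$ of $\{(C,Q):0\le C\le I(X;B)_\rho,\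 0\le Q\le I(A\rangle BX)_\rho\}$, with $I(A\rangle BX)=H(BX)-H(ABX)$; the CQ trade-off curve is its set of Pareto-optimal points (no other point $(C',Q')$ of the region with $C'\ge C,Q'\ge Q$). The CE capacity region is $\mathcal{C}_{\mathrm{CE}}(\mathcal{N})=\overline{\bigcup_{k\ge1}\frac1k\mathcal{C}^{(1)}_{\mathrm{CE}}(\mathcal{N}^{\otimes k})}$ where $\mathcal{C}^{(1)}_{\mathrm{CE}}(\mathcal{M})$ is the union over admissible $\rho$ of $\{(C,E):0\le C\le I(AX;B)_\rho,\ E\ge H(A|X)_\rho\}$; the CE trade-off curve is its set of Pareto-optimal points (no other point $(C',E')$ of the region with $C'\ge C$, $E'\le E$). *)

theory Defs
  imports "HOL-Analysis.Analysis" "Jordan_Normal_Form.Char_Poly"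
begin

definition H2 :: "real \<Rightarrow> real" where
  "H2 x = - x * log 2 x - (1 - x) * log 2 (1 - x)"

definition gamma_fn :: "real \<Rightarrow> real \<Rightarrow> real" where
  "gamma_fn \<mu> p = 1/2 + 1/2 * sqrt (1 - 16 * (p/2) * (1 - p/2) * \<mu> * (1 - \<mu>))"

definition matunit :: "nat \<Rightarrow> nat \<Rightarrow> nat \<Rightarrow> complex mat" where
  "matunit d i j = mat d d (\<lambda>(r,c). if r = i \<and> c = j then 1 else 0)"

definition kron :: "complex mat \<Rightarrow> complex mat \<Rightarrow> complex mat" where
  "kron A B = mat (dim_row A * dim_row B) (dim_col A * dim_col B)
     (\<lambda>(r,c). A $$ (r div dim_row B, c div dim_col B) * B $$ (r mod dim_row B, c mod dim_col B))"

text \<open>Tensor product of two linear maps M1 (on d1 x d1 matrices) and M2 (on d2 x d2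
  matrices), defined by linear extension from product matrix units.\<close>
definition chan_tensor :: "nat \<Rightarrow> nat \<Rightarrow> (complex mat \<Rightarrow> complex mat) \<Rightarrow> (complex mat \<Rightarrow> complex mat)
    \<Rightarrow> complex mat \<Rightarrow> complex mat" where
  "chan_tensor d1 d2 M1 M2 \<rho> = mat (d1 * d2) (d1 * d2) (\<lambda>(r,c).
     \<Sum>i<d1. \<Sum>j<d1. \<Sum>a<d2. \<Sum>b<d2.
       \<rho> $$ (i * d2 + a, j * d2 + b) * kron (M1 (matunit d1 i j)) (M2 (matunit d2 a b)) $$ (r, c))"

definition pauliZ :: "complex mat" where
  "pauliZ = mat 2 2 (\<lambda>(r,c). if r = c then (if r = 0 then 1 else -1) else 0)"

definition dephasing :: "real \<Rightarrow> complex mat \<Rightarrow> complex mat" where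
  "dephasing p \<sigma> = complex_of_real (1 - p) \<cdot>\<^sub>m \<sigma>
      + complex_of_real (p / 2) \<cdot>\<^sub>m (\<sigma> + pauliZ * \<sigma> * pauliZ)"

fun dephasing_pow :: "real \<Rightarrow> nat \<Rightarrow> complex mat \<Rightarrow> complex mat" where
  "dephasing_pow p 0 = (\<lambda>\<rho>. \<rho>)"
| "dephasing_pow p (Suc k) = chan_tensor 2 (2 ^ k) (dephasing p) (dephasing_pow p k)"

definition proj_vec :: "complex vec \<Rightarrow> complex mat" where
  "proj_vec v = mat (dim_vec v) (dim_vec v) (\<lambda>(i,j). v $ i * cnj (v $ j))"

definition unit_vector :: "nat \<Rightarrow> complex vec \<Rightarrow> bool" where
  "unit_vector n v \<longleftrightarrow> v \<in> carrier_vec n \<and> (\<Sum>i<n. (cmod (v $ i))\<^sup>2) = 1"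

text \<open>Von Neumann entropy (base 2): eigenvalues counted with multiplicity as roots of
  the characteristic polynomial; convention 0 log 0 = 0 (automatic since 0 * _ = 0).\<close>
definition vn_entropy :: "complex mat \<Rightarrow> real" where
  "vn_entropy M = - sum_mset (image_mset (\<lambda>z. Re z * log 2 (Re z)) (proots (char_poly M)))"

text \<open>Marginal (partial trace) of a tripartite operator on systems 1,2,3 of dimensions
  d1,d2,d3 (index (i1*d2+i2)*d3+i3); keep_l says whether system l is kept.\<close>
definition marg3 :: "nat \<Rightarrow> nat \<Rightarrow> nat \<Rightarrow> bool \<Rightarrow> bool \<Rightarrow> bool \<Rightarrow> complex mat \<Rightarrow> complex mat" where
  "marg3 d1 d2 d3 k1 k2 k3 \<rho> =
    (let e1 = (if k1 then d1 else 1); e2 = (if k2 then d2 else 1); e3 = (if k3 then d3 else 1);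
         t1 = (if k1 then 1 else d1); t2 = (if k2 then 1 else d2); t3 = (if k3 then 1 else d3)
     in mat (e1 * e2 * e3) (e1 * e2 * e3) (\<lambda>(r,c).
       let i1 = r div (e2 * e3); i2 = (r div e3) mod e2; i3 = r mod e3;
           j1 = c div (e2 * e3); j2 = (c div e3) mod e2; j3 = c mod e3
       in \<Sum>s1<t1. \<Sum>s2<t2. \<Sum>s3<t3.
         \<rho> $$ (((if k1 then i1 else s1) * d2 + (if k2 then i2 else s2)) * d3 + (if k3 then i3 else s3),
               ((if k1 then j1 else s1) * d2 + (if k2 then j2 else s2)) * d3 + (if k3 then j3 else s3))))"

text \<open>An ensemble: |X| = nx, distribution px on {0..<nx}, dim A = da, and pure states
  phi_x = |v x><v x| on A (x) A' with A' = (C^2)^(x)k.\<close>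
definition admissible :: "nat \<Rightarrow> nat \<Rightarrow> (nat \<Rightarrow> real) \<Rightarrow> nat \<Rightarrow> (nat \<Rightarrow> complex vec) \<Rightarrow> bool" where
  "admissible k nx px da v \<longleftrightarrow> nx \<ge> 1 \<and> da \<ge> 1 \<and> (\<forall>x<nx. px x \<ge> 0) \<and> (\<Sum>x<nx. px x) = 1
     \<and> (\<forall>x<nx. unit_vector (da * 2 ^ k) (v x))"

text \<open>rho^{XAB} = sum_x p(x) |x><x| (x) (id_A (x) N_p^{(x)k})(phi_x); this is the XAB-marginal
  of rho^{XABE} = sum_x p(x) |x><x| (x) U phi_x U^dagger for any isometric extension U.\<close>
definition state_XAB :: "real \<Rightarrow> nat \<Rightarrow> nat \<Rightarrow> (nat \<Rightarrow> real) \<Rightarrow> nat \<Rightarrow> (nat \<Rightarrow> complex vec) \<Rightarrow> complex mat" where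
  "state_XAB p k nx px da v = mat (nx * (da * 2 ^ k)) (nx * (da * 2 ^ k)) (\<lambda>(r,c).
     \<Sum>x<nx. complex_of_real (px x) *
        kron (matunit nx x x) (chan_tensor da (2 ^ k) (\<lambda>\<rho>. \<rho>) (dephasing_pow p k) (proj_vec (v x))) $$ (r,c))"

definition ent :: "real \<Rightarrow> nat \<Rightarrow> nat \<Rightarrow> (nat \<Rightarrow> real) \<Rightarrow> nat \<Rightarrow> (nat \<Rightarrow> complex vec)
    \<Rightarrow> bool \<Rightarrow> bool \<Rightarrow> bool \<Rightarrow> real" where
  "ent p k nx px da v kX kA kB = vn_entropy (marg3 nx da (2 ^ k) kX kA kB (state_XAB p k nx px da v))"

definition mutinf_X_B where
  "mutinf_X_B p k nx px da v = ent p k nx px da v True False False + ent p k nx px da v False False True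
      - ent p k nx px da v True False True"

definition coh_A_BX where
  "coh_A_BX p k nx px da v = ent p k nx px da v True False True - ent p k nx px da v True True True"

definition mutinf_AX_B where
  "mutinf_AX_B p k nx px da v = ent p k nx px da v True True False + ent p k nx px da v False False True
      - ent p k nx px da v True True True"

definition condent_A_X where
  "condent_A_X p k nx px da v = ent p k nx px da v True True False - ent p k nx px da v True False False"

definition CQ_one_shot :: "real \<Rightarrow> nat \<Rightarrow> (real \<times> real) set" where
  "CQ_one_shot p k = {(C, Q). \<exists>nx px da v. admissible k nx px da v \<and>
      0 \<le> C \<and> C \<le> mutinf_X_B p k nx px da v \<and> 0 \<le> Q \<and> Q \<le> coh_A_BX p k nx px da v}"

definition CE_one_shot :: "real \<Rightarrow> nat \<Rightarrow> (real \<times> real) set" where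
  "CE_one_shot p k = {(C, E). \<exists>nx px da v. admissible k nx px da v \<and>
      0 \<le> C \<and> C \<le> mutinf_AX_B p k nx px da v \<and> E \<ge> condent_A_X p k nx px da v}"

definition CQ_region :: "real \<Rightarrow> (real \<times> real) set" where
  "CQ_region p = closure (\<Union>k\<in>{1..}. (\<lambda>(C, Q). (C / real k, Q / real k)) ` CQ_one_shot p k)"

definition CE_region :: "real \<Rightarrow> (real \<times> real) set" where
  "CE_region p = closure (\<Union>k\<in>{1..}. (\<lambda>(C, E). (C / real k, E / real k)) ` CE_one_shot p k)"

definition CQ_tradeoff :: "real \<Rightarrow> (real \<times> real) set" where
  "CQ_tradeoff p = {(C, Q) \<in> CQ_region p. \<not> (\<exists>(C', Q') \<in> CQ_region p.
      (C', Q') \<noteq> (C, Q) \<and> C' \<ge> C \<and> Q' \<ge> Q)}"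

definition CE_tradeoff :: "real \<Rightarrow> (real \<times> real) set" where
  "CE_tradeoff p = {(C, E) \<in> CE_region p. \<not> (\<exists>(C', E') \<in> CE_region p.
      (C', E') \<noteq> (C, E) \<and> C' \<ge> C \<and> E' \<le> E)}"

end

(* The environment of k channel uses with input distribution d on {0,1}^k is in the state
   sum_i d_i |e_i><e_i|, where e_i is a product of k qubit states with pairwise overlap 1 or 1 - p.
   By purity its entropy is H(AB); it depends on the input only through d, and both H(B) and H(A)
   are at most the Shannon entropy of d.  So the converse is a lower bound for the environment
   entropy in terms of H(d), a quantum analogue of Mrs. Gerber's lemma.  For one letter it says that
   H2(gamma(mu)) is a convex increasing function of H2(mu).  Every tangent of that curve extends to
   k letters by induction, because conditioning on the first input letter instead of on the
   first environment qubit can only lower the entropy of the rest.  That last step is monotonicity of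
   the Holevo information; it is proved for resolvents by a variational argument and
   integrated to logarithms.  A uniform pair of bit-flipped states attains the bound. *)
theory Submission
  imports Defs "HOL-Real_Asymp.Real_Asymp"
begin

section \<open>Orthonormal families and spectral decompositions\<close>

text \<open>The single-letter curve enters only through affine minorants \<open>m * s + b\<close>
  with \<open>m \<ge> 0\<close>: such bounds add up over letters and survive the average over
  \<open>x\<close>; the curve is recovered at the end from its tangents. In the induction over
  letters the weights are not normalised, with correction terms \<open>eta\<close> of the total, so
  the hypothesis applies to each block as it is. Entropy is attached to kernels on finite index sets
  through their positive eigenvalues, so only scalars have logarithms. A relative entropy becomes a
  sum of \<open>ln (om j / tau)\<close> weighted by overlaps of two eigenbases; the ratios are
  eigenvalues of a relative modular operator, and a resolvent \<open>1 / (s + om j / tau)\<close>,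
  being a maximum of quadratic functionals, can be compared by inserting a test operator. For
  convexity, let \<open>r t\<close> be the Bloch radius of the environment qubit for input bias
  \<open>t\<close>. The logarithmic derivative of the slope is a positive factor times the
  difference of \<open>1 / (t * artanh t) - 1 / t^2\<close> at \<open>r t\<close> and at
  \<open>t\<close>. As \<open>t \<le> r t\<close>, it is enough that this function decreases, which
  is a quadratic inequality for \<open>artanh\<close>.\<close>

definition ip :: "'i set \<Rightarrow> ('i \<Rightarrow> complex) \<Rightarrow> ('i \<Rightarrow> complex) \<Rightarrow> complex" where
  "ip I f g = (\<Sum>a\<in>I. cnj (f a) * g a)"

definition nsq :: "'i set \<Rightarrow> ('i \<Rightarrow> complex) \<Rightarrow> real" where
  "nsq I f = (\<Sum>a\<in>I. (cmod (f a))\<^sup>2)"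

definition orthonormal :: "'i set \<Rightarrow> 'j set \<Rightarrow> ('j \<Rightarrow> 'i \<Rightarrow> complex) \<Rightarrow> bool" where
  "orthonormal I J w \<longleftrightarrow> (\<forall>j\<in>J. \<forall>l\<in>J. ip I (w j) (w l) = (if j = l then 1 else 0))"

text \<open>As an operator this is the mixture of the rank-one operators of the
  \<open>\<phi> t\<close> with weights \<open>c t\<close>. Bringing a state into this form with
  \<open>c \<ge> 0\<close> makes its positivity automatic.\<close>

definition gram :: "'t set \<Rightarrow> ('t \<Rightarrow> real) \<Rightarrow> ('t \<Rightarrow> 'i \<Rightarrow> complex) \<Rightarrow> 'i \<Rightarrow> 'i \<Rightarrow> complex" where
  "gram T c \<phi> a b = (\<Sum>t\<in>T. of_real (c t) * \<phi> t a * cnj (\<phi> t b))"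

definition eta :: "real \<Rightarrow> real" where
  "eta t = - t * log 2 t"

text \<open>Only the support is decomposed: the eigenvalue 0 has no vectors here, so
  \<open>w\<close> is orthonormal but in general not a basis.\<close>

definition spectral ::
  "'i set \<Rightarrow> ('i \<Rightarrow> 'i \<Rightarrow> complex) \<Rightarrow> 'j set \<Rightarrow> ('j \<Rightarrow> real) \<Rightarrow> ('j \<Rightarrow> 'i \<Rightarrow> complex) \<Rightarrow> bool" where
  "spectral I M J lam w \<longleftrightarrow> finite J \<and> (\<forall>j\<in>J. lam j > 0) \<and> orthonormal I J w
     \<and> (\<forall>a\<in>I. \<forall>b\<in>I. M a b = gram J lam w a b)"

text \<open>A relation, because existence and uniqueness of the value are theorems
  (\<open>gram_has_ent\<close>, \<open>has_ent_unique\<close>). The indices are natural numbers only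
  to keep a type variable out of the definition; \<open>spectral_has_ent\<close> admits every index
  type.\<close>

definition has_ent :: "'i set \<Rightarrow> ('i \<Rightarrow> 'i \<Rightarrow> complex) \<Rightarrow> real \<Rightarrow> bool" where
  "has_ent I M h \<longleftrightarrow> (\<exists>(J::nat set) lam w. spectral I M J lam w \<and> h = (\<Sum>j\<in>J. eta (lam j)))"

definition bf :: "'i set \<Rightarrow> ('i \<Rightarrow> 'i \<Rightarrow> complex) \<Rightarrow> ('i \<Rightarrow> complex) \<Rightarrow> ('i \<Rightarrow> complex) \<Rightarrow> complex" where
  "bf I M x y = (\<Sum>a\<in>I. \<Sum>b\<in>I. cnj (x a) * M a b * y b)"

lemma eta_0 [simp]: "eta 0 = 0" by (simp add: eta_def)
lemma eta_1 [simp]: "eta 1 = 0" by (simp add: eta_def)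

lemma eta_mult: "x \<ge> 0 \<Longrightarrow> y \<ge> 0 \<Longrightarrow> eta (x * y) = x * eta y + y * eta x"
  by (cases "x = 0 \<or> y = 0") (auto simp: eta_def log_mult algebra_simps)

lemma cnj_ip: "cnj (ip I f g) = ip I g f"
  by (simp add: ip_def mult.commute)

lemma norm_ip_commute: "cmod (ip I f g) = cmod (ip I g f)"
  by (metis cnj_ip complex_mod_cnj)

lemma ip_cong: "(\<And>a. a \<in> I \<Longrightarrow> f a = f' a) \<Longrightarrow> (\<And>a. a \<in> I \<Longrightarrow> g a = g' a) \<Longrightarrow> ip I f g = ip I f' g'"
  by (simp add: ip_def)

lemma ip_sum_right: "ip I f (\<lambda>a. \<Sum>t\<in>T. c t * g t a) = (\<Sum>t\<in>T. c t * ip I f (g t))"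
  unfolding ip_def by (simp add: sum_distrib_left mult_ac) (rule sum.swap)

lemma ip_sum_left: "ip I (\<lambda>a. \<Sum>t\<in>T. c t * g t a) f = (\<Sum>t\<in>T. cnj (c t) * ip I (g t) f)"
proof -
  have "ip I (\<lambda>a. \<Sum>t\<in>T. c t * g t a) f = cnj (ip I f (\<lambda>a. \<Sum>t\<in>T. c t * g t a))"
    by (simp add: cnj_ip)
  then show ?thesis by (simp add: ip_sum_right cnj_ip)
qed

lemma ip_diff_right: "ip I f (\<lambda>a. g a - h a) = ip I f g - ip I f h"
  by (simp add: ip_def algebra_simps sum_subtractf)

lemma ip_diff_left: "ip I (\<lambda>a. g a - h a) f = ip I g f - ip I h f"
  by (simp add: ip_def algebra_simps sum_subtractf)

lemma ip_self: "ip I f f = of_real (nsq I f)"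
  by (simp add: ip_def nsq_def complex_norm_square mult.commute del: of_real_power)

lemma nsq_nonneg: "nsq I f \<ge> 0"
  by (simp add: nsq_def sum_nonneg)

lemma nsq_eq_0: "finite I \<Longrightarrow> nsq I f = 0 \<Longrightarrow> a \<in> I \<Longrightarrow> f a = 0"
  by (simp add: nsq_def sum_nonneg_eq_0_iff)

lemma bf_gram:
  assumes "finite I" "finite T" "\<And>a b. a \<in> I \<Longrightarrow> b \<in> I \<Longrightarrow> M a b = gram T c \<phi> a b"
  shows "bf I M x y = (\<Sum>t\<in>T. of_real (c t) * ip I x (\<phi> t) * ip I (\<phi> t) y)"
proof -
  have "bf I M x y = (\<Sum>a\<in>I. \<Sum>b\<in>I. \<Sum>t\<in>T. of_real (c t) * (cnj (x a) * \<phi> t a) * (cnj (\<phi> t b) * y b))"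
    unfolding bf_def
    by (intro sum.cong refl) (simp add: assms(3) gram_def sum_distrib_left sum_distrib_right mult_ac)
  also have "\<dots> = (\<Sum>t\<in>T. \<Sum>a\<in>I. \<Sum>b\<in>I. of_real (c t) * (cnj (x a) * \<phi> t a) * (cnj (\<phi> t b) * y b))"
    by (subst sum.swap[where B = T], subst sum.swap[where B = T]) (rule refl)
  also have "\<dots> = (\<Sum>t\<in>T. of_real (c t) * ip I x (\<phi> t) * ip I (\<phi> t) y)"
    unfolding ip_def mult.assoc[of "of_real _" "sum _ _"] sum_product
    by (intro sum.cong refl) (simp add: mult.assoc sum_distrib_left)
  finally show ?thesis .
qed

lemma qf_gram:
  assumes "finite I" "finite T" "\<And>a b. a \<in> I \<Longrightarrow> b \<in> I \<Longrightarrow> M a b = gram T c \<phi> a b"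
  shows "bf I M x x = of_real (\<Sum>t\<in>T. c t * (cmod (ip I x (\<phi> t)))\<^sup>2)"
proof -
  have "of_real (c t) * ip I x (\<phi> t) * ip I (\<phi> t) x = of_real (c t * (cmod (ip I x (\<phi> t)))\<^sup>2)" for t
    using complex_norm_square[of "ip I x (\<phi> t)"] by (simp add: cnj_ip mult.assoc)
  moreover have "bf I M x x = (\<Sum>t\<in>T. of_real (c t) * ip I x (\<phi> t) * ip I (\<phi> t) x)"
    by (rule bf_gram[OF assms])
  ultimately show ?thesis by (simp only: of_real_sum)
qed

lemma
  assumes "finite I" "finite J" "orthonormal I J w"
  shows ip_residual: "l \<in> J \<Longrightarrow> ip I (w l) (\<lambda>a. \<phi> a - (\<Sum>j\<in>J. ip I (w j) \<phi> * w j a)) = 0"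
    and nsq_residual: "nsq I (\<lambda>a. \<phi> a - (\<Sum>j\<in>J. ip I (w j) \<phi> * w j a))
           = nsq I \<phi> - (\<Sum>j\<in>J. (cmod (ip I (w j) \<phi>))\<^sup>2)"
proof -
  have 1: "ip I (w l) (\<lambda>a. \<phi> a - (\<Sum>j\<in>J. ip I (w j) \<phi> * w j a)) = 0" if "l \<in> J" for l
  proof -
    have "(\<Sum>j\<in>J. ip I (w j) \<phi> * ip I (w l) (w j)) = (\<Sum>j\<in>J. if l = j then ip I (w j) \<phi> else 0)"
      using assms(3) that by (intro sum.cong) (auto simp: orthonormal_def)
    then show ?thesis
      using that assms(2) by (simp add: ip_diff_right ip_sum_right)
  qed
  then show "l \<in> J \<Longrightarrow> ip I (w l) (\<lambda>a. \<phi> a - (\<Sum>j\<in>J. ip I (w j) \<phi> * w j a)) = 0" .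
  let ?x = "\<lambda>a. \<phi> a - (\<Sum>j\<in>J. ip I (w j) \<phi> * w j a)"
  have "ip I ?x ?x = ip I \<phi> ?x - (\<Sum>j\<in>J. cnj (ip I (w j) \<phi>) * ip I (w j) ?x)"
    by (subst ip_diff_left) (simp add: ip_sum_left)
  also have "\<dots> = ip I \<phi> ?x"
    using 1 by simp
  also have "\<dots> = ip I \<phi> \<phi> - (\<Sum>j\<in>J. ip I (w j) \<phi> * cnj (ip I (w j) \<phi>))"
    by (simp add: ip_diff_right ip_sum_right cnj_ip)
  also have "\<dots> = of_real (nsq I \<phi> - (\<Sum>j\<in>J. (cmod (ip I (w j) \<phi>))\<^sup>2))"
    by (simp add: ip_self complex_norm_square del: of_real_power)
  finally show "nsq I ?x = nsq I \<phi> - (\<Sum>j\<in>J. (cmod (ip I (w j) \<phi>))\<^sup>2)"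
    by (simp only: ip_self of_real_eq_iff)
qed

lemma Bessel_inequality:
  assumes "finite I" "finite J" "orthonormal I J w"
  shows "(\<Sum>j\<in>J. (cmod (ip I (w j) \<phi>))\<^sup>2) \<le> nsq I \<phi>"
  using nsq_residual[OF assms, of \<phi>] nsq_nonneg[of I "\<lambda>a. \<phi> a - (\<Sum>j\<in>J. ip I (w j) \<phi> * w j a)"]
  by linarith

lemma spectralD:
  assumes "spectral I M J lam w"
  shows "finite J" "\<And>j. j \<in> J \<Longrightarrow> lam j > 0" "orthonormal I J w"
    "\<And>a b. a \<in> I \<Longrightarrow> b \<in> I \<Longrightarrow> M a b = gram J lam w a b"
  using assms by (auto simp: spectral_def)

lemma orthonormal_nsq: "orthonormal I J w \<Longrightarrow> j \<in> J \<Longrightarrow> nsq I (w j) = 1"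
  using ip_self[of I "w j"] by (simp add: orthonormal_def)

lemma bf_spectral:
  assumes "finite I" "spectral I M J lam w" "j \<in> J" "l \<in> J"
  shows "bf I M (w j) (w l) = (if j = l then of_real (lam j) else 0)"
proof -
  note S = spectralD[OF assms(2)]
  have "bf I M (w j) (w l) = (\<Sum>t\<in>J. of_real (lam t) * ip I (w j) (w t) * ip I (w t) (w l))"
    by (rule bf_gram[OF assms(1) S(1) S(4)])
  also have "\<dots> = (\<Sum>t\<in>J. if t = j then (if j = l then of_real (lam j) else 0) else 0)"
    using S(3) assms(3,4) by (intro sum.cong) (auto simp: orthonormal_def)
  finally show ?thesis using assms(3) S(1) by simp
qed

text \<open>The residual of \<open>\<phi> t\<close> after projecting to the support is annihilated by \<open>M\<close>, hence
  orthogonal to \<open>\<phi> t\<close>.\<close>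
lemma
  assumes fin: "finite I" "finite T" and sp: "spectral I M J lam w"
    and M: "\<And>a b. a \<in> I \<Longrightarrow> b \<in> I \<Longrightarrow> M a b = gram T c \<phi> a b"
    and c: "\<And>t. t \<in> T \<Longrightarrow> c t \<ge> 0" and t: "t \<in> T" "c t > 0"
  shows support_expansion: "\<And>a. a \<in> I \<Longrightarrow> \<phi> t a = (\<Sum>j\<in>J. ip I (w j) (\<phi> t) * w j a)"
    and support_nsq: "nsq I (\<phi> t) = (\<Sum>j\<in>J. (cmod (ip I (w j) (\<phi> t)))\<^sup>2)"
proof -
  note S = spectralD[OF sp]
  define x where "x = (\<lambda>a. \<phi> t a - (\<Sum>j\<in>J. ip I (w j) (\<phi> t) * w j a))"
  have x0: "ip I (w j) x = 0" if "j \<in> J" for j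
    unfolding x_def by (rule ip_residual[OF fin(1) S(1,3) that])
  then have x0': "ip I x (w j) = 0" if "j \<in> J" for j
    by (metis that cnj_ip complex_cnj_zero)
  have "bf I M x x = of_real (\<Sum>j\<in>J. lam j * (cmod (ip I x (w j)))\<^sup>2)"
    by (rule qf_gram[OF fin(1) S(1) S(4)])
  also have "\<dots> = 0" by (simp add: x0')
  finally have "(\<Sum>s\<in>T. c s * (cmod (ip I x (\<phi> s)))\<^sup>2) = 0"
    by (simp only: qf_gram[OF fin M] of_real_eq_0_iff)
  then have "\<forall>s\<in>T. c s * (cmod (ip I x (\<phi> s)))\<^sup>2 = 0"
    by (subst (asm) sum_nonneg_eq_0_iff) (use fin c in auto)
  then have xt: "ip I x (\<phi> t) = 0" using t by auto
  have "ip I x x = ip I x (\<phi> t) - (\<Sum>j\<in>J. ip I (w j) (\<phi> t) * ip I x (w j))"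
    by (subst (2) x_def) (simp add: ip_diff_right ip_sum_right)
  then have n0: "nsq I x = 0" by (simp add: xt x0' ip_self)
  show "\<phi> t a = (\<Sum>j\<in>J. ip I (w j) (\<phi> t) * w j a)" if "a \<in> I" for a
    using nsq_eq_0[OF fin(1) n0 that] by (simp add: x_def)
  show "nsq I (\<phi> t) = (\<Sum>j\<in>J. (cmod (ip I (w j) (\<phi> t)))\<^sup>2)"
    using nsq_residual[OF fin(1) S(1,3), of "\<phi> t"] n0 by (simp add: x_def)
qed

lemma spectral_eigenvalue:
  assumes fin: "finite I" "finite T" and sp: "spectral I M J lam w"
    and M: "\<And>a b. a \<in> I \<Longrightarrow> b \<in> I \<Longrightarrow> M a b = gram T c \<phi> a b" and j: "j \<in> J"
  shows "lam j = (\<Sum>t\<in>T. c t * (cmod (ip I (w j) (\<phi> t)))\<^sup>2)"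
  using qf_gram[OF fin M, of "w j"] bf_spectral[OF fin(1) sp j j]
  by (simp only: simp_thms if_True of_real_eq_iff)

section \<open>Entropy bounds from the tangents of \<open>eta\<close>\<close>

lemma eta_le_tangent:
  assumes "x \<ge> 0" "y > 0"
  shows "eta x \<le> - x * log 2 y + (y - x) / ln 2"
proof (cases "x = 0")
  case False
  then have x: "x > 0" using assms by simp
  have "ln (y / x) \<le> y / x - 1" using x assms(2) by (intro ln_le_minus_one) simp
  then have "x * ln (y / x) \<le> y - x" using x by (simp add: field_simps)
  then have "- x * ln x \<le> - x * ln y + (y - x)"
    using x assms(2) by (simp add: ln_div algebra_simps)
  then have "(- x * ln x) / ln 2 \<le> (- x * ln y + (y - x)) / ln 2"
    by (intro divide_right_mono) auto
  then show ?thesis by (simp add: eta_def log_def add_divide_distrib diff_divide_distrib)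
qed (use assms in auto)

text \<open>Schrodinger's mixture bound: the coefficients of the decomposition in an eigenbasis
  form a doubly substochastic matrix, so concavity of \<open>eta\<close> applies.\<close>
lemma spectral_entropy_le:
  assumes fin: "finite I" "finite T" and sp: "spectral I M J lam w"
    and M: "\<And>a b. a \<in> I \<Longrightarrow> b \<in> I \<Longrightarrow> M a b = gram T (\<lambda>_. 1) \<phi> a b"
  shows "(\<Sum>j\<in>J. eta (lam j)) \<le> (\<Sum>t\<in>T. eta (nsq I (\<phi> t)))"
proof -
  note S = spectralD[OF sp]
  \<comment> \<open>Division by \<open>sqrt (lam j)\<close> makes the overlap matrix a coisometry:
    \<open>M\<close> is diagonal with entries \<open>lam j\<close> in the vectors
    \<open>w j\<close>, so the rows \<open>u j\<close> are orthonormal over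
    \<open>T\<close>.\<close>
  define u where "u j t = ip I (w j) (\<phi> t) / of_real (sqrt (lam j))" for j t
  define q where "q t j = (cmod (ip I (w j) (\<phi> t)))\<^sup>2 / lam j" for t j
  have q_u: "(cmod (u j t))\<^sup>2 = q t j" if "j \<in> J" for j t
    using S(2)[OF that] by (simp add: u_def q_def norm_divide power_divide)
  have q0: "q t j \<ge> 0" if "j \<in> J" for t j
    using S(2)[OF that] by (simp add: q_def)
  have "orthonormal T J (\<lambda>j t. u j t)"
    unfolding orthonormal_def
  proof (intro ballI)
    fix j l assume jl: "j \<in> J" "l \<in> J"
    have "ip T (u j) (u l) = (\<Sum>t\<in>T. 1 * ip I (w l) (\<phi> t) * ip I (\<phi> t) (w j))
            / of_real (sqrt (lam j) * sqrt (lam l))"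
      unfolding ip_def[of T] u_def sum_divide_distrib
      by (intro sum.cong) (auto simp: cnj_ip field_simps)
    also have "\<dots> = bf I M (w l) (w j) / of_real (sqrt (lam j) * sqrt (lam l))"
      using bf_gram[OF fin M, of "w l" "w j"] by simp
    also have "\<dots> = (if j = l then 1 else 0)"
      using S(2)[OF jl(1)] by (auto simp: bf_spectral[OF fin(1) sp jl(2,1)] simp flip: of_real_mult)
    finally show "ip T (u j) (u l) = (if j = l then 1 else 0)" .
  qed
  note B = Bessel_inequality[OF fin(2) S(1) this]
  \<comment> \<open>Bessel's inequality for the coordinate vector at \<open>t\<close>: a column of a
    matrix with orthonormal rows has norm at most 1, and less than 1 is possible when the
    \<open>\<phi> t\<close> are linearly dependent.\<close>
  have qle: "(\<Sum>j\<in>J. q t j) \<le> 1" if t: "t \<in> T" for t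
  proof -
    have "ip T (u j) (\<lambda>s. if s = t then 1 else 0) = cnj (u j t)" for j
      using t fin(2) by (simp add: ip_def if_distrib[of "\<lambda>x. _ * x"] cong: if_cong)
    moreover have "nsq T (\<lambda>s. if s = t then 1 else 0) = 1"
      using t fin(2) by (simp add: nsq_def if_distrib[of cmod] if_distrib[of "\<lambda>x. x\<^sup>2"] cong: if_cong)
    ultimately show ?thesis
      using B[of "\<lambda>s. if s = t then 1 else 0"] by (simp add: q_u)
  qed
  have qsum: "(\<Sum>t\<in>T. q t j) = 1" if j: "j \<in> J" for j
    using spectral_eigenvalue[OF fin sp M j] S(2)[OF j] by (simp add: q_def flip: sum_divide_distrib)
  have d: "nsq I (\<phi> t) = (\<Sum>j\<in>J. q t j * lam j)" if t: "t \<in> T" for t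
  proof -
    have "nsq I (\<phi> t) = (\<Sum>j\<in>J. (cmod (ip I (w j) (\<phi> t)))\<^sup>2)"
      by (rule support_nsq[OF fin sp M]) (use t in auto)
    also have "\<dots> = (\<Sum>j\<in>J. q t j * lam j)"
      using S(2) by (intro sum.cong) (auto simp: q_def dest!: S(2))
    finally show ?thesis .
  qed
  have key: "(\<Sum>j\<in>J. q t j * eta (lam j)) \<le> eta (nsq I (\<phi> t))" if t: "t \<in> T" for t
  proof (cases "nsq I (\<phi> t) = 0")
    case True
    then have "(\<Sum>j\<in>J. q t j * lam j) = 0"
      using d[OF t] by simp
    then have "\<forall>j\<in>J. q t j * lam j = 0"
      by (subst (asm) sum_nonneg_eq_0_iff) (use S(1) q0 less_imp_le[OF S(2)] in auto)
    then have "\<forall>j\<in>J. q t j = 0" using S(2) by fastforce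
    then show ?thesis using True by simp
  next
    case False
    let ?D = "nsq I (\<phi> t)"
    have D: "?D > 0" using False nsq_nonneg[of I "\<phi> t"] by linarith
    have "(\<Sum>j\<in>J. q t j * eta (lam j)) \<le> (\<Sum>j\<in>J. q t j * (- lam j * log 2 ?D + (?D - lam j) / ln 2))"
      using q0 S(2) D by (intro sum_mono mult_left_mono eta_le_tangent) (auto intro: less_imp_le)
    also have "\<dots> = (\<Sum>j\<in>J. - log 2 ?D * (q t j * lam j) + ?D / ln 2 * q t j - (q t j * lam j) / ln 2)"
      by (intro sum.cong) (auto simp: field_simps)
    also have "\<dots> = - log 2 ?D * ?D + ?D / ln 2 * (\<Sum>j\<in>J. q t j) - ?D / ln 2"
      unfolding d[OF t] by (simp add: sum_negf sum.distrib sum_subtractf sum_distrib_left sum_divide_distrib)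
    \<comment> \<open>A sum of \<open>q t j\<close> below 1 does no harm: it enters the tangent
      bound with the nonnegative coefficient \<open>?D / ln 2\<close>.\<close>
    also have "\<dots> \<le> - log 2 ?D * ?D + ?D / ln 2 * 1 - ?D / ln 2"
      using mult_left_mono[OF qle[OF t], of "?D / ln 2"] D by simp
    finally show ?thesis by (simp add: eta_def mult.commute)
  qed
  have "(\<Sum>j\<in>J. eta (lam j)) = (\<Sum>j\<in>J. (\<Sum>t\<in>T. q t j) * eta (lam j))"
    by (simp add: qsum)
  also have "\<dots> = (\<Sum>t\<in>T. \<Sum>j\<in>J. q t j * eta (lam j))"
    by (simp add: sum_distrib_right) (rule sum.swap)
  also have "\<dots> \<le> (\<Sum>t\<in>T. eta (nsq I (\<phi> t)))"
    by (intro sum_mono key)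
  finally show ?thesis .
qed

section \<open>Entropy as an invariant of the kernel\<close>

lemma spectral_has_ent:
  fixes J :: "'j set"
  assumes "spectral I M J lam w"
  shows "has_ent I M (\<Sum>j\<in>J. eta (lam j))"
proof -
  note S = spectralD[OF assms]
  obtain f where f: "bij_betw f {..<card J} J"
    using ex_bij_betw_nat_finite[OF S(1)] by (auto simp: lessThan_atLeast0)
  have fJ: "f i \<in> J" if "i < card J" for i using bij_betwE[OF f] that by simp
  have inj: "f i = f k \<longleftrightarrow> i = k" if "i < card J" "k < card J" for i k
    using bij_betw_imp_inj_on[OF f] that by (auto simp: inj_on_def)
  have "spectral I M {..<card J} (\<lambda>i. lam (f i)) (\<lambda>i. w (f i))"
    unfolding spectral_def
  proof (intro conjI ballI)
    show "orthonormal I {..<card J} (\<lambda>i. w (f i))"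
      using S(3) fJ inj by (auto simp: orthonormal_def)
    show "M a b = gram {..<card J} (\<lambda>i. lam (f i)) (\<lambda>i. w (f i)) a b" if "a \<in> I" "b \<in> I" for a b
      unfolding S(4)[OF that] gram_def by (rule sum.reindex_bij_betw[OF f, symmetric])
  qed (use S(2) fJ in auto)
  moreover have "(\<Sum>j\<in>J. eta (lam j)) = (\<Sum>i<card J. eta (lam (f i)))"
    by (rule sum.reindex_bij_betw[OF f, symmetric])
  ultimately show ?thesis unfolding has_ent_def by blast
qed

lemma has_ent_cong:
  assumes "has_ent I M h" "\<And>a b. a \<in> I \<Longrightarrow> b \<in> I \<Longrightarrow> N a b = M a b"
  shows "has_ent I N h"
  using assms unfolding has_ent_def spectral_def by fastforce

lemma has_ent_le:
  assumes "finite I" "finite T" "has_ent I M h"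
    and "\<And>a b. a \<in> I \<Longrightarrow> b \<in> I \<Longrightarrow> M a b = gram T (\<lambda>_. 1) \<phi> a b"
  shows "h \<le> (\<Sum>t\<in>T. eta (nsq I (\<phi> t)))"
  using assms(3) spectral_entropy_le[OF assms(1,2) _ assms(4)] unfolding has_ent_def by blast

text \<open>Moves the eigenvalues into the vectors, which gives the unweighted mixtures that
  \<open>has_ent_le\<close> expects.\<close>

lemma spectral_sqrt:
  assumes "spectral I M J lam w"
  shows "\<And>a b. a \<in> I \<Longrightarrow> b \<in> I \<Longrightarrow> M a b = gram J (\<lambda>_. 1) (\<lambda>j a. of_real (sqrt (lam j)) * w j a) a b"
    and "\<And>j. j \<in> J \<Longrightarrow> nsq I (\<lambda>a. of_real (sqrt (lam j)) * w j a) = lam j"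
proof -
  note S = spectralD[OF assms]
  have sq: "of_real (sqrt (lam j)) * of_real (sqrt (lam j)) = complex_of_real (lam j)" if "j \<in> J" for j
    using S(2)[OF that] by (simp flip: of_real_mult)
  show "M a b = gram J (\<lambda>_. 1) (\<lambda>j a. of_real (sqrt (lam j)) * w j a) a b" if "a \<in> I" "b \<in> I" for a b
    unfolding S(4)[OF that] gram_def
    by (intro sum.cong refl) (simp add: sq[symmetric] mult_ac)
  show "nsq I (\<lambda>a. of_real (sqrt (lam j)) * w j a) = lam j" if "j \<in> J" for j
    using orthonormal_nsq[OF S(3) that] S(2)[OF that]
    by (simp add: nsq_def norm_mult power_mult_distrib flip: sum_distrib_left)
qed

text \<open>The eigenvectors of one decomposition, scaled by the roots of their eigenvalues, are a
  mixture for the same kernel, so the mixture bound holds in both directions.\<close>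

lemma has_ent_unique:
  assumes "finite I" "has_ent I M h" "has_ent I M h'"
  shows "h = h'"
proof -
  have le: "h \<le> h'" if hh: "has_ent I M h" "has_ent I M h'" for h h'
  proof -
    from hh(2) obtain J :: "nat set" and lam w where sp: "spectral I M J lam w" and h': "h' = (\<Sum>j\<in>J. eta (lam j))"
      unfolding has_ent_def by blast
    show ?thesis
      using has_ent_le[OF assms(1) spectralD(1)[OF sp] hh(1) spectral_sqrt(1)[OF sp]]
      by (simp add: h' spectral_sqrt(2)[OF sp])
  qed
  show ?thesis using le[OF assms(2,3)] le[OF assms(3,2)] by simp
qed

text \<open>The second kernel is the matrix of inner products of the \<open>\<phi> t\<close>.
  Expanding them in the eigenvectors of the first kernel turns it into a mixture of vectors with
  square norms \<open>lam j\<close>, to which the mixture bound applies. With the roles exchanged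
  this yields equality: the two marginals of a pure state have the same entropy.\<close>

lemma has_ent_dual_le:
  assumes "finite I" "finite T" "has_ent I (gram T (\<lambda>_. 1) \<phi>) h"
    and "has_ent T (gram I (\<lambda>_. 1) (\<lambda>a t. cnj (\<phi> t a))) h'"
  shows "h' \<le> h"
proof -
  from assms(3) obtain J :: "nat set" and lam w where sp: "spectral I (gram T (\<lambda>_. 1) \<phi>) J lam w"
    and h: "h = (\<Sum>j\<in>J. eta (lam j))"
    unfolding has_ent_def by blast
  note S = spectralD[OF sp]
  have "h' \<le> (\<Sum>j\<in>J. eta (nsq T (\<lambda>t. ip I (\<phi> t) (w j))))"
  proof (rule has_ent_le[OF assms(2) S(1) assms(4)])
    fix s t assume st: "s \<in> T" "t \<in> T"
    have "gram I (\<lambda>_. 1) (\<lambda>a t. cnj (\<phi> t a)) s t = ip I (\<phi> s) (\<phi> t)"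
      by (simp add: gram_def ip_def)
    also have "\<dots> = ip I (\<phi> s) (\<lambda>a. \<Sum>j\<in>J. ip I (w j) (\<phi> t) * w j a)"
      by (intro ip_cong refl support_expansion[OF assms(1,2) sp, where c = "\<lambda>_. 1"]) (use st in auto)
    also have "\<dots> = gram J (\<lambda>_. 1) (\<lambda>j t. ip I (\<phi> t) (w j)) s t"
      unfolding ip_sum_right by (simp add: gram_def cnj_ip mult.commute)
    finally show "gram I (\<lambda>_. 1) (\<lambda>a t. cnj (\<phi> t a)) s t = gram J (\<lambda>_. 1) (\<lambda>j t. ip I (\<phi> t) (w j)) s t" .
  qed
  moreover have "nsq T (\<lambda>t. ip I (\<phi> t) (w j)) = lam j" if "j \<in> J" for j
    using spectral_eigenvalue[OF assms(1,2) sp refl that]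
    by (simp add: nsq_def norm_ip_commute[of I _ "w j"])
  ultimately show ?thesis by (simp add: h)
qed

lemma has_ent_dual:
  assumes "finite I" "finite T" "has_ent I (gram T (\<lambda>_. 1) \<phi>) h"
    and "has_ent T (gram I (\<lambda>_. 1) (\<lambda>a t. cnj (\<phi> t a))) h'"
  shows "h = h'"
proof (rule antisym)
  show "h \<le> h'" using has_ent_dual_le[OF assms(2,1,4), of h] assms(3) by simp
qed (rule has_ent_dual_le[OF assms])

text \<open>For \<open>M = K K\<^sup>*\<close> with \<open>K = W \<surd>\<Lambda>\<close>, the rows of \<open>K\<close> decompose the diagonal matrix \<open>K\<^sup>* K = \<Lambda>\<close>.\<close>
lemma has_ent_le_diagonal:
  assumes "finite I" "has_ent I M h"
  shows "h \<le> (\<Sum>a\<in>I. eta (Re (M a a)))"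
proof -
  from assms(2) obtain J :: "nat set" and lam w where sp: "spectral I M J lam w"
    and h: "h = (\<Sum>j\<in>J. eta (lam j))"
    unfolding has_ent_def by blast
  note S = spectralD[OF sp]
  define N where "N j l = (if j = l then complex_of_real (lam j) else 0)" for j l :: nat
  define \<psi> where "\<psi> a j = of_real (sqrt (lam j)) * cnj (w j a)" for a j
  have spN: "spectral J N J lam (\<lambda>j l. if l = j then 1 else 0)"
    unfolding spectral_def
  proof (intro conjI ballI)
    show "orthonormal J J (\<lambda>j l. if l = j then 1 else 0)"
      unfolding orthonormal_def ip_def
      using S(1) by (simp add: if_distrib[of cnj] if_distrib[of "\<lambda>x. x * _"] cong: if_cong)
    show "N j l = gram J lam (\<lambda>j l. if l = j then 1 else 0) j l" if "j \<in> J" "l \<in> J" for j l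
      using that S(1)
      by (simp add: N_def gram_def if_distrib[of cnj] if_distrib[of "\<lambda>x. _ * x"] if_distrib[of "\<lambda>x. x * _"] cong: if_cong)
  qed (use S in auto)
  have N: "N j l = gram I (\<lambda>_. 1) \<psi> j l" if "j \<in> J" "l \<in> J" for j l
  proof -
    have "gram I (\<lambda>_. 1) \<psi> j l = of_real (sqrt (lam j)) * of_real (sqrt (lam l)) * ip I (w j) (w l)"
      by (simp add: gram_def \<psi>_def ip_def sum_distrib_left mult_ac)
    also have "\<dots> = N j l"
      using S(3) S(2)[OF that(1)] that by (auto simp: orthonormal_def N_def simp flip: of_real_mult)
    finally show ?thesis ..
  qed
  have "h \<le> (\<Sum>a\<in>I. eta (nsq J (\<psi> a)))"
    unfolding h by (rule spectral_entropy_le[OF S(1) assms(1) spN N])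
  moreover have "nsq J (\<psi> a) = Re (M a a)" if "a \<in> I" for a
  proof -
    have "of_real (lam j) * w j a * cnj (w j a) = of_real ((cmod (\<psi> a j))\<^sup>2)" if "j \<in> J" for j
      using S(2)[OF that]
      by (simp add: \<psi>_def norm_mult power_mult_distrib mult.assoc complex_norm_square del: of_real_power)
    then have "M a a = of_real (nsq J (\<psi> a))"
      unfolding S(4)[OF that that] gram_def nsq_def by simp
    then show ?thesis by simp
  qed
  ultimately show ?thesis by simp
qed

section \<open>Reindexing, traces and classical-quantum states\<close>

lemma has_ent_reindex:
  assumes "bij_betw f I' I" "has_ent I M h"
  shows "has_ent I' (\<lambda>a b. M (f a) (f b)) h"
proof -
  from assms(2) obtain J :: "nat set" and lam w where sp: "spectral I M J lam w"
    and h: "h = (\<Sum>j\<in>J. eta (lam j))"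
    unfolding has_ent_def by blast
  note S = spectralD[OF sp]
  have "spectral I' (\<lambda>a b. M (f a) (f b)) J lam (\<lambda>j a. w j (f a))"
    unfolding spectral_def
  proof (intro conjI ballI)
    have "ip I' (\<lambda>a. w j (f a)) (\<lambda>a. w l (f a)) = ip I (w j) (w l)" for j l
      unfolding ip_def by (rule sum.reindex_bij_betw[OF assms(1)])
    then show "orthonormal I' J (\<lambda>j a. w j (f a))"
      using S(3) by (simp add: orthonormal_def)
  qed (use S bij_betwE[OF assms(1)] in \<open>auto simp: gram_def\<close>)
  then show ?thesis using h unfolding has_ent_def by blast
qed

lemma spectral_trace:
  assumes "spectral I M J lam w"
  shows "(\<Sum>a\<in>I. M a a) = of_real (\<Sum>j\<in>J. lam j)"
proof -
  note S = spectralD[OF assms]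
  have "(\<Sum>a\<in>I. M a a) = (\<Sum>a\<in>I. \<Sum>j\<in>J. of_real (lam j) * (cnj (w j a) * w j a))"
    using S(4) by (intro sum.cong refl) (simp add: gram_def mult_ac)
  also have "\<dots> = (\<Sum>j\<in>J. of_real (lam j) * ip I (w j) (w j))"
    by (subst sum.swap) (simp add: ip_def sum_distrib_left)
  also have "\<dots> = of_real (\<Sum>j\<in>J. lam j)"
    using S(3) by (simp add: orthonormal_def)
  finally show ?thesis .
qed

lemma eta_nonneg: "0 \<le> x \<Longrightarrow> x \<le> 1 \<Longrightarrow> eta x \<ge> 0"
  by (cases "x = 0") (auto simp: eta_def mult_le_0_iff)

lemma has_ent_nonneg:
  assumes "has_ent I M h" "(\<Sum>a\<in>I. M a a) = 1"
  shows "h \<ge> 0"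
proof -
  from assms(1) obtain J :: "nat set" and lam w where sp: "spectral I M J lam w"
    and h: "h = (\<Sum>j\<in>J. eta (lam j))"
    unfolding has_ent_def by blast
  note S = spectralD[OF sp]
  have 1: "(\<Sum>j\<in>J. lam j) = 1"
    using spectral_trace[OF sp] assms(2) by (metis of_real_eq_1_iff)
  have "lam j \<le> 1" if "j \<in> J" for j
    using member_le_sum[OF that, of lam] S(1,2) 1 by (fastforce intro: less_imp_le)
  then show ?thesis unfolding h using S(2) by (intro sum_nonneg eta_nonneg) (auto intro: less_imp_le)
qed

lemma Shannon_entropy_le:
  assumes "finite I" "\<And>i. i \<in> I \<Longrightarrow> d i \<ge> 0" "(\<Sum>i\<in>I. d i) = 1"
  shows "(\<Sum>i\<in>I. eta (d i)) \<le> log 2 (card I)"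
proof -
  have c: "card I > 0" using assms by (auto simp: card_gt_0_iff)
  have "(\<Sum>i\<in>I. eta (d i)) \<le> (\<Sum>i\<in>I. - d i * log 2 (1 / card I) + (1 / card I - d i) / ln 2)"
    using assms c by (intro sum_mono eta_le_tangent) auto
  also have "\<dots> = - (\<Sum>i\<in>I. d i) * log 2 (1 / card I) + ((\<Sum>i\<in>I. 1 / card I) - (\<Sum>i\<in>I. d i)) / ln 2"
    by (simp add: sum.distrib sum_negf sum_subtractf sum_distrib_right flip: sum_divide_distrib)
  also have "\<dots> = log 2 (card I)"
    using c assms(3) by (simp add: log_divide)
  finally show ?thesis .
qed

text \<open>The eigenvectors of the blocks, extended by zero, diagonalise the whole kernel with
  eigenvalues \<open>p x * lam x j\<close>. The entropy splits by the product rule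
  \<open>eta_mult\<close>, since each block has trace 1.\<close>

lemma has_ent_block:
  assumes X: "finite X" and I: "finite I"
    and p: "\<And>x. x \<in> X \<Longrightarrow> p x \<ge> 0"
    and M: "\<And>x. x \<in> X \<Longrightarrow> has_ent I (M x) (h x)"
    and tr: "\<And>x. x \<in> X \<Longrightarrow> (\<Sum>a\<in>I. M x a a) = 1"
  shows "has_ent (X \<times> I) (\<lambda>(x,a) (y,b). if x = y then of_real (p x) * M x a b else 0)
           ((\<Sum>x\<in>X. eta (p x)) + (\<Sum>x\<in>X. p x * h x))"
proof -
  have "\<forall>x. \<exists>(J::nat set) lam w. x \<in> X \<longrightarrow> spectral I (M x) J lam w \<and> h x = (\<Sum>j\<in>J. eta (lam j))"
    using M unfolding has_ent_def by metis
  then obtain J :: "_ \<Rightarrow> nat set" and lam w where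
    sp: "\<And>x. x \<in> X \<Longrightarrow> spectral I (M x) (J x) (lam x) (w x)"
    and h: "\<And>x. x \<in> X \<Longrightarrow> h x = (\<Sum>j\<in>J x. eta (lam x j))"
    by metis
  note S = spectralD[OF sp]
  \<comment> \<open>Blocks of weight 0 are left out because \<open>spectral\<close> wants positive
    eigenvalues; they add nothing to the kernel or to the entropy.\<close>
  let ?X = "{x \<in> X. p x > 0}"
  let ?M = "\<lambda>(x,a) (y,b). if x = y then of_real (p x) * M x a b else 0"
  let ?w = "\<lambda>(x,j) (y,a). if y = x then w x j a else 0"
  have "spectral (X \<times> I) ?M (Sigma ?X J) (\<lambda>(x,j). p x * lam x j) ?w"
    unfolding spectral_def
  proof (intro conjI ballI)
    show "finite (Sigma ?X J)" using X S(1) by auto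
    show "0 < (case j of (x, j) \<Rightarrow> p x * lam x j)" if "j \<in> Sigma ?X J" for j
      using that S(2) by auto
    show "orthonormal (X \<times> I) (Sigma ?X J) ?w"
      unfolding orthonormal_def
    proof (intro ballI)
      fix s t assume "s \<in> Sigma ?X J" "t \<in> Sigma ?X J"
      then obtain x j y l where st: "s = (x,j)" "t = (y,l)"
        and *: "x \<in> X" "p x > 0" "j \<in> J x" "y \<in> X" "p y > 0" "l \<in> J y" by auto
      have "ip (X \<times> I) (?w (x,j)) (?w (y,l)) = (\<Sum>z\<in>X. if z = x then (if x = y then ip I (w x j) (w x l) else 0) else 0)"
        unfolding ip_def sum.cartesian_product' by (intro sum.cong) auto
      also have "\<dots> = (if (x,j) = (y,l) then 1 else 0)"
        using * X S(3)[OF *(1)] by (auto simp: orthonormal_def)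
      finally show "ip (X \<times> I) (?w s) (?w t) = (if s = t then 1 else 0)"
        unfolding st .
    qed
    fix r c assume "r \<in> X \<times> I" "c \<in> X \<times> I"
    then obtain x a y b where rc: "r = (x,a)" "c = (y,b)" "x \<in> X" "a \<in> I" "y \<in> X" "b \<in> I" by auto
    have "gram (Sigma ?X J) (\<lambda>(x,j). p x * lam x j) ?w r c
      = (\<Sum>z\<in>?X. \<Sum>j\<in>J z. of_real (p z * lam z j) * ?w (z,j) (x,a) * cnj (?w (z,j) (y,b)))"
      unfolding gram_def rc by (subst sum.Sigma) (use X S(1) in \<open>auto intro!: sum.cong\<close>)
    also have "\<dots> = (\<Sum>z\<in>?X. if z = x then (if x = y then of_real (p x) * gram (J x) (lam x) (w x) a b else 0) else 0)"
      by (intro sum.cong refl) (auto simp: gram_def sum_distrib_left mult_ac)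
    also have "\<dots> = ?M r c"
      using rc X S(4)[of x a b] p[of x] by (cases "p x = 0") auto
    finally show "?M r c = gram (Sigma ?X J) (\<lambda>(x,j). p x * lam x j) ?w r c" ..
  qed
  note R = spectral_has_ent[OF this]
  have tr1: "(\<Sum>j\<in>J x. lam x j) = 1" if "x \<in> X" for x
    using spectral_trace[OF sp[OF that]] tr[OF that] by (metis of_real_eq_1_iff)
  have "(\<Sum>r\<in>Sigma ?X J. eta (case r of (x,j) \<Rightarrow> p x * lam x j))
      = (\<Sum>x\<in>?X. \<Sum>j\<in>J x. eta (p x * lam x j))"
    by (subst sum.Sigma) (use X S(1) in \<open>auto intro!: sum.cong\<close>)
  also have "\<dots> = (\<Sum>x\<in>?X. eta (p x) + p x * h x)"
  proof (intro sum.cong refl)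
    fix x assume x: "x \<in> ?X"
    have "(\<Sum>j\<in>J x. eta (p x * lam x j)) = (\<Sum>j\<in>J x. p x * eta (lam x j) + lam x j * eta (p x))"
      using x S(2)[of x] by (intro sum.cong refl eta_mult) (auto intro: less_imp_le)
    then show "(\<Sum>j\<in>J x. eta (p x * lam x j)) = eta (p x) + p x * h x"
      using x tr1[of x] h[of x] by (simp add: sum.distrib sum_distrib_left flip: sum_distrib_right)
  qed
  also have "\<dots> = (\<Sum>x\<in>X. eta (p x) + p x * h x)"
    using X p by (intro sum.mono_neutral_left ballI) (auto simp: not_less dest!: antisym[of "p _" 0])
  finally show ?thesis using R by (simp add: sum.distrib)
qed

lemma has_ent_diag:
  assumes X: "finite X" and p: "\<And>x. x \<in> X \<Longrightarrow> p x \<ge> 0"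
  shows "has_ent X (\<lambda>x y. if x = y then of_real (p x) else 0) (\<Sum>x\<in>X. eta (p x))"
proof -
  let ?X = "{x \<in> X. p x > 0}"
  have "spectral X (\<lambda>x y. if x = y then of_real (p x) else 0) ?X p (\<lambda>x y. if y = x then 1 else 0)"
    unfolding spectral_def
  proof (intro conjI ballI)
    show "orthonormal X ?X (\<lambda>x y. if y = x then 1 else 0)"
      unfolding orthonormal_def ip_def
      using X by (simp add: if_distrib[of cnj] if_distrib[of "\<lambda>x. x * _"] cong: if_cong)
    show "(if x = y then of_real (p x) else 0) = gram ?X p (\<lambda>x y. if y = x then 1 else 0) x y"
      if "x \<in> X" "y \<in> X" for x y
      using that X p[of x] by (cases "p x = 0")
        (auto simp: gram_def if_distrib[of cnj] if_distrib[of "\<lambda>x. _ * x"] if_distrib[of "\<lambda>x. x * _"] cong: if_cong)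
  qed (use X in auto)
  note R = spectral_has_ent[OF this]
  have "(\<Sum>x\<in>?X. eta (p x)) = (\<Sum>x\<in>X. eta (p x))"
    using X p by (intro sum.mono_neutral_left ballI) (auto simp: not_less dest!: antisym[of "p _" 0])
  then show ?thesis using R by simp
qed

section \<open>Monotonicity of the Holevo information\<close>

text \<open>Integrating the hypothesis over \<open>s\<close> gives differences of logarithms; the boundary term at
  infinity vanishes because both sides have the same total weight.\<close>
lemma sum_ln_mono_of_resolvent:
  fixes a \<alpha> :: "'a \<Rightarrow> real" and b \<beta> :: "'b \<Rightarrow> real"
  assumes \<alpha>: "\<And>i. i \<in> A \<Longrightarrow> \<alpha> i > 0" and \<beta>: "\<And>i. i \<in> B \<Longrightarrow> \<beta> i > 0"
    and eq: "sum a A = sum b B"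
    and le: "\<And>s. s > 0 \<Longrightarrow> (\<Sum>i\<in>B. b i / (s + \<beta> i)) \<le> (\<Sum>i\<in>A. a i / (s + \<alpha> i))"
  shows "(\<Sum>i\<in>A. a i * ln (\<alpha> i)) \<le> (\<Sum>i\<in>B. b i * ln (\<beta> i))"
proof -
  define \<Phi> where "\<Phi> s = (\<Sum>i\<in>A. a i * ln (s + \<alpha> i)) - (\<Sum>i\<in>B. b i * ln (s + \<beta> i))" for s
  define \<Phi>' where "\<Phi>' s = (\<Sum>i\<in>A. a i / (s + \<alpha> i)) - (\<Sum>i\<in>B. b i / (s + \<beta> i))" for s
  have D: "(\<Phi> has_real_derivative \<Phi>' s) (at s)" if "s \<ge> 0" for s
  proof -
    have "((\<lambda>s. c * ln (s + z)) has_real_derivative c / (s + z)) (at s)" if "z > 0" for c z :: real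
      using that \<open>s \<ge> 0\<close> by (auto intro!: derivative_eq_intros)
    then show ?thesis unfolding \<Phi>_def \<Phi>'_def using \<alpha> \<beta>
      by (intro DERIV_diff DERIV_sum) auto
  qed
  have mono: "\<Phi> 0 \<le> \<Phi> s" if "s > 0" for s
  proof (rule DERIV_nonneg_imp_increasing_open[of 0 s \<Phi>])
    show "\<exists>y. (\<Phi> has_real_derivative y) (at x) \<and> 0 \<le> y" if "0 < x" "x < s" for x
      using D[of x] le[of x] that by (intro exI[of _ "\<Phi>' x"]) (simp add: \<Phi>'_def)
    show "continuous_on {0..s} \<Phi>"
      by (intro continuous_at_imp_continuous_on ballI) (use D DERIV_isCont in fastforce)
  qed (use that in simp)
  have lim: "((\<lambda>s. ln (s + z) - ln s) \<longlongrightarrow> 0) at_top" if "z > 0" for z :: real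
    using that by real_asymp
  have "((\<lambda>s. (\<Sum>i\<in>A. a i * (ln (s + \<alpha> i) - ln s)) - (\<Sum>i\<in>B. b i * (ln (s + \<beta> i) - ln s)))
     \<longlongrightarrow> (\<Sum>i\<in>A. a i * 0) - (\<Sum>i\<in>B. b i * 0)) at_top"
    using \<alpha> \<beta> by (intro tendsto_intros lim) auto
  moreover have "(\<Sum>i\<in>A. a i * (ln (s + \<alpha> i) - ln s)) - (\<Sum>i\<in>B. b i * (ln (s + \<beta> i) - ln s)) = \<Phi> s" for s
    using eq by (simp add: \<Phi>_def right_diff_distrib sum_subtractf flip: sum_distrib_right)
  ultimately have "(\<Phi> \<longlongrightarrow> 0) at_top" by simp
  moreover have "\<forall>\<^sub>F s in at_top. \<Phi> 0 \<le> \<Phi> s"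
    using eventually_gt_at_top[of 0] by eventually_elim (rule mono)
  ultimately have "\<Phi> 0 \<le> 0"
    by (intro tendsto_lowerbound[of \<Phi> 0 at_top]) auto
  then show ?thesis by (simp add: \<Phi>_def)
qed

text \<open>The right-hand side is the maximum over \<open>X\<close>, attained at
  \<open>X = t * cnj Z / D\<close>. It bounds a quadratic test functional one eigenvector at a
  time.\<close>

lemma complete_square_le:
  fixes X Z :: complex
  assumes "D > 0"
  shows "2 * t * Re (X * Z) - D * (cmod X)\<^sup>2 \<le> t\<^sup>2 * (cmod Z)\<^sup>2 / D"
proof -
  have "2 * t * Re (X * Z) \<le> 2 * \<bar>t\<bar> * (cmod X * cmod Z)"
    using abs_Re_le_cmod[of "X * Z"] mult_left_mono[of "\<bar>Re (X * Z)\<bar>" "cmod X * cmod Z" "\<bar>t\<bar>"]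
    by (simp add: norm_mult abs_mult[symmetric])
  moreover have "0 \<le> (D * cmod X - \<bar>t\<bar> * cmod Z)\<^sup>2" by simp
  then have "D * (2 * \<bar>t\<bar> * (cmod X * cmod Z)) \<le> D * (D * (cmod X)\<^sup>2) + t\<^sup>2 * (cmod Z)\<^sup>2"
    by (simp add: power2_diff power_mult_distrib power2_eq_square algebra_simps)
  then have "2 * \<bar>t\<bar> * (cmod X * cmod Z) \<le> D * (cmod X)\<^sup>2 + t\<^sup>2 * (cmod Z)\<^sup>2 / D"
    using assms by (simp add: field_simps)
  ultimately show ?thesis by simp
qed

section \<open>The resolvent inequality for the partial trace\<close>

definition tens :: "('a \<Rightarrow> complex) \<Rightarrow> ('i \<Rightarrow> complex) \<Rightarrow> 'a \<times> 'i \<Rightarrow> complex" where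
  "tens f g = (\<lambda>(x,i). f x * g i)"

lemma ip_tens: "ip (A \<times> I) (tens f g) (tens f' g') = ip A f f' * ip I g g'"
  unfolding ip_def tens_def sum.cartesian_product' sum_product by (simp add: mult_ac)

lemma nsq_tens: "nsq (A \<times> I) (tens f g) = nsq A f * nsq I g"
  unfolding nsq_def tens_def sum.cartesian_product' sum_product
  by (simp add: norm_mult power_mult_distrib)

text \<open>The resolvent form of the monotonicity of the Holevo information under the partial trace
  over \<open>I\<close>. Both sides are maxima of a quadratic functional of a test operator; the right-hand side is
  tested with \<open>y \<otimes> id\<close>, where \<open>y\<close> is optimal for the left-hand side.\<close>
lemma resolvent_le:
  fixes J :: "'j set" and K :: "'k set" and C :: "'c set" and L :: "'c \<Rightarrow> 'l set"
  assumes A: "finite A" and I: "finite I" and C: "finite C"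
    and E: "\<And>c. c \<in> C \<Longrightarrow> spectral I (E c) (L c) (tau c) (u c)"
    and P: "\<And>c. c \<in> C \<Longrightarrow> P c = (\<Sum>l\<in>L c. tau c l)"
    and \<Omega>: "spectral (A \<times> I) (gram (Sigma C L) (\<lambda>(c,l). tau c l) (\<lambda>(c,l). tens (e c) (u c l))) J om w"
    and \<omega>: "spectral A (gram C P e) K th f"
    and c: "c \<in> C" "P c > 0" and s: "s > 0"
  shows "(\<Sum>k\<in>K. (P c)\<^sup>2 * (cmod (ip A (f k) (e c)))\<^sup>2 / (th k + s * P c))
     \<le> (\<Sum>l\<in>L c. \<Sum>j\<in>J. (tau c l)\<^sup>2 * (cmod (ip (A \<times> I) (w j) (tens (e c) (u c l))))\<^sup>2 / (om j + s * tau c l))"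
proof -
  note SE = spectralD[OF E] and S\<Omega> = spectralD[OF \<Omega>] and S\<omega> = spectralD[OF \<omega>]
  have finT: "finite (Sigma C L)" using C SE(1) by auto
  have P0: "P c \<ge> 0" if "c \<in> C" for c
    unfolding P[OF that] by (intro sum_nonneg less_imp_le SE(2)[OF that])
  define \<phi> where "\<phi> l = tens (e c) (u c l)" for l
  \<comment> \<open>\<open>y\<close> is the optimal test vector: on the support of
    \<open>gram C P e\<close>, the inverse of that operator plus \<open>s * P c\<close>, applied to
    \<open>P c\<close> times \<open>e c\<close>. The \<open>z k\<close> are its coordinates in the
    eigenvectors \<open>f k\<close>, and \<open>V\<close> is the optimal value.\<close>
  define z where "z k = of_real (P c / (th k + s * P c)) * ip A (f k) (e c)" for k
  define y where "y = (\<lambda>x. \<Sum>k\<in>K. z k * f k x)"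
  define V where "V = (\<Sum>k\<in>K. (P c)\<^sup>2 * (cmod (ip A (f k) (e c)))\<^sup>2 / (th k + s * P c))"
  define \<psi> where "\<psi> l = tens y (u c l)" for l
  let ?X = "\<lambda>l j. ip (A \<times> I) (\<psi> l) (w j)"
  have pos: "th k + s * P c > 0" if "k \<in> K" for k
    using S\<omega>(2)[OF that] c(2) s by (simp add: add_pos_pos)
  have fy: "ip A (f k) y = z k" if "k \<in> K" for k
  proof -
    have "ip A (f k) y = (\<Sum>k'\<in>K. if k' = k then z k else 0)"
      unfolding y_def ip_sum_right using S\<omega>(3) that by (intro sum.cong) (auto simp: orthonormal_def)
    then show ?thesis using that S\<omega>(1) by simp
  qed
  have ye: "P c * Re (ip A y (e c)) = V"
  proof -
    have "cnj (z k) * ip A (f k) (e c) = of_real (P c * (cmod (ip A (f k) (e c)))\<^sup>2 / (th k + s * P c))" for k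
    proof -
      have "cnj (z k) * ip A (f k) (e c)
        = of_real (P c / (th k + s * P c)) * (ip A (f k) (e c) * cnj (ip A (f k) (e c)))"
        by (simp add: z_def)
      also have "\<dots> = of_real (P c / (th k + s * P c) * (cmod (ip A (f k) (e c)))\<^sup>2)"
        by (simp add: complex_norm_square del: of_real_power)
      finally show ?thesis by simp
    qed
    then have "ip A y (e c) = of_real (\<Sum>k\<in>K. P c * (cmod (ip A (f k) (e c)))\<^sup>2 / (th k + s * P c))"
      unfolding y_def ip_sum_left by simp
    then show ?thesis by (simp add: V_def sum_distrib_left power2_eq_square mult.assoc)
  qed
  have nsq_y: "nsq A y = (\<Sum>k\<in>K. (cmod (z k))\<^sup>2)"
  proof -
    have "ip A y y = (\<Sum>k\<in>K. cnj (z k) * ip A (f k) y)"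
      by (subst y_def) (simp add: ip_sum_left)
    also have "\<dots> = of_real (\<Sum>k\<in>K. (cmod (z k))\<^sup>2)"
      by (simp add: fy complex_norm_square mult.commute del: of_real_power)
    finally show ?thesis by (simp only: ip_self of_real_eq_iff)
  qed
  define W where "W = (\<Sum>k\<in>K. th k * (cmod (z k))\<^sup>2)"
  have W: "W = (\<Sum>c\<in>C. P c * (cmod (ip A y (e c)))\<^sup>2)"
  proof -
    have "of_real W = bf A (gram C P e) y y"
      using qf_gram[OF A S\<omega>(1) S\<omega>(4), of y] by (simp add: W_def norm_ip_commute[of A y] fy)
    also have "\<dots> = of_real (\<Sum>c\<in>C. P c * (cmod (ip A y (e c)))\<^sup>2)"
      by (rule qf_gram[OF A C refl])
    finally show ?thesis by (simp only: of_real_eq_iff)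
  qed
  have Wn: "W + s * P c * nsq A y = V"
  proof -
    have "W + s * P c * nsq A y = (\<Sum>k\<in>K. (th k + s * P c) * (cmod (z k))\<^sup>2)"
      by (simp add: W_def nsq_y sum_distrib_left algebra_simps flip: sum.distrib)
    also have "\<dots> = V"
      unfolding V_def
    proof (intro sum.cong refl)
      fix k assume "k \<in> K"
      then show "(th k + s * P c) * (cmod (z k))\<^sup>2 = (P c)\<^sup>2 * (cmod (ip A (f k) (e c)))\<^sup>2 / (th k + s * P c)"
        unfolding z_def norm_mult norm_of_real power_mult_distrib power2_abs power_divide
        using pos[of k] by (simp add: power2_eq_square)
    qed
    finally show ?thesis .
  qed
  \<comment> \<open>This is the partial trace over \<open>I\<close>. Bessel's inequality for the
    orthonormal \<open>u c l\<close> bounds the sum over \<open>l\<close> of their squared overlaps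
    with each \<open>u c' l'\<close> by 1; what remains is the quadratic form of
    \<open>gram C P e\<close> at \<open>y\<close>.\<close>
  have W\<Omega>: "(\<Sum>l\<in>L c. \<Sum>j\<in>J. om j * (cmod (?X l j))\<^sup>2) \<le> W"
  proof -
    have 1: "(\<Sum>j\<in>J. om j * (cmod (?X l j))\<^sup>2)
        = (\<Sum>t\<in>Sigma C L. case t of (c',l') \<Rightarrow> tau c' l' * ((cmod (ip A y (e c')))\<^sup>2 * (cmod (ip I (u c l) (u c' l')))\<^sup>2))" for l
    proof -
      let ?M = "gram (Sigma C L) (\<lambda>(c,l). tau c l) (\<lambda>(c,l). tens (e c) (u c l))"
      have "complex_of_real (\<Sum>j\<in>J. om j * (cmod (?X l j))\<^sup>2) = bf (A \<times> I) ?M (\<psi> l) (\<psi> l)"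
        by (rule qf_gram[OF _ S\<Omega>(1) S\<Omega>(4), symmetric]) (use A I in auto)
      also have "\<dots> = of_real (\<Sum>t\<in>Sigma C L. (case t of (c,l) \<Rightarrow> tau c l)
            * (cmod (ip (A \<times> I) (\<psi> l) (case t of (c,l) \<Rightarrow> tens (e c) (u c l))))\<^sup>2)"
        by (rule qf_gram[OF _ finT refl]) (use A I in auto)
      finally show ?thesis
        by (simp add: \<psi>_def ip_tens norm_mult power_mult_distrib case_prod_beta' del: of_real_sum)
    qed
    have "(\<Sum>l\<in>L c. \<Sum>j\<in>J. om j * (cmod (?X l j))\<^sup>2)
       = (\<Sum>t\<in>Sigma C L. case t of (c',l') \<Rightarrow> tau c' l' * (cmod (ip A y (e c')))\<^sup>2 * (\<Sum>l\<in>L c. (cmod (ip I (u c l) (u c' l')))\<^sup>2))"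
      unfolding 1 by (subst sum.swap) (simp add: case_prod_beta' sum_distrib_left mult.assoc)
    also have "\<dots> \<le> (\<Sum>t\<in>Sigma C L. case t of (c',l') \<Rightarrow> tau c' l' * (cmod (ip A y (e c')))\<^sup>2 * 1)"
    proof (intro sum_mono, clarify)
      fix c' l' assume *: "c' \<in> C" "l' \<in> L c'"
      have "(\<Sum>l\<in>L c. (cmod (ip I (u c l) (u c' l')))\<^sup>2) \<le> 1"
        using Bessel_inequality[OF I SE(1,3)[OF c(1)], of "u c' l'"]
          orthonormal_nsq[OF SE(3)[OF *(1)] *(2)] by simp
      then show "tau c' l' * (cmod (ip A y (e c')))\<^sup>2 * (\<Sum>l\<in>L c. (cmod (ip I (u c l) (u c' l')))\<^sup>2)
          \<le> tau c' l' * (cmod (ip A y (e c')))\<^sup>2 * 1"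
        using SE(2)[OF *] by (intro mult_left_mono) auto
    qed
    also have "\<dots> = (\<Sum>c'\<in>C. \<Sum>l'\<in>L c'. tau c' l' * (cmod (ip A y (e c')))\<^sup>2)"
      by (subst sum.Sigma) (use C SE(1) in \<open>auto intro!: sum.cong\<close>)
    also have "\<dots> = W"
      unfolding W by (intro sum.cong refl) (simp add: P sum_distrib_right)
    finally show ?thesis .
  qed
  \<comment> \<open>Expand in the eigenvectors \<open>w j\<close> and complete the square with
    \<open>t = tau c l\<close> and \<open>D = om j + s * tau c l\<close>. The component of
    \<open>\<psi> l\<close> outside the support is dropped; it enters with a minus sign.\<close>
  have bound: "tau c l * (2 * Re (ip A y (e c))) - (\<Sum>j\<in>J. om j * (cmod (?X l j))\<^sup>2) - s * tau c l * nsq A y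
     \<le> (\<Sum>j\<in>J. (tau c l)\<^sup>2 * (cmod (ip (A \<times> I) (w j) (\<phi> l)))\<^sup>2 / (om j + s * tau c l))" if l: "l \<in> L c" for l
  proof -
    have t0: "tau c l > 0" using SE(2)[OF c(1) l] .
    have u1: "ip I (u c l) (u c l) = 1" using SE(3)[OF c(1)] l by (simp add: orthonormal_def)
    have "ip A y (e c) = ip (A \<times> I) (\<psi> l) (\<phi> l)"
      by (simp add: \<psi>_def \<phi>_def ip_tens u1)
    also have "\<dots> = ip (A \<times> I) (\<psi> l) (\<lambda>a. \<Sum>j\<in>J. ip (A \<times> I) (w j) (\<phi> l) * w j a)"
    proof (rule ip_cong[OF refl])
      fix a assume a: "a \<in> A \<times> I"
      show "\<phi> l a = (\<Sum>j\<in>J. ip (A \<times> I) (w j) (\<phi> l) * w j a)"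
        unfolding \<phi>_def
        using support_expansion[OF finite_cartesian_product[OF A I] finT \<Omega> refl, of "(c,l)" a]
          SE(2) c(1) l t0 a by (force intro: less_imp_le)
    qed
    also have "\<dots> = (\<Sum>j\<in>J. ?X l j * ip (A \<times> I) (w j) (\<phi> l))"
      unfolding ip_sum_right by (simp add: mult.commute)
    finally have 1: "tau c l * (2 * Re (ip A y (e c))) = (\<Sum>j\<in>J. 2 * tau c l * Re (?X l j * ip (A \<times> I) (w j) (\<phi> l)))"
      by (simp add: sum_distrib_left mult_ac del: times_complex.sel)
    have "(\<Sum>j\<in>J. (cmod (?X l j))\<^sup>2) \<le> nsq A y"
      using Bessel_inequality[OF finite_cartesian_product[OF A I] S\<Omega>(1,3), of "\<psi> l"]
        orthonormal_nsq[OF SE(3)[OF c(1)] l]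
      unfolding norm_ip_commute[of _ "\<psi> l"] by (simp add: \<psi>_def nsq_tens)
    then have 2: "s * tau c l * (\<Sum>j\<in>J. (cmod (?X l j))\<^sup>2) \<le> s * tau c l * nsq A y"
      using s t0 by (intro mult_left_mono) auto
    have "tau c l * (2 * Re (ip A y (e c))) - (\<Sum>j\<in>J. om j * (cmod (?X l j))\<^sup>2) - s * tau c l * nsq A y
      \<le> (\<Sum>j\<in>J. 2 * tau c l * Re (?X l j * ip (A \<times> I) (w j) (\<phi> l)) - (om j + s * tau c l) * (cmod (?X l j))\<^sup>2)"
      using 2 unfolding 1 by (simp add: sum_subtractf sum.distrib sum_distrib_left algebra_simps)
    also have "\<dots> \<le> (\<Sum>j\<in>J. (tau c l)\<^sup>2 * (cmod (ip (A \<times> I) (w j) (\<phi> l)))\<^sup>2 / (om j + s * tau c l))"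
      using S\<Omega>(2) s t0 by (intro sum_mono complete_square_le) (simp add: add_pos_pos)
    finally show ?thesis .
  qed
  \<comment> \<open>At its maximum the functional is half of its linear part: both
    \<open>P c * Re (ip A y (e c))\<close> and the quadratic part
    \<open>W + s * P c * nsq A y\<close> equal \<open>V\<close>.\<close>
  have "V = 2 * (P c * Re (ip A y (e c))) - W - s * P c * nsq A y"
    using ye Wn by simp
  also have "\<dots> \<le> (\<Sum>l\<in>L c. tau c l * (2 * Re (ip A y (e c))) - (\<Sum>j\<in>J. om j * (cmod (?X l j))\<^sup>2) - s * tau c l * nsq A y)"
    using W\<Omega> by (simp add: P[OF c(1)] sum_subtractf sum_distrib_left sum_distrib_right mult_ac)
  also have "\<dots> \<le> (\<Sum>l\<in>L c. \<Sum>j\<in>J. (tau c l)\<^sup>2 * (cmod (ip (A \<times> I) (w j) (\<phi> l)))\<^sup>2 / (om j + s * tau c l))"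
    by (intro sum_mono bound)
  finally show ?thesis by (simp add: V_def \<phi>_def)
qed

text \<open>The numbers \<open>c t * |ip I (w j) (\<phi> t)|^2\<close> are joint weights on
  \<open>J \<times> T\<close> with marginals \<open>lam j\<close> and \<open>c t\<close>. Hence a
  weighted sum of logarithms of ratios is a difference of two entropies, although the eigenvectors
  and the \<open>\<phi> t\<close> need not be aligned.\<close>

lemma spectral_mixture_sums:
  assumes fin: "finite I" "finite T" and sp: "spectral I (gram T c \<phi>) J lam w"
    and c: "\<And>t. t \<in> T \<Longrightarrow> c t > 0" and \<phi>: "\<And>t. t \<in> T \<Longrightarrow> nsq I (\<phi> t) = 1"
  shows "(\<Sum>(j,t)\<in>J \<times> T. c t * (cmod (ip I (w j) (\<phi> t)))\<^sup>2) = (\<Sum>t\<in>T. c t)"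
    and "(\<Sum>(j,t)\<in>J \<times> T. c t * (cmod (ip I (w j) (\<phi> t)))\<^sup>2 * ln (lam j / c t))
      = (\<Sum>j\<in>J. lam j * ln (lam j)) - (\<Sum>t\<in>T. c t * ln (c t))"
proof -
  note S = spectralD[OF sp]
  have J: "(\<Sum>j\<in>J. (cmod (ip I (w j) (\<phi> t)))\<^sup>2) = 1" if "t \<in> T" for t
    using support_nsq[OF fin sp refl less_imp_le[OF c] that c[OF that]] \<phi>[OF that] by simp
  have T: "lam j = (\<Sum>t\<in>T. c t * (cmod (ip I (w j) (\<phi> t)))\<^sup>2)" if "j \<in> J" for j
    by (rule spectral_eigenvalue[OF fin sp refl that])
  have wt: "(\<Sum>(j,t)\<in>J \<times> T. c t * (cmod (ip I (w j) (\<phi> t)))\<^sup>2 * g t) = (\<Sum>t\<in>T. c t * g t)" for g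
  proof -
    have "(\<Sum>(j,t)\<in>J \<times> T. c t * (cmod (ip I (w j) (\<phi> t)))\<^sup>2 * g t)
        = (\<Sum>t\<in>T. c t * g t * (\<Sum>j\<in>J. (cmod (ip I (w j) (\<phi> t)))\<^sup>2))"
      by (subst sum.cartesian_product[symmetric], subst sum.swap) (simp add: sum_distrib_left mult_ac)
    then show ?thesis by (simp add: J)
  qed
  have wj: "(\<Sum>(j,t)\<in>J \<times> T. c t * (cmod (ip I (w j) (\<phi> t)))\<^sup>2 * g j) = (\<Sum>j\<in>J. lam j * g j)" for g
    by (subst sum.cartesian_product[symmetric], intro sum.cong refl)
       (use T in \<open>simp add: sum_distrib_right\<close>)
  show "(\<Sum>(j,t)\<in>J \<times> T. c t * (cmod (ip I (w j) (\<phi> t)))\<^sup>2) = (\<Sum>t\<in>T. c t)"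
    using wt[of "\<lambda>_. 1"] by simp
  have "(\<Sum>(j,t)\<in>J \<times> T. c t * (cmod (ip I (w j) (\<phi> t)))\<^sup>2 * ln (lam j / c t))
      = (\<Sum>(j,t)\<in>J \<times> T. c t * (cmod (ip I (w j) (\<phi> t)))\<^sup>2 * ln (lam j)
          - c t * (cmod (ip I (w j) (\<phi> t)))\<^sup>2 * ln (c t))"
    by (intro sum.cong refl)
       (auto simp: ln_div right_diff_distrib less_imp_neq[OF S(2), symmetric] less_imp_neq[OF c, symmetric])
  then show "(\<Sum>(j,t)\<in>J \<times> T. c t * (cmod (ip I (w j) (\<phi> t)))\<^sup>2 * ln (lam j / c t))
      = (\<Sum>j\<in>J. lam j * ln (lam j)) - (\<Sum>t\<in>T. c t * ln (c t))"
    using wj[of "\<lambda>j. ln (lam j)"] wt[of "\<lambda>t. ln (c t)"]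
    by (simp add: case_prod_beta' sum_subtractf)
qed

text \<open>Read \<open>c\<close> as a classical letter, \<open>A\<close> as a system in the pure
  state \<open>e c\<close> and \<open>I\<close> as the rest, which is in the unnormalised state
  \<open>E c\<close>. The sum over \<open>C\<close> is the entropy of the rest given the letter;
  given \<open>A\<close> instead, it is at least as large.\<close>

lemma spectral_conditional_entropy:
  fixes J :: "'j set" and K :: "'k set" and C :: "'c set" and L :: "'c \<Rightarrow> 'l set"
  assumes A: "finite A" and I: "finite I" and C: "finite C"
    and E: "\<And>c. c \<in> C \<Longrightarrow> spectral I (E c) (L c) (tau c) (u c)"
    and P: "\<And>c. c \<in> C \<Longrightarrow> P c = (\<Sum>l\<in>L c. tau c l)" "\<And>c. c \<in> C \<Longrightarrow> P c > 0"
    and e: "\<And>c. c \<in> C \<Longrightarrow> nsq A (e c) = 1"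
    and \<Omega>: "spectral (A \<times> I) (gram (Sigma C L) (\<lambda>(c,l). tau c l) (\<lambda>(c,l). tens (e c) (u c l))) J om w"
    and \<omega>: "spectral A (gram C P e) K th f"
  shows "(\<Sum>k\<in>K. eta (th k)) + (\<Sum>c\<in>C. (\<Sum>l\<in>L c. eta (tau c l)) - eta (P c)) \<le> (\<Sum>j\<in>J. eta (om j))"
proof -
  note SE = spectralD[OF E] and S\<Omega> = spectralD[OF \<Omega>] and S\<omega> = spectralD[OF \<omega>]
  let ?T = "Sigma C L"
  define c where "c = (\<lambda>(c,l). tau c l)"
  define \<phi> where "\<phi> = (\<lambda>(c,l). tens (e c) (u c l))"
  have T: "finite ?T" and AI: "finite (A \<times> I)" using A I C SE(1) by auto
  have c: "c t > 0" if "t \<in> ?T" for t using that SE(2) by (auto simp: c_def)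
  have \<phi>: "nsq (A \<times> I) (\<phi> t) = 1" if "t \<in> ?T" for t
    using that e orthonormal_nsq[OF SE(3)] by (auto simp: \<phi>_def nsq_tens)
  note M\<Omega> = spectral_mixture_sums[OF AI T \<Omega>[folded c_def \<phi>_def] c \<phi>]
  note M\<omega> = spectral_mixture_sums[OF A C \<omega> P(2) e]
  have sumT: "(\<Sum>t\<in>?T. g (c t)) = (\<Sum>d\<in>C. \<Sum>l\<in>L d. g (tau d l))" for g :: "real \<Rightarrow> real"
    by (subst sum.Sigma) (use C SE(1) in \<open>auto intro!: sum.cong simp: c_def\<close>)
  \<comment> \<open>With the points \<open>om j / c t\<close> and \<open>th k / P d\<close>,
    clearing denominators in the resolvent sums gives exactly the summands of
    \<open>resolvent_le\<close>.\<close>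
  have "(\<Sum>(j,t)\<in>J \<times> ?T. c t * (cmod (ip (A \<times> I) (w j) (\<phi> t)))\<^sup>2 * ln (om j / c t))
     \<le> (\<Sum>(k,d)\<in>K \<times> C. P d * (cmod (ip A (f k) (e d)))\<^sup>2 * ln (th k / P d))"
    unfolding case_prod_beta'
  proof (rule sum_ln_mono_of_resolvent)
    show "0 < om (fst i) / c (snd i)" if "i \<in> J \<times> ?T" for i
      using that S\<Omega>(2) c by auto
    show "0 < th (fst i) / P (snd i)" if "i \<in> K \<times> C" for i
      using that S\<omega>(2) P(2) by auto
    show "(\<Sum>i\<in>J \<times> ?T. c (snd i) * (cmod (ip (A \<times> I) (w (fst i)) (\<phi> (snd i))))\<^sup>2)
        = (\<Sum>i\<in>K \<times> C. P (snd i) * (cmod (ip A (f (fst i)) (e (snd i))))\<^sup>2)"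
      using M\<Omega>(1) M\<omega>(1) sumT[of "\<lambda>x. x"] P(1) by (simp add: case_prod_beta')
    fix s :: real assume s: "s > 0"
    have "(\<Sum>i\<in>K \<times> C. P (snd i) * (cmod (ip A (f (fst i)) (e (snd i))))\<^sup>2 / (s + th (fst i) / P (snd i)))
        = (\<Sum>d\<in>C. \<Sum>k\<in>K. (P d)\<^sup>2 * (cmod (ip A (f k) (e d)))\<^sup>2 / (th k + s * P d))"
      unfolding sum.cartesian_product'
      apply (subst sum.swap)
      by (intro sum.cong refl, use P(2) in \<open>force simp: field_simps power2_eq_square\<close>)
    also have "\<dots> \<le> (\<Sum>d\<in>C. \<Sum>l\<in>L d. \<Sum>j\<in>J. (tau d l)\<^sup>2 * (cmod (ip (A \<times> I) (w j) (tens (e d) (u d l))))\<^sup>2 / (om j + s * tau d l))"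
      by (intro sum_mono resolvent_le[OF A I C E P(1) \<Omega> \<omega> _ P(2) s])
    also have "\<dots> = (\<Sum>t\<in>?T. \<Sum>j\<in>J. (c t)\<^sup>2 * (cmod (ip (A \<times> I) (w j) (\<phi> t)))\<^sup>2 / (om j + s * c t))"
      by (subst sum.Sigma) (use C SE(1) in \<open>auto intro!: sum.cong simp: c_def \<phi>_def\<close>)
    also have "\<dots> = (\<Sum>i\<in>J \<times> ?T. c (snd i) * (cmod (ip (A \<times> I) (w (fst i)) (\<phi> (snd i))))\<^sup>2 / (s + om (fst i) / c (snd i)))"
      unfolding sum.cartesian_product'
      apply (subst sum.swap)
      by (intro sum.cong refl, use c in \<open>force simp: field_simps power2_eq_square\<close>)
    finally show "(\<Sum>i\<in>K \<times> C. P (snd i) * (cmod (ip A (f (fst i)) (e (snd i))))\<^sup>2 / (s + th (fst i) / P (snd i)))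
      \<le> (\<Sum>i\<in>J \<times> ?T. c (snd i) * (cmod (ip (A \<times> I) (w (fst i)) (\<phi> (snd i))))\<^sup>2 / (s + om (fst i) / c (snd i)))" .
  qed
  moreover have "(\<Sum>(j,t)\<in>J \<times> ?T. c t * (cmod (ip (A \<times> I) (w j) (\<phi> t)))\<^sup>2 * ln (om j / c t))
      = (\<Sum>j\<in>J. om j * ln (om j)) - (\<Sum>d\<in>C. \<Sum>l\<in>L d. tau d l * ln (tau d l))"
    using M\<Omega>(2) sumT[of "\<lambda>x. x * ln x"] by simp
  moreover have "(\<Sum>(k,d)\<in>K \<times> C. P d * (cmod (ip A (f k) (e d)))\<^sup>2 * ln (th k / P d))
      = (\<Sum>k\<in>K. th k * ln (th k)) - (\<Sum>d\<in>C. P d * ln (P d))"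
    by (rule M\<omega>(2))
  ultimately have "(\<Sum>j\<in>J. om j * ln (om j)) - (\<Sum>d\<in>C. \<Sum>l\<in>L d. tau d l * ln (tau d l))
      \<le> (\<Sum>k\<in>K. th k * ln (th k)) - (\<Sum>d\<in>C. P d * ln (P d))"
    by simp
  then have "((\<Sum>j\<in>J. om j * ln (om j)) - (\<Sum>d\<in>C. \<Sum>l\<in>L d. tau d l * ln (tau d l))) / ln 2
      \<le> ((\<Sum>k\<in>K. th k * ln (th k)) - (\<Sum>d\<in>C. P d * ln (P d))) / ln 2"
    by (rule divide_right_mono) simp
  then show ?thesis
    by (simp add: eta_def log_def sum_negf sum_subtractf diff_divide_distrib sum_divide_distrib)
qed

text \<open>A letter with \<open>P c = 0\<close> has a block of trace 0, which has no positive
  eigenvalue; such letters are removed so that the version with positive weights applies.\<close>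

lemma has_ent_conditional:
  fixes C :: "'c set"
  assumes A: "finite A" and I: "finite I" and C: "finite C"
    and E: "\<And>c. c \<in> C \<Longrightarrow> has_ent I (E c) (hE c)"
    and P: "\<And>c. c \<in> C \<Longrightarrow> (\<Sum>i\<in>I. E c i i) = of_real (P c)"
    and e: "\<And>c. c \<in> C \<Longrightarrow> nsq A (e c) = 1"
    and \<Omega>: "has_ent (A \<times> I) (\<lambda>(x,i) (y,k). \<Sum>c\<in>C. e c x * cnj (e c y) * E c i k) h"
    and \<omega>: "has_ent A (gram C P e) h1"
  shows "h1 + (\<Sum>c\<in>C. hE c - eta (P c)) \<le> h"
proof -
  have "\<forall>c. \<exists>(L::nat set) tau u. c \<in> C \<longrightarrow> spectral I (E c) L tau u \<and> hE c = (\<Sum>l\<in>L. eta (tau l))"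
    using E unfolding has_ent_def by metis
  then obtain L :: "'c \<Rightarrow> nat set" and tau u where
    sp: "\<And>c. c \<in> C \<Longrightarrow> spectral I (E c) (L c) (tau c) (u c)"
    and hE: "\<And>c. c \<in> C \<Longrightarrow> hE c = (\<Sum>l\<in>L c. eta (tau c l))"
    by metis
  note SE = spectralD[OF sp]
  have P': "P c = (\<Sum>l\<in>L c. tau c l)" if "c \<in> C" for c
    using P[OF that] spectral_trace[OF sp[OF that]] by (simp only: of_real_eq_iff)
  have P0: "P c \<ge> 0" if "c \<in> C" for c
    unfolding P'[OF that] by (intro sum_nonneg less_imp_le SE(2)[OF that])
  have Lempty: "L c = {}" if "c \<in> C" "P c = 0" for c
    using P'[OF that(1)] that(2) sum_pos[OF SE(1)[OF that(1)] _ SE(2)[OF that(1)]] by fastforce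
  let ?C = "{c \<in> C. P c > 0}"
  have C0: "P c = 0" if "c \<in> C - ?C" for c using that P0[of c] by auto
  from \<Omega> obtain J :: "nat set" and om w where
    spJ: "spectral (A \<times> I) (\<lambda>(x,i) (y,k). \<Sum>c\<in>C. e c x * cnj (e c y) * E c i k) J om w"
    and h: "h = (\<Sum>j\<in>J. eta (om j))"
    unfolding has_ent_def by blast
  from \<omega> obtain K :: "nat set" and th f where spK: "spectral A (gram C P e) K th f"
    and h1: "h1 = (\<Sum>k\<in>K. eta (th k))"
    unfolding has_ent_def by blast
  have 1: "gram ?C P e x y = gram C P e x y" for x y
    unfolding gram_def using C C0 by (intro sum.mono_neutral_left) auto
  have 2: "gram (Sigma ?C L) (\<lambda>(c,l). tau c l) (\<lambda>(c,l). tens (e c) (u c l)) a b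
     = (case a of (x,i) \<Rightarrow> \<lambda>(y,k). \<Sum>c\<in>C. e c x * cnj (e c y) * E c i k) b" if mem: "a \<in> A \<times> I" "b \<in> A \<times> I" for a b
  proof -
    obtain x i y k where ab: "a = (x,i)" "b = (y,k)" "i \<in> I" "k \<in> I"
      using mem by (metis mem_Sigma_iff surj_pair)
    have "Sigma ?C L = Sigma C L" using Lempty P0 by (auto simp: order.order_iff_strict)
    then have "gram (Sigma ?C L) (\<lambda>(c,l). tau c l) (\<lambda>(c,l). tens (e c) (u c l)) a b
      = (\<Sum>c\<in>C. \<Sum>l\<in>L c. of_real (tau c l) * (e c x * u c l i) * cnj (e c y * u c l k))"
      unfolding gram_def ab by (subst sum.Sigma) (use C SE(1) in \<open>auto intro!: sum.cong simp: tens_def\<close>)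
    also have "\<dots> = (\<Sum>c\<in>C. e c x * cnj (e c y) * E c i k)"
      by (intro sum.cong refl) (simp add: SE(4) ab gram_def sum_distrib_left mult_ac)
    finally show ?thesis by (simp add: ab)
  qed
  have "(\<Sum>k\<in>K. eta (th k)) + (\<Sum>c\<in>?C. (\<Sum>l\<in>L c. eta (tau c l)) - eta (P c)) \<le> (\<Sum>j\<in>J. eta (om j))"
  proof (rule spectral_conditional_entropy[OF A I])
    show "spectral (A \<times> I) (gram (Sigma ?C L) (\<lambda>(c,l). tau c l) (\<lambda>(c,l). tens (e c) (u c l))) J om w"
      using spJ 2 unfolding spectral_def by simp
    show "spectral A (gram ?C P e) K th f"
      using spK 1 unfolding spectral_def by simp
  qed (use C sp P' e in auto)
  moreover have "(\<Sum>c\<in>?C. (\<Sum>l\<in>L c. eta (tau c l)) - eta (P c)) = (\<Sum>c\<in>C. hE c - eta (P c))"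
  proof (rule sum.mono_neutral_cong_left)
    show "\<forall>c\<in>C - ?C. hE c - eta (P c) = 0"
    proof
      fix c assume "c \<in> C - ?C"
      then show "hE c - eta (P c) = 0" using C0[of c] Lempty[of c] hE[of c] by simp
    qed
  qed (use C hE in auto)
  ultimately show ?thesis by (simp add: h h1)
qed

section \<open>The spectral theorem and the von Neumann entropy\<close>

lemma unit_eigenvector_exists:
  fixes f :: "nat \<Rightarrow> nat \<Rightarrow> complex"
  assumes "n > 0"
  obtains v \<kappa> where "nsq {..<n} v = 1" "\<And>a. a < n \<Longrightarrow> (\<Sum>b<n. f a b * v b) = \<kappa> * v a"
proof -
  define A where "A = mat n n (\<lambda>(a,b). f a b)"
  have A: "A \<in> carrier_mat n n" by (simp add: A_def)
  obtain as where as: "char_poly A = (\<Prod>a\<leftarrow>as. [:- a, 1:])" "length as = n"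
    using char_poly_factorized[OF A] by blast
  then obtain \<kappa> as' where "as = \<kappa> # as'" using assms by (cases as) auto
  then have "poly (char_poly A) \<kappa> = 0" using as by simp
  then obtain v where v: "v \<in> carrier_vec n" "v \<noteq> 0\<^sub>v n" "A *\<^sub>v v = \<kappa> \<cdot>\<^sub>v v"
    using eigenvalue_root_char_poly[OF A] A by (auto simp: eigenvalue_def eigenvector_def)
  define N where "N = sqrt (nsq {..<n} (vec_index v))"
  have ev: "(\<Sum>b<n. f a b * vec_index v b) = \<kappa> * vec_index v a" if "a < n" for a
  proof -
    have "vec_index (A *\<^sub>v v) a = (\<Sum>b<n. f a b * vec_index v b)"
      using that v(1) by (simp add: A_def scalar_prod_def lessThan_atLeast0)
    then show ?thesis using v that by simp
  qed
  have "nsq {..<n} (vec_index v) \<noteq> 0"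
  proof
    assume "nsq {..<n} (vec_index v) = 0"
    then have "vec_index v a = 0" if "a < n" for a using nsq_eq_0[of "{..<n}"] that by simp
    then have "v = 0\<^sub>v n" using v(1) by (intro eq_vecI) auto
    then show False using v(2) by simp
  qed
  then have pos: "nsq {..<n} (vec_index v) > 0"
    using nsq_nonneg[of "{..<n}" "vec_index v"] by linarith
  show thesis
  proof (rule that[of "\<lambda>a. vec_index v a / of_real N" \<kappa>])
    have "N\<^sup>2 = nsq {..<n} (vec_index v)" using pos by (simp add: N_def)
    then show "nsq {..<n} (\<lambda>a. vec_index v a / of_real N) = 1"
      using pos by (simp add: nsq_def norm_divide power_divide flip: sum_divide_distrib)
    show "(\<Sum>b<n. f a b * (vec_index v b / of_real N)) = \<kappa> * (vec_index v a / of_real N)" if "a < n" for a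
      using ev[OF that] by (simp flip: sum_divide_distrib)
  qed
qed

text \<open>The Householder reflection exchanging \<open>v\<close> and the first basis vector; \<open>v 0 \<le> 0\<close> keeps the
  denominator away from zero.\<close>
lemma unitary_with_first_column:
  fixes v :: "nat \<Rightarrow> complex"
  assumes v: "nsq {..<n} v = 1" and v0: "v 0 = of_real r" "r \<le> 0" and n: "n > 0"
  obtains B where "orthonormal {..<n} {..<n} B" "\<And>a. a < n \<Longrightarrow> B 0 a = v a"
    "\<And>i a. i < n \<Longrightarrow> a < n \<Longrightarrow> B i a = cnj (B a i)"
proof -
  define u where "u a = (if a = 0 then v a - 1 else v a)" for a
  \<comment> \<open>\<open>c\<close> is 2 divided by the square norm \<open>2 - 2 * r\<close> of
    \<open>u\<close>, so \<open>B\<close> is the reflection in the hyperplane orthogonal to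
    \<open>u\<close>.\<close>
  define c where "c = 1 / (1 - r)"
  define B where "B i a = (if a = i then 1 else 0) - of_real c * cnj (u i) * u a" for i a
  have uu: "ip {..<n} u u = of_real (2 - 2 * r)"
  proof -
    obtain m where m: "n = Suc m" using n by (cases n) auto
    have "v 0 - 1 = of_real (r - 1)" by (simp add: v0)
    then have "cmod (v 0 - 1) = \<bar>r - 1\<bar>" by (simp only: norm_of_real)
    then have "nsq {..<n} u = nsq {..<n} v + (r - 1)\<^sup>2 - r\<^sup>2"
      using v0(1) unfolding nsq_def m sum.lessThan_Suc_shift by (simp add: u_def)
    then show ?thesis by (simp add: ip_self v power2_diff)
  qed
  have cr: "c * (1 - r) = 1" using v0(2) by (simp add: c_def)
  have delta_l: "ip {..<n} (\<lambda>a. if a = i then 1 else 0) g = g i" if "i < n" for i g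
    using that by (simp add: ip_def if_distrib[of cnj] if_distrib[of "\<lambda>x. x * _"] cong: if_cong)
  have delta_r: "ip {..<n} g (\<lambda>a. if a = i then 1 else 0) = cnj (g i)" if "i < n" for i g
    using delta_l[OF that, of g] by (metis cnj_ip)
  have scale: "ip {..<n} g (\<lambda>a. k * h a) = k * ip {..<n} g h"
    "ip {..<n} (\<lambda>a. k * h a) g = cnj k * ip {..<n} h g" for g h k
    by (simp_all add: ip_def sum_distrib_left mult_ac)
  have on: "ip {..<n} (B i) (B j) = (if i = j then 1 else 0)" if ij: "i < n" "j < n" for i j
  proof -
    have "ip {..<n} (B i) (B j) = (if i = j then 1 else 0) - of_real (2 * c) * u i * cnj (u j)
       + of_real (c * c) * (of_real (2 - 2 * r) * (u i * cnj (u j)))"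
      unfolding B_def ip_diff_left ip_diff_right scale delta_l[OF ij(1)] delta_r[OF ij(2)] delta_l[OF ij(2)] uu
      by (simp add: algebra_simps)
    also have "of_real (c * c) * (of_real (2 - 2 * r) * (u i * cnj (u j)))
       = of_real (2 * c * (c * (1 - r))) * (u i * cnj (u j))"
      by (simp add: algebra_simps)
    finally show ?thesis by (simp add: cr)
  qed
  show thesis
  proof (rule that[of B])
    show "orthonormal {..<n} {..<n} B" using on by (simp add: orthonormal_def)
    show "B i a = cnj (B a i)" if "i < n" "a < n" for i a by (auto simp: B_def)
    show "B 0 a = v a" if "a < n" for a
    proof -
      have "of_real c * cnj (u 0) = - complex_of_real (c * (1 - r))"
        by (simp add: u_def v0 algebra_simps)
      then have "B 0 a = (if a = 0 then 1 else 0) + u a"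
        unfolding B_def cr by simp
      then show ?thesis by (simp add: u_def)
    qed
  qed
qed

text \<open>Deflation: a unit eigenvector is completed to an orthonormal basis by a reflection, its
  orthogonal complement is invariant because \<open>f\<close> is hermitian, and the induction
  hypothesis is applied to the compression \<open>g\<close> of \<open>f\<close> to that complement.
  The eigenvalues are still complex numbers here; \<open>gram_eigenbasis\<close> makes them real and
  nonnegative.\<close>

lemma hermitian_eigenbasis:
  fixes f :: "nat \<Rightarrow> nat \<Rightarrow> complex"
  assumes "\<And>a b. a < n \<Longrightarrow> b < n \<Longrightarrow> f a b = cnj (f b a)"
  shows "\<exists>w lam. orthonormal {..<n} {..<n} w \<and>
    (\<forall>j<n. \<forall>a<n. (\<Sum>b<n. f a b * w j b) = lam j * w j a)"
  using assms
proof (induction n arbitrary: f)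
  case 0
  then show ?case by (simp add: orthonormal_def)
next
  case (Suc m)
  define n where "n = Suc m"
  have n: "n > 0" by (simp add: n_def)
  note herm = Suc.prems[folded n_def]
  obtain v0 \<kappa> where v0: "nsq {..<n} v0 = 1" "\<And>a. a < n \<Longrightarrow> (\<Sum>b<n. f a b * v0 b) = \<kappa> * v0 a"
    using unit_eigenvector_exists[OF n, of f] by blast
  \<comment> \<open>The phase that turns the first coordinate into a nonpositive real, as the
    reflection requires.\<close>
  define \<theta> where "\<theta> = (if v0 0 = 0 then 1 else - cnj (v0 0) / of_real (cmod (v0 0)))"
  define v where "v a = \<theta> * v0 a" for a
  have \<theta>: "cmod \<theta> = 1" by (simp add: \<theta>_def norm_divide)
  have v: "nsq {..<n} v = 1" using v0(1) by (simp add: v_def nsq_def norm_mult \<theta>)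
  have evv: "(\<Sum>b<n. f a b * v b) = \<kappa> * v a" if "a < n" for a
    using v0(2)[OF that] by (simp add: v_def mult.left_commute[of _ \<theta>] flip: sum_distrib_left)
  have v_0: "v 0 = of_real (- cmod (v0 0))"
  proof (cases "v0 0 = 0")
    case False
    have "v0 0 * cnj (v0 0) = of_real (cmod (v0 0)) * of_real (cmod (v0 0))"
      by (simp only: complex_norm_square[symmetric] power2_eq_square of_real_mult)
    then show ?thesis using False by (simp add: v_def \<theta>_def field_simps)
  qed (simp add: v_def)
  obtain B where B: "orthonormal {..<n} {..<n} B" and B0: "\<And>a. a < n \<Longrightarrow> B 0 a = v a"
    and Bh: "\<And>i a. i < n \<Longrightarrow> a < n \<Longrightarrow> B i a = cnj (B a i)"
    using unitary_with_first_column[OF v v_0 _ n] by (metis neg_le_0_iff_le norm_ge_zero)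
  have on: "ip {..<n} (B i) (B j) = (if i = j then 1 else 0)" if "i < n" "j < n" for i j
    using B that by (simp add: orthonormal_def)
  define F where "F \<phi> = (\<lambda>a. \<Sum>b<n. f a b * \<phi> b)" for \<phi>
  have Fsym: "ip {..<n} \<phi> (F \<psi>) = ip {..<n} (F \<phi>) \<psi>" for \<phi> \<psi>
  proof -
    have "ip {..<n} (F \<phi>) \<psi> = (\<Sum>a<n. \<Sum>b<n. f b a * cnj (\<phi> b) * \<psi> a)"
      unfolding ip_def F_def cnj_sum sum_distrib_right
      by (intro sum.cong refl) (use herm in \<open>metis complex_cnj_cnj complex_cnj_mult lessThan_iff\<close>)
    also have "\<dots> = ip {..<n} \<phi> (F \<psi>)"
      by (subst sum.swap) (simp add: ip_def F_def sum_distrib_left mult_ac)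
    finally show ?thesis ..
  qed
  \<comment> \<open>\<open>B\<close> is hermitian, so exchanging its indices turns completeness of
    the basis into its orthonormality.\<close>
  have expand: "\<phi> a = (\<Sum>i<n. ip {..<n} (B i) \<phi> * B i a)" if a: "a < n" for \<phi> a
  proof -
    have "(\<Sum>i<n. ip {..<n} (B i) \<phi> * B i a) = (\<Sum>i<n. \<Sum>b<n. \<phi> b * (cnj (B i b) * B i a))"
      unfolding ip_def sum_distrib_right by (intro sum.cong refl) (simp only: mult_ac)
    also have "\<dots> = (\<Sum>b<n. \<phi> b * (\<Sum>i<n. cnj (B a i) * B b i))"
    proof (subst sum.swap, intro sum.cong refl)
      fix b assume "b \<in> {..<n}"
      then have "cnj (B i b) * B i a = cnj (B a i) * B b i" if "i < n" for i
        using Bh[of b i] Bh[of i a] that a by simp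
      then show "(\<Sum>i<n. \<phi> b * (cnj (B i b) * B i a)) = \<phi> b * (\<Sum>i<n. cnj (B a i) * B b i)"
        by (simp add: sum_distrib_left)
    qed
    also have "\<dots> = (\<Sum>b<n. if b = a then \<phi> a else 0)"
      using on[OF a] by (intro sum.cong refl) (auto simp: ip_def)
    finally show ?thesis using a by simp
  qed
  define g where "g i j = ip {..<n} (B (Suc i)) (F (B (Suc j)))" for i j
  have "g i j = cnj (g j i)" for i j
    unfolding g_def by (simp add: cnj_ip Fsym)
  then obtain w3 lam3 where w3: "orthonormal {..<m} {..<m} w3"
    and ev3: "\<And>j a. j < m \<Longrightarrow> a < m \<Longrightarrow> (\<Sum>b<m. g a b * w3 j b) = lam3 j * w3 j a"
    using Suc.IH[of g] by blast
  define w where "w j = (case j of 0 \<Rightarrow> v | Suc j \<Rightarrow> (\<lambda>a. \<Sum>i<m. w3 j i * B (Suc i) a))" for j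
  define lam where "lam j = (case j of 0 \<Rightarrow> \<kappa> | Suc j \<Rightarrow> lam3 j)" for j
  have w0: "ip {..<n} v g' = ip {..<n} (B 0) g'" for g'
    by (rule ip_cong) (use B0 in auto)
  have nm: "Suc i < n \<longleftrightarrow> i < m" for i by (simp add: n_def)
  have Bw: "ip {..<n} (B (Suc i)) (w (Suc j)) = w3 j i" if "i < m" "j < m" for i j
  proof -
    have "ip {..<n} (B (Suc i)) (w (Suc j)) = (\<Sum>k<m. if k = i then w3 j k else 0)"
      unfolding w_def nat.case ip_sum_right
      using that by (intro sum.cong refl) (auto simp: on nm)
    then show ?thesis using that by simp
  qed
  have vw: "ip {..<n} v (w (Suc j)) = 0" if "j < m" for j
    unfolding w0 w_def nat.case ip_sum_right
    using that n by (intro sum.neutral) (auto simp: on nm)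
  have ww: "ip {..<n} (w (Suc j)) (w (Suc l)) = (if j = l then 1 else 0)" if "j < m" "l < m" for j l
  proof -
    have "ip {..<n} (w (Suc j)) (w (Suc l)) = (\<Sum>i<m. cnj (w3 j i) * ip {..<n} (B (Suc i)) (w (Suc l)))"
      by (subst w_def) (simp add: ip_sum_left)
    also have "\<dots> = ip {..<m} (w3 j) (w3 l)"
      using that by (simp add: Bw ip_def[of "{..<m}"])
    finally show ?thesis using w3 that by (simp add: orthonormal_def)
  qed
  have "orthonormal {..<n} {..<n} w"
    unfolding orthonormal_def
  proof (intro ballI)
    fix j l assume "j \<in> {..<n}" "l \<in> {..<n}"
    moreover have "ip {..<n} (w (Suc j)) v = 0" if "j < m" for j
      using vw[OF that] by (metis cnj_ip complex_cnj_zero)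
    moreover have "ip {..<n} v v = 1" by (simp add: ip_self v)
    moreover have "w 0 = v" by (simp add: w_def)
    ultimately show "ip {..<n} (w j) (w l) = (if j = l then 1 else 0)"
      by (cases j; cases l) (auto simp: ww vw nm)
  qed
  moreover have "(\<Sum>b<n. f a b * w j b) = lam j * w j a" if ja: "j < n" "a < n" for j a
  proof (cases j)
    case 0
    then show ?thesis using evv[OF ja(2)] by (simp add: w_def lam_def)
  next
    case (Suc l)
    then have l: "l < m" using ja by (simp add: nm)
    have 1: "ip {..<n} (B 0) (F (w (Suc l))) = 0"
    proof -
      have "ip {..<n} (B 0) (F (w (Suc l))) = ip {..<n} (F v) (w (Suc l))"
        unfolding w0[symmetric] by (rule Fsym)
      \<comment> \<open>The scalar multiple is written as a one-term sum so that
        \<open>ip_sum_left\<close> can extract \<open>\<kappa>\<close>.\<close>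
      also have "\<dots> = ip {..<n} (\<lambda>a. \<Sum>t\<in>{()}. \<kappa> * v a) (w (Suc l))"
        by (rule ip_cong) (simp_all add: F_def evv)
      also have "\<dots> = 0" unfolding ip_sum_left by (simp add: vw l)
      finally show ?thesis .
    qed
    have 2: "ip {..<n} (B (Suc i)) (F (w (Suc l))) = lam3 l * w3 l i" if "i < m" for i
    proof -
      have "F (w (Suc l)) a = (\<Sum>k<m. w3 l k * F (B (Suc k)) a)" for a
        unfolding F_def w_def nat.case
        by (simp add: sum_distrib_left mult_ac) (rule sum.swap)
      then have "ip {..<n} (B (Suc i)) (F (w (Suc l))) = ip {..<n} (B (Suc i)) (\<lambda>a. \<Sum>k<m. w3 l k * F (B (Suc k)) a)"
        by presburger
      also have "\<dots> = (\<Sum>k<m. g i k * w3 l k)"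
        unfolding ip_sum_right g_def by (simp add: mult.commute)
      finally show ?thesis using ev3[OF l that] by simp
    qed
    have "F (w (Suc l)) a = (\<Sum>i<n. ip {..<n} (B i) (F (w (Suc l))) * B i a)"
      by (rule expand[OF ja(2)])
    also have "\<dots> = (\<Sum>i<m. lam3 l * w3 l i * B (Suc i) a)"
      unfolding n_def sum.lessThan_Suc_shift by (simp add: 1 2 flip: n_def)
    also have "\<dots> = lam j * w j a"
      by (simp add: Suc lam_def w_def sum_distrib_left mult.assoc)
    finally show ?thesis by (simp add: F_def Suc)
  qed
  ultimately show ?case unfolding n_def by blast
qed

text \<open>Each eigenvalue is the quadratic form at its unit eigenvector, and for a mixture with
  nonnegative weights this is a nonnegative real.\<close>

lemma gram_eigenbasis:
  fixes f :: "nat \<Rightarrow> nat \<Rightarrow> complex"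
  assumes T: "finite T" and c: "\<And>t. t \<in> T \<Longrightarrow> c t \<ge> 0"
    and f: "\<And>a b. a < n \<Longrightarrow> b < n \<Longrightarrow> f a b = gram T c \<phi> a b"
  obtains w lam where "orthonormal {..<n} {..<n} w"
    "\<And>j a. j < n \<Longrightarrow> a < n \<Longrightarrow> (\<Sum>b<n. f a b * w j b) = of_real (lam j) * w j a"
    "\<And>j. j < n \<Longrightarrow> lam j \<ge> 0"
proof -
  have "f a b = cnj (f b a)" if "a < n" "b < n" for a b
    using that by (simp add: f gram_def mult_ac)
  then obtain w lam where w: "orthonormal {..<n} {..<n} w"
    and ev: "\<And>j a. j < n \<Longrightarrow> a < n \<Longrightarrow> (\<Sum>b<n. f a b * w j b) = lam j * w j a"
    using hermitian_eigenbasis[of n f] by blast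
  have lam: "lam j = of_real (\<Sum>t\<in>T. c t * (cmod (ip {..<n} (w j) (\<phi> t)))\<^sup>2)" if j: "j < n" for j
  proof -
    have "bf {..<n} f (w j) (w j) = (\<Sum>a<n. cnj (w j a) * (\<Sum>b<n. f a b * w j b))"
      by (simp add: bf_def sum_distrib_left mult.assoc)
    also have "\<dots> = lam j * ip {..<n} (w j) (w j)"
      by (simp add: ev[OF j] ip_def sum_distrib_left mult_ac)
    finally have "lam j = bf {..<n} f (w j) (w j)"
      using w j by (simp add: orthonormal_def)
    also have "\<dots> = of_real (\<Sum>t\<in>T. c t * (cmod (ip {..<n} (w j) (\<phi> t)))\<^sup>2)"
      by (rule qf_gram) (use T f in auto)
    finally show ?thesis .
  qed
  show thesis
  proof (rule that[OF w])
    show "(\<Sum>b<n. f a b * w j b) = of_real (Re (lam j)) * w j a" if "j < n" "a < n" for j a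
      using ev[OF that] lam[OF that(1)] by simp
    show "Re (lam j) \<ge> 0" if "j < n" for j
      unfolding lam[OF that] using c by (auto intro!: sum_nonneg)
  qed
qed

text \<open>A full eigenbasis conjugates the matrix to diagonal form, so the roots of the
  characteristic polynomial are the \<open>lam j\<close> with multiplicity. Zero eigenvalues occur
  among these roots but not in \<open>spectral\<close>; the two entropies agree because
  \<open>eta 0 = 0\<close>.\<close>

lemma
  fixes f :: "nat \<Rightarrow> nat \<Rightarrow> complex"
  assumes w: "orthonormal {..<n} {..<n} w"
    and ev: "\<And>j a. j < n \<Longrightarrow> a < n \<Longrightarrow> (\<Sum>b<n. f a b * w j b) = of_real (lam j) * w j a"
    and lam: "\<And>j. j < n \<Longrightarrow> lam j \<ge> 0"
  shows eigenbasis_has_ent: "has_ent {..<n} f (\<Sum>j<n. eta (lam j))"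
    and eigenbasis_vn_entropy: "vn_entropy (mat n n (\<lambda>(a,b). f a b)) = (\<Sum>j<n. eta (lam j))"
    and eigenbasis_trace: "(\<Sum>a<n. f a a) = of_real (\<Sum>j<n. lam j)"
proof -
  define A where "A = mat n n (\<lambda>(a,b). f a b)"
  define U where "U = mat n n (\<lambda>(a,j). w j a)"
  define V where "V = mat n n (\<lambda>(j,a). cnj (w j a))"
  define D where "D = mat n n (\<lambda>(i,j). if i = j then complex_of_real (lam j) else 0)"
  have [simp]: "A \<in> carrier_mat n n" "U \<in> carrier_mat n n" "V \<in> carrier_mat n n" "D \<in> carrier_mat n n"
    by (simp_all add: A_def U_def V_def D_def)
  have VU: "V * U = 1\<^sub>m n"
  proof (rule eq_matI)
    fix i j assume "i < dim_row (1\<^sub>m n)" "j < dim_col (1\<^sub>m n)"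
    then have ij: "i < n" "j < n" by simp_all
    then have "(V * U) $$ (i,j) = ip {..<n} (w i) (w j)"
      by (simp add: V_def U_def scalar_prod_def ip_def lessThan_atLeast0)
    then show "(V * U) $$ (i,j) = 1\<^sub>m n $$ (i,j)" using w ij by (simp add: orthonormal_def)
  qed (simp_all add: V_def U_def)
  then have UV: "U * V = 1\<^sub>m n" by (rule mat_mult_left_right_inverse[rotated 2]) simp_all
  have UD: "(U * D) $$ (i,j) = of_real (lam j) * w j i" if "i < n" "j < n" for i j
    using that by (simp add: U_def D_def scalar_prod_def lessThan_atLeast0[symmetric] if_distrib[of "\<lambda>x. _ * x"] mult.commute cong: if_cong)
  have "A * U = U * D"
  proof (rule eq_matI)
    fix i j assume "i < dim_row (U * D)" "j < dim_col (U * D)"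
    then have ij: "i < n" "j < n" by (simp_all add: U_def D_def)
    then have "(A * U) $$ (i,j) = (\<Sum>b<n. f i b * w j b)"
      by (simp add: A_def U_def scalar_prod_def lessThan_atLeast0)
    then show "(A * U) $$ (i,j) = (U * D) $$ (i,j)" using ev[OF ij(2,1)] UD[OF ij] by simp
  qed (simp_all add: A_def U_def D_def)
  then have A: "A = U * D * V"
    using UV by (metis \<open>A \<in> carrier_mat n n\<close> \<open>U \<in> carrier_mat n n\<close> \<open>V \<in> carrier_mat n n\<close> assoc_mult_mat right_mult_one_mat)
  have "similar_mat A D"
    by (rule similar_matI[OF _ UV VU A]) simp
  then have "char_poly A = char_poly D" by (rule char_poly_similar)
  also have "\<dots> = (\<Prod>a\<leftarrow>diag_mat D. [:- a, 1:])"
    by (rule char_poly_upper_triangular[of _ n]) (auto simp: upper_triangular_def D_def)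
  also have "diag_mat D = map (\<lambda>j. complex_of_real (lam j)) [0..<n]"
    by (auto simp: diag_mat_def D_def)
  finally have cp: "char_poly A = (\<Prod>j\<leftarrow>[0..<n]. [:- complex_of_real (lam j), 1:])"
    by (simp add: o_def)
  have "proots (\<Prod>j\<leftarrow>js. [:- complex_of_real (lam j), 1:]) = mset (map (\<lambda>j. complex_of_real (lam j)) js)" for js
  proof (induction js)
    case (Cons j js)
    have nz: "(\<Prod>j\<leftarrow>js. [:- complex_of_real (lam j), 1:]) \<noteq> 0"
      by (auto simp: prod_list_zero_iff)
    have "proots ([:- complex_of_real (lam j), 1:] * (\<Prod>j\<leftarrow>js. [:- complex_of_real (lam j), 1:]))
      = proots [:- complex_of_real (lam j), 1:] + proots (\<Prod>j\<leftarrow>js. [:- complex_of_real (lam j), 1:])"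
      by (rule proots_mult[OF _ nz]) simp
    then show ?case
      unfolding list.map prod_list.Cons Cons.IH proots_linear_factor by simp
  qed simp
  then have "vn_entropy A = - sum_list (map (\<lambda>j. lam j * log 2 (lam j)) [0..<n])"
    unfolding vn_entropy_def cp by (simp add: sum_mset_sum_list multiset.map_comp o_def flip: mset_map)
  also have "\<dots> = (\<Sum>j<n. eta (lam j))"
    by (simp add: eta_def sum_negf interv_sum_list_conv_sum_set_nat lessThan_atLeast0)
  finally show "vn_entropy (mat n n (\<lambda>(a,b). f a b)) = (\<Sum>j<n. eta (lam j))"
    by (simp add: A_def)
  have fab: "f a b = (\<Sum>j<n. of_real (lam j) * w j a * cnj (w j b))" if "a < n" "b < n" for a b
  proof -
    have "f a b = A $$ (a,b)" using that by (simp add: A_def)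
    also have "\<dots> = (U * D * V) $$ (a,b)" by (simp only: A)
    also have "\<dots> = (\<Sum>j<n. (U * D) $$ (a,j) * V $$ (j,b))"
      using that by (simp add: scalar_prod_def U_def V_def D_def lessThan_atLeast0)
    also have "\<dots> = (\<Sum>j<n. of_real (lam j) * w j a * cnj (w j b))"
      using that UD by (intro sum.cong refl) (simp add: V_def)
    finally show ?thesis .
  qed
  show "(\<Sum>a<n. f a a) = of_real (\<Sum>j<n. lam j)"
  proof -
    have "(\<Sum>a<n. f a a) = (\<Sum>j<n. of_real (lam j) * ip {..<n} (w j) (w j))"
      by (simp add: fab ip_def sum_distrib_left mult_ac) (rule sum.swap)
    then show ?thesis using w by (simp add: orthonormal_def)
  qed
  let ?J = "{j \<in> {..<n}. lam j > 0}"
  have J0: "lam j = 0" if "j \<in> {..<n} - ?J" for j using that lam[of j] by auto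
  have "spectral {..<n} f ?J lam w"
    unfolding spectral_def
  proof (intro conjI ballI)
    show "orthonormal {..<n} ?J w" using w by (simp add: orthonormal_def)
    show "f a b = gram ?J lam w a b" if "a \<in> {..<n}" "b \<in> {..<n}" for a b
    proof -
      have "gram ?J lam w a b = (\<Sum>j<n. of_real (lam j) * w j a * cnj (w j b))"
        unfolding gram_def using J0 by (intro sum.mono_neutral_left) auto
      then show ?thesis using fab that by simp
    qed
  qed auto
  note spectral_has_ent[OF this]
  moreover have "(\<Sum>j\<in>?J. eta (lam j)) = (\<Sum>j<n. eta (lam j))"
  proof (rule sum.mono_neutral_left)
    show "\<forall>j\<in>{..<n} - ?J. eta (lam j) = 0" using J0 eta_0 by metis
  qed auto
  ultimately show "has_ent {..<n} f (\<Sum>j<n. eta (lam j))" by simp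
qed

section \<open>Von Neumann entropy in terms of kernels\<close>

lemma vn_entropy_has_ent:
  fixes f :: "nat \<Rightarrow> nat \<Rightarrow> complex"
  assumes "finite T" "\<And>t. t \<in> T \<Longrightarrow> c t \<ge> 0"
    and "\<And>a b. a < n \<Longrightarrow> b < n \<Longrightarrow> f a b = gram T c \<phi> a b"
  shows "has_ent {..<n} f (vn_entropy (mat n n (\<lambda>(a,b). f a b)))"
proof (rule gram_eigenbasis[where f = f, OF assms])
  fix w lam assume "orthonormal {..<n} {..<n} w"
    "\<And>j a. j < n \<Longrightarrow> a < n \<Longrightarrow> (\<Sum>b<n. f a b * w j b) = of_real (lam j) * w j a"
    "\<And>j. j < n \<Longrightarrow> lam j \<ge> 0"
  from eigenbasis_has_ent[OF this] eigenbasis_vn_entropy[OF this] show ?thesis by simp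
qed

lemma vn_entropy_eqI:
  assumes "has_ent {..<n} f h"
  shows "vn_entropy (mat n n (\<lambda>(a,b). f a b)) = h"
proof -
  from assms obtain J :: "nat set" and lam w where sp: "spectral {..<n} f J lam w"
    unfolding has_ent_def by blast
  note S = spectralD[OF sp]
  have "has_ent {..<n} f (vn_entropy (mat n n (\<lambda>(a,b). f a b)))"
    by (rule vn_entropy_has_ent[where c = lam and T = J]) (use S in \<open>auto intro: less_imp_le\<close>)
  then show ?thesis using assms by (intro has_ent_unique[of "{..<n}"]) auto
qed

lemma vn_entropy_reindex:
  assumes "bij_betw g {..<n} I" "has_ent I M h"
  shows "vn_entropy (mat n n (\<lambda>(a,b). M (g a) (g b))) = h"
  by (intro vn_entropy_eqI has_ent_reindex[OF assms])

lemma gram_has_ent: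
  fixes I :: "'i set"
  assumes "finite I" "finite T" "\<And>t. t \<in> T \<Longrightarrow> c t \<ge> 0"
  shows "\<exists>h. has_ent I (gram T c \<phi>) h"
proof -
  obtain g where g: "bij_betw g {..<card I} I"
    using ex_bij_betw_nat_finite[OF assms(1)] by (auto simp: lessThan_atLeast0)
  let ?g = "inv_into {..<card I} g"
  have "has_ent {..<card I} (\<lambda>a b. gram T c \<phi> (g a) (g b))
     (vn_entropy (mat (card I) (card I) (\<lambda>(a,b). gram T c \<phi> (g a) (g b))))"
    by (rule vn_entropy_has_ent[OF assms(2,3), where \<phi> = "\<lambda>t a. \<phi> t (g a)"]) (auto simp: gram_def)
  from has_ent_reindex[OF bij_betw_inv_into[OF g] this]
  have "has_ent I (\<lambda>a b. gram T c \<phi> (g (?g a)) (g (?g b)))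
     (vn_entropy (mat (card I) (card I) (\<lambda>(a,b). gram T c \<phi> (g a) (g b))))" .
  then have "has_ent I (gram T c \<phi>)
     (vn_entropy (mat (card I) (card I) (\<lambda>(a,b). gram T c \<phi> (g a) (g b))))"
    by (rule has_ent_cong) (use bij_betw_inv_into_right[OF g] in simp)
  then show ?thesis by blast
qed

lemma has_ent_qubit:
  fixes f :: "nat \<Rightarrow> nat \<Rightarrow> complex"
  assumes h: "has_ent {..<2} f h"
    and tr: "f 0 0 + f 1 1 = of_real (l1 + l2)"
    and det: "f 0 0 * f 1 1 - f 0 1 * f 1 0 = of_real (l1 * l2)"
  shows "h = eta l1 + eta l2"
proof -
  from h obtain J :: "nat set" and mu u where sp: "spectral {..<2} f J mu u"
    unfolding has_ent_def by blast
  note S = spectralD[OF sp]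
  have two: "{..<2::nat} = {0, 1}" by auto
  obtain w :: "nat \<Rightarrow> nat \<Rightarrow> complex" and lam :: "nat \<Rightarrow> real"
    where w: "orthonormal {..<2} {..<2} w"
    and ev: "\<And>j a. j < 2 \<Longrightarrow> a < 2 \<Longrightarrow> (\<Sum>b<2. f a b * w j b) = of_real (lam j) * w j a"
    and lam: "\<And>j. j < 2 \<Longrightarrow> lam j \<ge> 0"
    by (rule gram_eigenbasis[of J mu 2 f u]) (use S in \<open>auto intro: less_imp_le\<close>)
  have "h = (\<Sum>j<2. eta (lam j))"
    by (rule has_ent_unique[OF _ h eigenbasis_has_ent[OF w ev lam]]) auto
  then have h': "h = eta (lam 0) + eta (lam 1)" by (simp add: two)
  have "lam 0 + lam 1 = l1 + l2"
    using eigenbasis_trace[OF w ev lam] tr by (simp add: two flip: of_real_add)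
  moreover have "lam 0 = l1 \<or> lam 0 = l2"
  proof -
    let ?x = "complex_of_real (lam 0)"
    have e: "f 0 0 * w 0 0 + f 0 1 * w 0 1 = ?x * w 0 0" "f 1 0 * w 0 0 + f 1 1 * w 0 1 = ?x * w 0 1"
      using ev[of 0 0] ev[of 0 1] by (simp_all add: two)
    have "nsq {..<2} (w 0) = 1" by (rule orthonormal_nsq[OF w]) simp
    then have nz: "w 0 0 \<noteq> 0 \<or> w 0 1 \<noteq> 0" by (auto simp: nsq_def two)
    \<comment> \<open>Elimination in the eigenvector equations: the characteristic polynomial at
      \<open>lam 0\<close> annihilates both coordinates of \<open>w 0\<close>, one of which is
      nonzero.\<close>
    have "((f 0 0 - ?x) * (f 1 1 - ?x) - f 0 1 * f 1 0) * w 0 0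
      = (f 1 1 - ?x) * (f 0 0 * w 0 0 + f 0 1 * w 0 1 - ?x * w 0 0) - f 0 1 * (f 1 0 * w 0 0 + f 1 1 * w 0 1 - ?x * w 0 1)"
      "((f 0 0 - ?x) * (f 1 1 - ?x) - f 0 1 * f 1 0) * w 0 1
      = (f 0 0 - ?x) * (f 1 0 * w 0 0 + f 1 1 * w 0 1 - ?x * w 0 1) - f 1 0 * (f 0 0 * w 0 0 + f 0 1 * w 0 1 - ?x * w 0 0)"
      by (simp_all add: algebra_simps)
    then have "((f 0 0 - ?x) * (f 1 1 - ?x) - f 0 1 * f 1 0) * w 0 0 = 0"
      "((f 0 0 - ?x) * (f 1 1 - ?x) - f 0 1 * f 1 0) * w 0 1 = 0"
      by (simp_all only: e diff_self mult_zero_right)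
    then have "(f 0 0 - ?x) * (f 1 1 - ?x) - f 0 1 * f 1 0 = 0" using nz by auto
    moreover have "(?x - of_real l1) * (?x - of_real l2) = ?x * ?x - of_real (l1 + l2) * ?x + of_real (l1 * l2)"
      by (simp add: algebra_simps)
    then have "(?x - of_real l1) * (?x - of_real l2) = (f 0 0 - ?x) * (f 1 1 - ?x) - f 0 1 * f 1 0"
      unfolding tr[symmetric] det[symmetric] by (simp add: algebra_simps)
    ultimately have "(?x - of_real l1) * (?x - of_real l2) = 0" by simp
    then show ?thesis by auto
  qed
  ultimately show ?thesis unfolding h' by auto
qed

section \<open>Convexity of the single-letter trade-off\<close>

text \<open>The bound is the positive root \<open>a\<close> of
  \<open>2 * a^2 = x * (a + x / (1 - x^2))\<close>, the equality case of
  \<open>artanh_quadratic_bound\<close>. Both sides vanish at 0. With \<open>w\<close> the square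
  root in the bound, the derivative of the difference is
  \<open>(w + 1)^2 * (w - 3)^2 / (32 * w)\<close>, where \<open>w = 3\<close> at 0.\<close>

lemma artanh_upper_bound:
  fixes x :: real
  assumes "0 \<le> x" "x < 1"
  shows "artanh x \<le> x * (1 + sqrt ((9 - x\<^sup>2) / (1 - x\<^sup>2))) / 4"
proof -
  define D where "D z = z * (1 + sqrt ((9 - z\<^sup>2) / (1 - z\<^sup>2))) / 4 - artanh z" for z :: real
  have "D 0 \<le> D x"
  proof (rule DERIV_nonneg_imp_nondecreasing[OF assms(1)])
    fix z assume z: "0 \<le> z" "z \<le> x"
    then have z2: "z\<^sup>2 < 1" using assms(2) by (simp add: abs_square_less_1)
    define y where "y = 1 / (1 - z\<^sup>2)"
    define w where "w = sqrt ((9 - z\<^sup>2) / (1 - z\<^sup>2))"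
    have u: "(9 - z\<^sup>2) / (1 - z\<^sup>2) > 0" using z2 by simp
    have w: "w > 0" using u by (simp add: w_def)
    have y: "y > 0" using z2 by (simp add: y_def)
    have w2: "w\<^sup>2 = 1 + 8 * y" using u z2 by (simp add: w_def y_def field_simps)
    have zy: "z\<^sup>2 * y = y - 1" using z2 by (simp add: y_def field_simps)
    let ?d = "(1 + w) / 4 + 2 * (y\<^sup>2 - y) / w - y"
    have "(D has_real_derivative ?d) (at z)"
    proof -
      have "((\<lambda>z. (9 - z\<^sup>2) / (1 - z\<^sup>2)) has_real_derivative 16 * z * y\<^sup>2) (at z)"
        using z2 by (auto intro!: derivative_eq_intros simp: y_def power2_eq_square field_simps)
      then have "((\<lambda>z. sqrt ((9 - z\<^sup>2) / (1 - z\<^sup>2))) has_real_derivative inverse w / 2 * (16 * z * y\<^sup>2)) (at z)"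
        unfolding w_def
        by (rule DERIV_chain2[where f = sqrt and g = "\<lambda>z. (9 - z\<^sup>2) / (1 - z\<^sup>2)", OF DERIV_real_sqrt[OF u]])
      moreover have "(artanh has_real_derivative y) (at z)"
        unfolding y_def using z assms(2) by (intro artanh_real_has_field_derivative) auto
      ultimately have "(D has_real_derivative (1 * (1 + w) + (0 + inverse w / 2 * (16 * z * y\<^sup>2)) * z) / 4 - y) (at z)"
        unfolding D_def w_def
        by (intro DERIV_diff DERIV_cdivide DERIV_mult DERIV_ident DERIV_add DERIV_const)
      moreover have "z * (z * y\<^sup>2) = y\<^sup>2 - y"
      proof -
        have "z * (z * y\<^sup>2) = (z\<^sup>2 * y) * y" by (simp add: power2_eq_square)
        then show ?thesis unfolding zy by (simp add: power2_eq_square algebra_simps)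
      qed
      then have E: "inverse w / 2 * (16 * z * y\<^sup>2) * z = 4 * (2 * (y\<^sup>2 - y) / w)"
        by (simp add: field_simps)
      have c4: "4 * q / 4 = q" for q :: real by simp
      note \<open>(D has_real_derivative _) (at z)\<close>
      then show ?thesis
        unfolding add_0_left E mult_1_left add_divide_distrib[of _ "4 * _"] c4 .
    qed
    moreover have "?d \<ge> 0"
    proof -
      have y8: "y = (w\<^sup>2 - 1) / 8" using w2 by simp
      have "32 * w * ?d = 8 * w * (1 + w) + 64 * (y\<^sup>2 - y) - 32 * w * y"
        using w by (simp add: field_simps)
      also have "\<dots> = (w + 1)\<^sup>2 * (w - 3)\<^sup>2"
        unfolding y8 by (simp add: power2_eq_square field_simps)
      finally have "32 * w * ?d \<ge> 0" by simp
      then show ?thesis using w by (simp add: zero_le_mult_iff)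
    qed
    ultimately show "\<exists>d. (D has_real_derivative d) (at z) \<and> d \<ge> 0" by blast
  qed
  then show ?thesis by (simp add: D_def)
qed

lemma artanh_real_pos: "0 < x \<Longrightarrow> x < 1 \<Longrightarrow> artanh (x::real) > 0"
  by (simp add: artanh_def field_simps)

lemma artanh_quadratic_bound:
  fixes x :: real
  assumes "0 < x" "x < 1"
  shows "2 * (artanh x)\<^sup>2 \<le> x * (artanh x + x / (1 - x\<^sup>2))"
proof -
  define w where "w = sqrt ((9 - x\<^sup>2) / (1 - x\<^sup>2))"
  have x2: "x\<^sup>2 < 1" using assms by (simp add: abs_square_less_1)
  have "(9 - x\<^sup>2) / (1 - x\<^sup>2) \<ge> 1" using x2 by (simp add: field_simps)
  then have w1: "w \<ge> 1" by (simp add: w_def)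
  have w2: "w\<^sup>2 = 1 + 8 / (1 - x\<^sup>2)" using x2 by (simp add: w_def field_simps)
  \<comment> \<open>The quadratic is factored over its two roots. \<open>artanh x\<close> lies
    between them: the upper one is \<open>artanh_upper_bound\<close>, the lower one is
    nonpositive.\<close>
  have "(artanh x - x * (1 + w) / 4) * (artanh x - x * (1 - w) / 4) \<le> 0"
  proof (rule mult_nonpos_nonneg)
    show "artanh x - x * (1 + w) / 4 \<le> 0"
      using artanh_upper_bound[of x] assms by (simp add: w_def)
    have "x * (1 - w) \<le> 0" using assms w1 by (simp add: mult_nonneg_nonpos)
    then show "artanh x - x * (1 - w) / 4 \<ge> 0" using artanh_real_pos[OF assms] by linarith
  qed
  also have "(artanh x - x * (1 + w) / 4) * (artanh x - x * (1 - w) / 4)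
      = (artanh x)\<^sup>2 - x * artanh x / 2 - x\<^sup>2 * (w\<^sup>2 - 1) / 16"
    by (simp add: power2_eq_square algebra_simps) (simp add: field_simps)
  finally have "2 * (artanh x)\<^sup>2 \<le> x * artanh x + 2 * (x\<^sup>2 * (w\<^sup>2 - 1) / 16)" by simp
  also have "2 * (x\<^sup>2 * (w\<^sup>2 - 1) / 16) = x * (x / (1 - x\<^sup>2))"
  proof -
    have "2 * (x\<^sup>2 * (8 * q) / 16) = x * (x * q)" for q by (simp add: power2_eq_square)
    from this[of "1 / (1 - x\<^sup>2)"] show ?thesis unfolding w2 by simp
  qed
  finally show ?thesis by (simp add: algebra_simps)
qed

text \<open>In \<open>slope_antimono\<close> the logarithmic derivative of the slope is a positive
  factor times a difference of two values of this function. The sign of its own derivative is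
  \<open>artanh_quadratic_bound\<close>.\<close>

lemma artanh_log_slope_antimono:
  fixes x z :: real
  assumes "0 < x" "x \<le> z" "z < 1"
  shows "1 / (z * artanh z) - 1 / z\<^sup>2 \<le> 1 / (x * artanh x) - 1 / x\<^sup>2"
proof (rule DERIV_nonpos_imp_nonincreasing[OF assms(2)])
  fix t assume "x \<le> t" "t \<le> z"
  then have t: "0 < t" "t < 1" using assms by auto
  let ?a = "artanh t" and ?y = "1 / (1 - t\<^sup>2)"
  note a = artanh_real_pos[OF t]
  have da: "(artanh has_real_derivative ?y) (at t)"
    using t by (intro artanh_real_has_field_derivative) auto
  have "((\<lambda>t. 1 / (t * artanh t) - 1 / t\<^sup>2) has_real_derivative
     - (?a + t * ?y) / (t * ?a)\<^sup>2 + 2 / t ^ 3) (at t)"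
  proof -
    have "((\<lambda>t. t * artanh t) has_real_derivative ?a + t * ?y) (at t)"
      using DERIV_mult[OF DERIV_ident da] by (simp add: add.commute mult.commute)
    then have 1: "((\<lambda>t. inverse (t * artanh t)) has_real_derivative
        - (?a + t * ?y) / (t * ?a)\<^sup>2) (at t)"
      by (rule DERIV_cong[OF DERIV_inverse_fun]) (use t a in \<open>simp_all add: divide_inverse power2_eq_square algebra_simps\<close>)
    have 2: "((\<lambda>t. 1 / t\<^sup>2) has_real_derivative - (2 / t ^ 3)) (at t)"
      using t by (auto intro!: derivative_eq_intros simp: power2_eq_square power3_eq_cube)
    from DERIV_diff[OF 1 2] show ?thesis by (simp add: inverse_eq_divide)
  qed
  moreover have "- (?a + t * ?y) / (t * ?a)\<^sup>2 + 2 / t ^ 3 \<le> 0"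
  proof -
    have "2 / t ^ 3 = 2 * ?a\<^sup>2 / (t * (t * ?a)\<^sup>2)"
      using t a by (simp add: power2_eq_square power3_eq_cube field_simps)
    also have "\<dots> \<le> t * (?a + t / (1 - t\<^sup>2)) / (t * (t * ?a)\<^sup>2)"
      by (intro divide_right_mono artanh_quadratic_bound t) (use t in simp)
    also have "\<dots> = (?a + t * ?y) / (t * ?a)\<^sup>2" using t by simp
    finally show ?thesis by (simp add: diff_divide_distrib add_divide_distrib)
  qed
  ultimately show "\<exists>d. ((\<lambda>t. 1 / (t * artanh t) - 1 / t\<^sup>2) has_real_derivative d) (at t) \<and> d \<le> 0"
    by blast
qed

text \<open>\<open>x\<close> is the bias \<open>\<bar>1 - 2 * \<mu>\<bar>\<close> of the input bit
  and \<open>r\<close> the Bloch radius \<open>2 * gamma_fn \<mu> p - 1\<close> of the environment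
  qubit, for \<open>c = p * (2 - p)\<close>.\<close>

lemma contracted_radius:
  fixes c x :: real
  assumes "0 < c" "c \<le> 1" "0 < x" "x < 1"
  defines "r \<equiv> sqrt (1 - c + c * x\<^sup>2)"
  shows "r\<^sup>2 = 1 - c + c * x\<^sup>2" "x \<le> r" "r < 1" "1 - c + c * x\<^sup>2 > 0"
proof -
  have x2: "x\<^sup>2 < 1" "x\<^sup>2 > 0" using assms by (simp_all add: abs_square_less_1)
  have "c * x\<^sup>2 > 0" using assms x2 by simp
  then show pos: "1 - c + c * x\<^sup>2 > 0" using assms by linarith
  then show "r\<^sup>2 = 1 - c + c * x\<^sup>2" by (simp add: r_def)
  have "(1 - c) * x\<^sup>2 \<le> (1 - c) * 1" using assms x2 by (intro mult_left_mono) auto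
  then have "x\<^sup>2 \<le> 1 - c + c * x\<^sup>2" by (simp add: algebra_simps)
  then show "x \<le> r" unfolding r_def by (rule real_le_rsqrt)
  have "c * x\<^sup>2 < c * 1" using assms x2 by (intro mult_strict_left_mono) auto
  then show "r < 1" by (simp add: r_def)
qed

lemma contracted_radius_derivative:
  fixes c t :: real
  assumes "0 < c" "c \<le> 1" "0 < t" "t < 1"
  shows "((\<lambda>x. sqrt (1 - c + c * x\<^sup>2)) has_real_derivative c * t / sqrt (1 - c + c * t\<^sup>2)) (at t)"
proof -
  have "((\<lambda>x. 1 - c + c * x\<^sup>2) has_real_derivative 2 * c * t) (at t)"
    by (auto intro!: derivative_eq_intros)
  from DERIV_chain2[where f = sqrt and g = "\<lambda>x. 1 - c + c * x\<^sup>2",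
      OF DERIV_real_sqrt[OF contracted_radius(4)[OF assms]] this]
  show ?thesis by (simp add: field_simps)
qed

text \<open>Up to the factor \<open>c\<close>, this is the slope of the output entropy as a function of the input
  entropy.\<close>
lemma slope_antimono:
  fixes c x z :: real
  assumes c: "0 < c" "c \<le> 1" and xz: "0 < x" "x \<le> z" "z < 1"
  defines "r \<equiv> \<lambda>x. sqrt (1 - c + c * x\<^sup>2)"
  shows "(artanh (r z) / r z) / (artanh z / z) \<le> (artanh (r x) / r x) / (artanh x / x)"
proof -
  define L where "L t = ln (artanh (r t)) - ln (r t) - (ln (artanh t) - ln t)" for t
  have pos: "0 < r t" "r t < 1" "artanh (r t) > 0" "artanh t > 0" "t \<le> r t" "(r t)\<^sup>2 = 1 - c + c * t\<^sup>2"
    if t: "0 < t" "t < 1" for t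
  proof -
    show "t \<le> r t" "r t < 1" "(r t)\<^sup>2 = 1 - c + c * t\<^sup>2"
      using contracted_radius[OF c t] by (simp_all add: r_def)
    then show "0 < r t" using t by linarith
    then show "artanh (r t) > 0" using \<open>r t < 1\<close> by (rule artanh_real_pos)
    show "artanh t > 0" using t by (rule artanh_real_pos)
  qed
  have "L z \<le> L x"
  proof (rule DERIV_nonpos_imp_nonincreasing[OF xz(2)])
    fix t assume "x \<le> t" "t \<le> z"
    then have t: "0 < t" "t < 1" using xz by auto
    note p = pos[OF t]
    define a where "a = artanh t"
    define b where "b = artanh (r t)"
    have t2: "t\<^sup>2 < 1" using t by (simp add: abs_square_less_1)
    \<comment> \<open>This identity lets the derivatives of all four logarithms be collected over
      the common factor \<open>t / (1 - t^2)\<close>.\<close>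
    have r1: "1 - (r t)\<^sup>2 = c * (1 - t\<^sup>2)" using p by (simp add: algebra_simps)
    have dr: "(r has_real_derivative c * t / r t) (at t)"
      unfolding r_def by (rule contracted_radius_derivative[OF c t])
    have da: "(artanh has_real_derivative 1 / (1 - s\<^sup>2)) (at s)" if "0 < s" "s < 1" for s :: real
      using that by (intro artanh_real_has_field_derivative) auto
    have db: "((\<lambda>t. artanh (r t)) has_real_derivative 1 / (1 - (r t)\<^sup>2) * (c * t / r t)) (at t)"
      by (rule DERIV_chain2[OF da[OF p(1,2)] dr])
    have "(L has_real_derivative
        inverse b * (1 / (1 - (r t)\<^sup>2) * (c * t / r t)) - inverse (r t) * (c * t / r t)
         - (inverse a * (1 / (1 - t\<^sup>2)) - inverse t)) (at t)"
      unfolding L_def a_def b_def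
      by (intro DERIV_diff DERIV_chain2[OF DERIV_ln db] DERIV_chain2[OF DERIV_ln dr]
          DERIV_chain2[OF DERIV_ln da[OF t]] DERIV_ln p t)
    moreover have "inverse b * (1 / (1 - (r t)\<^sup>2) * (c * t / r t)) - inverse (r t) * (c * t / r t)
         - (inverse a * (1 / (1 - t\<^sup>2)) - inverse t)
       = t / (1 - t\<^sup>2) * ((1 / (r t * b) - 1 / (r t)\<^sup>2) - (1 / (t * a) - 1 / t\<^sup>2))" (is "?l = ?r")
    proof -
      have 1: "c * t * inverse (1 - (r t)\<^sup>2) = t / (1 - t\<^sup>2)"
        unfolding r1 using c by (simp add: divide_inverse)
      have 2: "c * t / (r t)\<^sup>2 = t / (1 - t\<^sup>2) * (1 / (r t)\<^sup>2 - 1)"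
      proof -
        have "1 / (r t)\<^sup>2 - 1 = c * (1 - t\<^sup>2) / (r t)\<^sup>2"
          using p(1) r1 by (simp add: field_simps)
        then show ?thesis using t2 by simp
      qed
      have 3: "1 / t = t / (1 - t\<^sup>2) * (1 / t\<^sup>2 - 1)"
        using t t2 by (simp add: field_simps power2_eq_square)
      have "?l = (c * t * inverse (1 - (r t)\<^sup>2)) * (1 / (r t * b)) - c * t / (r t)\<^sup>2
          - t / (1 - t\<^sup>2) * (1 / (t * a)) + 1 / t"
        using t by (simp add: field_simps power2_eq_square)
      also have "\<dots> = t / (1 - t\<^sup>2) * (1 / (r t * b)) - t / (1 - t\<^sup>2) * (1 / (r t)\<^sup>2 - 1)
          - t / (1 - t\<^sup>2) * (1 / (t * a)) + t / (1 - t\<^sup>2) * (1 / t\<^sup>2 - 1)"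
        by (simp only: 1 2 3[symmetric])
      also have "\<dots> = ?r"
      proof -
        have "K * A - K * (B - 1) - K * C + K * (E - 1) = K * ((A - B) - (C - E))" for K A B C E :: real
          by (simp add: algebra_simps)
        then show ?thesis .
      qed
      finally show ?thesis .
    qed
    moreover have "\<dots> \<le> 0"
      unfolding a_def b_def using artanh_log_slope_antimono[OF t(1) p(5,2)] t t2
      by (intro mult_nonneg_nonpos) auto
    ultimately show "\<exists>d. (L has_real_derivative d) (at t) \<and> d \<le> 0" by metis
  qed
  moreover have "L t = ln ((artanh (r t) / r t) / (artanh t / t))" if t: "0 < t" "t < 1" for t
    using pos[OF t] t by (simp add: L_def ln_div ln_mult)
  ultimately have "ln ((artanh (r z) / r z) / (artanh z / z)) \<le> ln ((artanh (r x) / r x) / (artanh x / x))"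
    using xz by simp
  then show ?thesis
    using pos[of x] pos[of z] xz by (subst (asm) ln_le_cancel_iff) auto
qed

section \<open>Binary entropy and tangents of the output-entropy curve\<close>

lemma continuous_on_eta: "continuous_on {0..} eta"
proof -
  have "continuous (at x within {0..}) eta" if x: "x \<ge> 0" for x
  proof (cases "x = 0")
    case True
    have "((\<lambda>t::real. - t * log 2 t) \<longlongrightarrow> 0) (at_right 0)"
      by real_asymp
    then have "(eta \<longlongrightarrow> eta 0) (at_right 0)"
      by (simp add: eta_def[abs_def])
    moreover have "at (0::real) within {0..} = at_right 0"
      by (rule at_within_nhd[of 0 UNIV]) auto
    ultimately show ?thesis using True by (simp add: continuous_within)
  next
    case False
    then have "isCont eta x" using x unfolding eta_def[abs_def] by (intro continuous_intros) auto
    then show ?thesis by (rule continuous_at_imp_continuous_at_within)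
  qed
  then show ?thesis by (simp add: continuous_on_eq_continuous_within)
qed

lemma H2_eta: "H2 x = eta x + eta (1 - x)"
  by (simp add: H2_def eta_def algebra_simps)

lemma continuous_on_H2: "continuous_on {0..1} H2"
  unfolding H2_eta[abs_def]
  by (intro continuous_intros continuous_on_compose2[OF continuous_on_eta]) auto

lemma H2_nonneg: "0 \<le> x \<Longrightarrow> x \<le> 1 \<Longrightarrow> H2 x \<ge> 0"
  by (simp add: H2_eta eta_nonneg)

lemma H2_0 [simp]: "H2 0 = 0" and H2_1 [simp]: "H2 1 = 0"
  by (simp_all add: H2_eta)

lemma H2_half [simp]: "H2 (1/2) = 1"
  by (simp add: H2_def log_divide)

lemma H2_flip: "H2 (1 - x) = H2 x"
  by (simp add: H2_eta)

lemma H2_derivative: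
  fixes x :: real
  assumes "0 \<le> x" "x < 1"
  shows "((\<lambda>x. H2 ((1 + x) / 2)) has_real_derivative - artanh x / ln 2) (at x)"
proof -
  have a: "artanh x = (ln (1 + x) - ln (1 - x)) / 2"
    using assms by (simp add: artanh_def ln_div)
  have l: "ln ((1 + x) / 2) = ln (1 + x) - ln 2" "ln ((1 - x) / 2) = ln (1 - x) - ln 2"
    using assms ln_div[of "1 + x" 2] ln_div[of "1 - x" 2] by simp_all
  have H: "H2 ((1 + x) / 2) = - ((1 + x) / 2) * (ln ((1 + x) / 2) / ln 2) - (1 - x) / 2 * (ln ((1 - x) / 2) / ln 2)" for x
  proof -
    have e: "1 - (1 + x) / 2 = (1 - x) / 2" by (simp add: field_simps)
    show ?thesis unfolding H2_def log_def e ..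
  qed
  have 1: "((\<lambda>x. ln ((1 + x) / 2)) has_real_derivative 1 / (1 + x)) (at x)"
    using assms by (auto intro!: derivative_eq_intros simp: field_simps)
  have 2: "((\<lambda>x. ln ((1 - x) / 2)) has_real_derivative - 1 / (1 - x)) (at x)"
    using assms by (auto intro!: derivative_eq_intros simp: field_simps)
  have 3: "((\<lambda>x::real. - ((1 + x) / 2)) has_real_derivative - 1 / 2) (at x)"
    "((\<lambda>x::real. (1 - x) / 2) has_real_derivative - 1 / 2) (at x)"
    by (auto intro!: derivative_eq_intros)
  have "((\<lambda>x. H2 ((1 + x) / 2)) has_real_derivative
      (- 1 / 2 * (ln ((1 + x) / 2) / ln 2) + 1 / (1 + x) / ln 2 * - ((1 + x) / 2))
      - (- 1 / 2 * (ln ((1 - x) / 2) / ln 2) + - 1 / (1 - x) / ln 2 * ((1 - x) / 2))) (at x)"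
    unfolding H by (intro DERIV_diff DERIV_mult 3 DERIV_cdivide 1 2)
  then show ?thesis
  proof (rule DERIV_cong)
    have e1: "1 / (1 + x) / ln 2 * - ((1 + x) / 2) = - 1 / (2 * ln 2)"
      and e2: "- 1 / (1 - x) / ln 2 * ((1 - x) / 2) = - 1 / (2 * ln 2)"
      using assms by auto
    show "(- 1 / 2 * (ln ((1 + x) / 2) / ln 2) + 1 / (1 + x) / ln 2 * - ((1 + x) / 2))
      - (- 1 / 2 * (ln ((1 - x) / 2) / ln 2) + - 1 / (1 - x) / ln 2 * ((1 - x) / 2)) = - artanh x / ln 2"
      unfolding e1 e2 a l by (simp add: field_simps)
  qed
qed

text \<open>\<open>S x\<close> is the derivative of \<open>g (r x)\<close> divided by that of
  \<open>g x\<close>. Since \<open>S\<close> is antitone, \<open>g (r x) - S x0 * g x\<close> falls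
  up to \<open>x0\<close> and rises afterwards. The point \<open>x0 = 0\<close> is left out, where
  both derivatives vanish or \<open>S\<close> is of the form 0 / 0.\<close>

lemma output_entropy_tangent:
  fixes c x0 :: real
  assumes c: "0 \<le> c" "c \<le> 1" and x0: "0 < x0" "x0 \<le> 1"
  defines "g \<equiv> \<lambda>x. H2 ((1 + x) / 2)" and "r \<equiv> \<lambda>x. sqrt (1 - c + c * x\<^sup>2)"
  obtains m where "m \<ge> 0" "\<And>x. 0 \<le> x \<Longrightarrow> x \<le> 1 \<Longrightarrow> m * (g x - g x0) \<le> g (r x) - g (r x0)"
proof (cases "c = 0 \<or> x0 = 1")
  case True
  \<comment> \<open>In these cases the environment is pure at \<open>x0\<close>, so its entropy is 0
    there and the horizontal line \<open>m = 0\<close> supports the curve.\<close>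
  then have "r x0 = 1" by (auto simp: r_def)
  moreover have "g (r x) \<ge> 0" if "0 \<le> x" "x \<le> 1" for x
  proof -
    have "x\<^sup>2 \<le> 1" using that by (simp add: power_le_one)
    then have "c * x\<^sup>2 \<le> c * 1" using c by (intro mult_left_mono) auto
    then have "r x \<le> 1" "0 \<le> r x" using c by (auto simp: r_def)
    then show ?thesis unfolding g_def by (intro H2_nonneg) auto
  qed
  ultimately show thesis using that[of 0] by (simp add: g_def)
next
  case False
  then have c': "0 < c" "c \<le> 1" and x0': "0 < x0" "x0 < 1" using c x0 by auto
  define S where "S x = c * ((artanh (r x) / r x) / (artanh x / x))" for x
  have rr: "x \<le> r x" "r x < 1" if "0 < x" "x < 1" for x
    using contracted_radius[OF c' that] by (simp_all add: r_def)
  have S_pos: "S x0 \<ge> 0"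
    using artanh_real_pos[OF x0'] artanh_real_pos[of "r x0"] rr[OF x0'] x0' c' by (simp add: S_def)
  have anti: "S z \<le> S x" if "0 < x" "x \<le> z" "z < 1" for x z
    unfolding S_def r_def using slope_antimono[OF c' that] c' by (intro mult_left_mono) auto
  define \<psi> where "\<psi> x = g (r x) - S x0 * g x" for x
  have r01: "r x \<in> {0..1}" if "x \<in> {0..1}" for x
  proof -
    have "x\<^sup>2 \<le> 1" using that by (simp add: power_le_one)
    then have "c * x\<^sup>2 \<le> c * 1" using c by (intro mult_left_mono) auto
    then show ?thesis using c by (auto simp: r_def)
  qed
  have contg: "continuous_on {0..1} g"
    unfolding g_def by (intro continuous_on_compose2[OF continuous_on_H2] continuous_intros) auto
  have cont: "continuous_on {0..1} \<psi>"
    unfolding \<psi>_def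
    by (intro continuous_intros contg continuous_on_compose2[OF contg])
       (use r01 in \<open>auto simp: r_def intro!: continuous_intros\<close>)
  have D: "(\<psi> has_real_derivative artanh t / ln 2 * (S x0 - S t)) (at t)" if t: "0 < t" "t < 1" for t
  proof -
    have dr: "(r has_real_derivative c * t / r t) (at t)"
      unfolding r_def by (rule contracted_radius_derivative[OF c' t])
    have dg: "(g has_real_derivative - artanh s / ln 2) (at s)" if "0 \<le> s" "s < 1" for s
      unfolding g_def by (rule H2_derivative[OF that])
    have "((\<lambda>t. g (r t)) has_real_derivative (- artanh (r t) / ln 2) * (c * t / r t)) (at t)"
      by (rule DERIV_chain2[OF dg dr]) (use rr[OF t] t in auto)
    then have "(\<psi> has_real_derivative (- artanh (r t) / ln 2) * (c * t / r t) - S x0 * (- artanh t / ln 2)) (at t)"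
      unfolding \<psi>_def using t by (intro DERIV_diff DERIV_cmult dg) auto
    moreover have "artanh (r t) * (c * t / r t) = artanh t * S t"
      using artanh_real_pos[OF t] t by (simp add: S_def)
    moreover have "(- artanh (r t) / ln 2) * (c * t / r t) = - (artanh (r t) * (c * t / r t)) / ln 2" by simp
    ultimately have "(\<psi> has_real_derivative - (artanh t * S t) / ln 2 - S x0 * (- artanh t / ln 2)) (at t)"
      by (simp only:)
    then show ?thesis by (simp add: field_simps)
  qed
  have "\<psi> x0 \<le> \<psi> x" if x: "0 \<le> x" "x \<le> 1" for x
  proof (cases "x0 \<le> x")
    case True
    show ?thesis
    proof (rule DERIV_nonneg_imp_increasing_open[OF True])
      fix t assume t: "x0 < t" "t < x"
      have "artanh t / ln 2 * (S x0 - S t) \<ge> 0"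
        using anti[of x0 t] artanh_real_pos[of t] t x x0' by (intro mult_nonneg_nonneg) auto
      then show "\<exists>y. (\<psi> has_real_derivative y) (at t) \<and> 0 \<le> y" using D[of t] t x x0' by fastforce
    qed (use cont x x0' in \<open>auto intro: continuous_on_subset\<close>)
  next
    case False
    show ?thesis
    proof (rule DERIV_nonpos_imp_decreasing_open[of x x0 \<psi>])
      fix t assume t: "x < t" "t < x0"
      have "artanh t / ln 2 * (S x0 - S t) \<le> 0"
        using anti[of t x0] artanh_real_pos[of t] t x x0' by (intro mult_nonneg_nonpos) auto
      then show "\<exists>y. (\<psi> has_real_derivative y) (at t) \<and> y \<le> 0" using D[of t] t x x0' by fastforce
    qed (use cont x x0' False in \<open>auto intro: continuous_on_subset\<close>)
  qed
  then show thesis using S_pos by (intro that[of "S x0"]) (auto simp: \<psi>_def algebra_simps)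
qed

text \<open>The coefficient is \<open>c = p * (2 - p) = 1 - (1 - p)^2\<close>: the radicand is
  \<open>1 - 4 * c * \<mu> * (1 - \<mu>)\<close>, and
  \<open>4 * \<mu> * (1 - \<mu>) = 1 - (1 - 2 * \<mu>)^2\<close>.\<close>

lemma
  fixes \<mu> p :: real
  assumes p: "0 \<le> p" "p \<le> 1"
  shows gamma_fn_eq: "gamma_fn \<mu> p = (1 + sqrt (1 - p * (2 - p) + p * (2 - p) * \<bar>1 - 2 * \<mu>\<bar>\<^sup>2)) / 2"
    and dephasing_coefficient: "0 \<le> p * (2 - p)" "p * (2 - p) \<le> 1"
proof -
  have "1 - 16 * (p/2) * (1 - p/2) * \<mu> * (1 - \<mu>) = 1 - p * (2 - p) + p * (2 - p) * \<bar>1 - 2 * \<mu>\<bar>\<^sup>2"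
    by (simp add: power2_eq_square field_simps)
  then show "gamma_fn \<mu> p = (1 + sqrt (1 - p * (2 - p) + p * (2 - p) * \<bar>1 - 2 * \<mu>\<bar>\<^sup>2)) / 2"
    by (simp add: gamma_fn_def field_simps)
  show "0 \<le> p * (2 - p)" using p by simp
  have "0 \<le> (1 - p)\<^sup>2" by simp
  then show "p * (2 - p) \<le> 1" by (simp add: power2_eq_square algebra_simps)
qed

lemma H2_abs: "H2 ((1 + \<bar>1 - 2 * \<mu>\<bar>) / 2) = H2 \<mu>"
proof (cases "\<mu> \<le> 1/2")
  case True
  then have "(1 + \<bar>1 - 2 * \<mu>\<bar>) / 2 = 1 - \<mu>" by (simp add: abs_if)
  then show ?thesis by (simp only: H2_flip)
next
  case False
  then have "(1 + \<bar>1 - 2 * \<mu>\<bar>) / 2 = \<mu>" by (simp add: abs_if)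
  then show ?thesis by simp
qed

lemma H2_gamma_tangent:
  fixes p \<mu>0 :: real
  assumes p: "0 \<le> p" "p \<le> 1" and \<mu>0: "0 \<le> \<mu>0" "\<mu>0 < 1/2"
  obtains m where "m \<ge> 0" "\<And>\<mu>. 0 \<le> \<mu> \<Longrightarrow> \<mu> \<le> 1 \<Longrightarrow>
    m * (H2 \<mu> - H2 \<mu>0) \<le> H2 (gamma_fn \<mu> p) - H2 (gamma_fn \<mu>0 p)"
proof -
  have x0: "0 < \<bar>1 - 2 * \<mu>0\<bar>" "\<bar>1 - 2 * \<mu>0\<bar> \<le> 1" using \<mu>0 by auto
  obtain m where m: "m \<ge> 0" "\<And>x. 0 \<le> x \<Longrightarrow> x \<le> 1 \<Longrightarrow>
     m * (H2 ((1 + x) / 2) - H2 ((1 + \<bar>1 - 2 * \<mu>0\<bar>) / 2))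
      \<le> H2 ((1 + sqrt (1 - p * (2 - p) + p * (2 - p) * x\<^sup>2)) / 2)
        - H2 ((1 + sqrt (1 - p * (2 - p) + p * (2 - p) * \<bar>1 - 2 * \<mu>0\<bar>\<^sup>2)) / 2)"
    using output_entropy_tangent[OF dephasing_coefficient[OF p] x0] by blast
  show thesis
  proof (rule that[OF m(1)])
    fix \<mu> :: real assume "0 \<le> \<mu>" "\<mu> \<le> 1"
    then show "m * (H2 \<mu> - H2 \<mu>0) \<le> H2 (gamma_fn \<mu> p) - H2 (gamma_fn \<mu>0 p)"
      using m(2)[of "\<bar>1 - 2 * \<mu>\<bar>"] by (simp add: H2_abs gamma_fn_eq[OF p] abs_le_iff)
  qed
qed

lemma continuous_on_gamma_fn: "continuous_on UNIV (\<lambda>\<mu>. gamma_fn \<mu> p)"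
  unfolding gamma_fn_def by (intro continuous_intros)

text \<open>The third fact says that the environment is at least as pure as the input bit, which
  gives \<open>H2_gamma_le\<close>; the fourth is the determinant of the environment qubit, for
  \<open>has_ent_qubit\<close>.\<close>

lemma gamma_fn_range:
  assumes p: "0 \<le> p" "p \<le> 1" and \<mu>: "0 \<le> \<mu>" "\<mu> \<le> 1"
  shows "1 / 2 \<le> gamma_fn \<mu> p" "gamma_fn \<mu> p \<le> 1" "\<bar>1 - 2 * \<mu>\<bar> \<le> 2 * gamma_fn \<mu> p - 1"
    "gamma_fn \<mu> p * (1 - gamma_fn \<mu> p) = 4 * (p / 2) * (1 - p / 2) * \<mu> * (1 - \<mu>)"
proof -
  define c where "c = p * (2 - p)"
  define x where "x = \<bar>1 - 2 * \<mu>\<bar>"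
  have c: "0 \<le> c" "c \<le> 1" using dephasing_coefficient[OF p] by (simp_all add: c_def)
  have x: "0 \<le> x" "x \<le> 1" using \<mu> by (auto simp: x_def abs_le_iff)
  have x2: "x\<^sup>2 \<le> 1" using x by (simp add: power_le_one)
  have g: "gamma_fn \<mu> p = (1 + sqrt (1 - c + c * x\<^sup>2)) / 2"
    using gamma_fn_eq[OF p] by (simp add: c_def x_def)
  have "c * x\<^sup>2 \<le> c * 1" using c x2 by (intro mult_left_mono)
  moreover have nn: "0 \<le> 1 - c + c * x\<^sup>2" using c by simp
  ultimately have "sqrt (1 - c + c * x\<^sup>2) \<le> 1" by simp
  then show "gamma_fn \<mu> p \<le> 1" "1 / 2 \<le> gamma_fn \<mu> p" using nn by (simp_all add: g)
  have "(1 - c) * x\<^sup>2 \<le> (1 - c) * 1" using c x2 by (intro mult_left_mono) auto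
  then have "x \<le> sqrt (1 - c + c * x\<^sup>2)" by (intro real_le_rsqrt) (simp add: algebra_simps)
  then show "\<bar>1 - 2 * \<mu>\<bar> \<le> 2 * gamma_fn \<mu> p - 1" 
    unfolding x_def[symmetric] g by (simp add: field_simps)
  have "gamma_fn \<mu> p * (1 - gamma_fn \<mu> p) = (1 - (sqrt (1 - c + c * x\<^sup>2))\<^sup>2) / 4"
    unfolding g by (simp add: power2_eq_square field_simps)
  also have "\<dots> = c * (1 - x\<^sup>2) / 4" using nn by (simp add: algebra_simps)
  also have "\<dots> = 4 * (p / 2) * (1 - p / 2) * \<mu> * (1 - \<mu>)"
    by (simp add: c_def x_def power2_eq_square field_simps)
  finally show "gamma_fn \<mu> p * (1 - gamma_fn \<mu> p) = 4 * (p / 2) * (1 - p / 2) * \<mu> * (1 - \<mu>)" .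
qed

lemma H2_le_1:
  assumes "0 \<le> \<mu>" "\<mu> \<le> 1"
  shows "H2 \<mu> \<le> 1"
  using Shannon_entropy_le[of "{0,1::nat}" "\<lambda>i. if i = 0 then \<mu> else 1 - \<mu>"] assms
  by (simp add: H2_eta)

lemma continuous_on_H2_half: "continuous_on {0..1/2} H2"
  by (rule continuous_on_subset[OF continuous_on_H2]) auto

lemma continuous_on_H2_gamma:
  assumes p: "0 \<le> p" "p \<le> 1"
  shows "continuous_on {0..1/2} (\<lambda>\<mu>. H2 (gamma_fn \<mu> p))"
proof (rule continuous_on_compose2[OF continuous_on_H2])
  show "continuous_on {0..1/2} (\<lambda>\<mu>. gamma_fn \<mu> p)"
    by (rule continuous_on_subset[OF continuous_on_gamma_fn]) simp
  show "(\<lambda>\<mu>. gamma_fn \<mu> p) ` {0..1/2} \<subseteq> {0..1}"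
  proof clarify
    fix \<mu> :: real assume "\<mu> \<in> {0..1/2}"
    then have "0 \<le> \<mu>" "\<mu> \<le> 1" by auto
    then show "gamma_fn \<mu> p \<in> {0..1}"
      using gamma_fn_range(1,2)[OF p, of \<mu>] by auto
  qed
qed

lemma H2_surj:
  assumes "0 \<le> s" "s \<le> 1"
  obtains \<mu> where "0 \<le> \<mu>" "\<mu> \<le> 1/2" "H2 \<mu> = s"
proof -
  have "\<exists>\<mu>. 0 \<le> \<mu> \<and> \<mu> \<le> 1/2 \<and> H2 \<mu> = s"
    using assms continuous_on_H2_half by (intro IVT') auto
  then show thesis using that by blast
qed

text \<open>At \<open>\<mu> = 1/2\<close> the tangent is replaced by the limit of the tangents at \<open>\<mu> < 1/2\<close>.\<close>
lemma output_entropy_ge_of_affine: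
  assumes p: "0 \<le> p" "p \<le> 1" and s: "0 \<le> s" "s \<le> 1"
    and le: "\<And>m b. m \<ge> 0 \<Longrightarrow> (\<And>\<mu>. 0 \<le> \<mu> \<Longrightarrow> \<mu> \<le> 1 \<Longrightarrow> m * H2 \<mu> + b \<le> H2 (gamma_fn \<mu> p)) \<Longrightarrow> m * s + b \<le> S"
  shows "\<exists>\<mu>\<in>{0..1/2}. H2 \<mu> = s \<and> H2 (gamma_fn \<mu> p) \<le> S"
proof -
  \<comment> \<open>The condition is \<open>H2 \<mu> \<le> s\<close>, not equality, so that
    \<open>\<mu>\<close> can tend to 1/2 while \<open>s = 1\<close> stays fixed;
    \<open>m \<ge> 0\<close> absorbs the difference.\<close>
  have tangent: "H2 (gamma_fn \<mu> p) \<le> S" if \<mu>: "0 \<le> \<mu>" "\<mu> < 1/2" "H2 \<mu> \<le> s" for \<mu>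
  proof -
    obtain m where m: "m \<ge> 0" "\<And>\<nu>. 0 \<le> \<nu> \<Longrightarrow> \<nu> \<le> 1 \<Longrightarrow> m * (H2 \<nu> - H2 \<mu>) \<le> H2 (gamma_fn \<nu> p) - H2 (gamma_fn \<mu> p)"
      using H2_gamma_tangent[OF p \<mu>(1,2)] by blast
    have "m * s + (H2 (gamma_fn \<mu> p) - m * H2 \<mu>) \<le> S"
    proof (rule le[OF m(1)])
      show "m * H2 \<nu> + (H2 (gamma_fn \<mu> p) - m * H2 \<mu>) \<le> H2 (gamma_fn \<nu> p)" if "0 \<le> \<nu>" "\<nu> \<le> 1" for \<nu>
        using m(2)[OF that] by (simp add: right_diff_distrib)
    qed
    moreover have "m * H2 \<mu> \<le> m * s" using m(1) \<mu>(3) by (rule mult_left_mono[rotated])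
    ultimately show ?thesis by simp
  qed
  obtain \<mu> where \<mu>: "0 \<le> \<mu>" "\<mu> \<le> 1/2" "H2 \<mu> = s" using H2_surj[OF s] .
  show ?thesis
  proof (cases "\<mu> = 1/2")
    case False
    then show ?thesis using tangent[of \<mu>] \<mu> by auto
  next
    case True
    then have s1: "s = 1" using \<mu>(3) H2_half by blast
    have "((\<lambda>\<nu>. H2 (gamma_fn \<nu> p)) \<longlongrightarrow> H2 (gamma_fn (1/2) p)) (at (1/2) within {0..1/2})"
      using continuous_on_H2_gamma[OF p] by (simp add: continuous_on)
    then have "((\<lambda>\<nu>. H2 (gamma_fn \<nu> p)) \<longlongrightarrow> H2 (gamma_fn (1/2) p)) (at_left (1/2))"
      by (simp add: at_within_Icc_at_left)
    moreover have "\<forall>\<^sub>F \<nu> in at_left (1/2). H2 (gamma_fn \<nu> p) \<le> S"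
      using eventually_at_left_real[of 0 "1/2::real"]
    proof (rule eventually_mono)
      fix \<nu> :: real assume "\<nu> \<in> {0<..<1/2}"
      then show "H2 (gamma_fn \<nu> p) \<le> S" using H2_le_1[of \<nu>] s1 by (intro tangent) auto
    qed simp
    ultimately have "H2 (gamma_fn (1/2) p) \<le> S"
      by (rule tendsto_upperbound) simp
    then show ?thesis using s1 by (intro bexI[of _ "1/2"]) auto
  qed
qed

section \<open>Environment states of the dephasing channel\<close>

text \<open>The channel has the Kraus operators \<open>sqrt (1 - p/2)\<close> times the identity and
  \<open>sqrt (p/2)\<close> times \<open>pauliZ\<close>; \<open>dvec1 p y z\<close> is the amplitude
  of Kraus index \<open>z\<close> on the basis state \<open>y\<close>.\<close>

definition dvec1 :: "real \<Rightarrow> nat \<Rightarrow> nat \<Rightarrow> complex" where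
  "dvec1 p y z = of_real (if z = 0 then sqrt (1 - p/2) else if y = 0 then sqrt (p/2) else - sqrt (p/2))"

text \<open>\<open>dvec p k i\<close> is the environment state that the channel produces from the basis state \<open>i\<close>, so
  that \<open>dcoef p k\<close>, the Gram matrix of these states, is the Schur multiplier of the channel.\<close>
fun dvec :: "real \<Rightarrow> nat \<Rightarrow> nat \<Rightarrow> nat \<Rightarrow> complex" where
  "dvec p 0 i z = 1"
| "dvec p (Suc k) i z = dvec1 p (i div 2 ^ k) (z div 2 ^ k) * dvec p k (i mod 2 ^ k) (z mod 2 ^ k)"

fun dcoef :: "real \<Rightarrow> nat \<Rightarrow> nat \<Rightarrow> nat \<Rightarrow> real" where
  "dcoef p 0 i j = 1"
| "dcoef p (Suc k) i j = (if i div 2 ^ k = j div 2 ^ k then 1 else 1 - p) * dcoef p k (i mod 2 ^ k) (j mod 2 ^ k)"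

lemma cnj_dvec [simp]: "cnj (dvec p k i z) = dvec p k i z"
  by (induction k arbitrary: i z) (simp_all add: dvec1_def)

lemma dcoef_refl [simp]: "dcoef p k i i = 1"
  by (induction k arbitrary: i) simp_all

section \<open>Splitting an index into leading part and remainder\<close>

lemma mult_add_less:
  assumes "x < m" "i < (n::nat)"
  shows "x * n + i < m * n"
proof -
  have "x * n + i < Suc x * n" using assms by simp
  also have "\<dots> \<le> m * n" using assms by (intro mult_right_mono) auto
  finally show ?thesis .
qed

lemma bij_betw_mult_add:
  assumes "n > (0::nat)"
  shows "bij_betw (\<lambda>(x,i). x * n + i) ({..<m} \<times> {..<n}) {..<m * n}"
    and bij_betw_div_mod: "bij_betw (\<lambda>r. (r div n, r mod n)) {..<m * n} ({..<m} \<times> {..<n})"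
proof -
  have 1: "(\<lambda>r. (r div n, r mod n)) \<in> {..<m * n} \<rightarrow> {..<m} \<times> {..<n}"
    using assms by (auto simp: less_mult_imp_div_less)
  have 2: "(\<lambda>(x,i). x * n + i) \<in> {..<m} \<times> {..<n} \<rightarrow> {..<m * n}"
    by (auto intro: mult_add_less)
  show "bij_betw (\<lambda>(x,i). x * n + i) ({..<m} \<times> {..<n}) {..<m * n}"
    by (rule bij_betwI[OF 2 1]) (use assms in auto)
  show "bij_betw (\<lambda>r. (r div n, r mod n)) {..<m * n} ({..<m} \<times> {..<n})"
    by (rule bij_betwI[OF 1 2]) (use assms in auto)
qed

lemma sum_div_mod:
  fixes f :: "nat \<Rightarrow> nat \<Rightarrow> 'a :: comm_monoid_add"
  assumes "n > 0"
  shows "(\<Sum>r<m * n. f (r div n) (r mod n)) = (\<Sum>x<m. \<Sum>i<n. f x i)"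
  using sum.reindex_bij_betw[OF bij_betw_div_mod[OF assms], of "\<lambda>(x,i). f x i" m]
  by (simp add: sum.cartesian_product)

lemma two: "{..<2::nat} = {0, 1}" by auto

lemma ip_dvec1:
  assumes "0 \<le> p" "p \<le> 1" "i < 2" "j < 2"
  shows "ip {..<2} (dvec1 p i) (dvec1 p j) = of_real (if i = j then 1 else 1 - p)"
proof -
  define A where "A y z = (if z = 0 then sqrt (1 - p/2) else if y = 0 then sqrt (p/2) else - sqrt (p/2))" for y z :: nat
  have "ip {..<2} (dvec1 p i) (dvec1 p j) = of_real (A i 0 * A j 0 + A i 1 * A j 1)"
    by (simp only: ip_def two dvec1_def A_def[symmetric] complex_cnj_complex_of_real) simp
  also have "A i 0 * A j 0 + A i 1 * A j 1 = (if i = j then 1 else 1 - p)"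
    using assms by (auto simp: A_def less_2_cases_iff)
  finally show ?thesis .
qed

lemma ip_dvec:
  assumes p: "0 \<le> p" "p \<le> 1" and "i < 2 ^ k" "j < 2 ^ k"
  shows "ip {..<2 ^ k} (dvec p k i) (dvec p k j) = of_real (dcoef p k i j)"
  using assms(3,4)
proof (induction k arbitrary: i j)
  case 0
  then show ?case by (simp add: ip_def)
next
  case (Suc k)
  have "i div 2 ^ k < 2" "j div 2 ^ k < 2" using Suc.prems by (simp_all add: less_mult_imp_div_less)
  note d = ip_dvec1[OF p this]
  have "ip {..<2 ^ Suc k} (dvec p (Suc k) i) (dvec p (Suc k) j)
     = (\<Sum>r<2 * 2 ^ k. cnj (dvec1 p (i div 2 ^ k) (r div 2 ^ k) * dvec p k (i mod 2 ^ k) (r mod 2 ^ k))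
         * (dvec1 p (j div 2 ^ k) (r div 2 ^ k) * dvec p k (j mod 2 ^ k) (r mod 2 ^ k)))"
    by (simp add: ip_def)
  also have "\<dots> = (\<Sum>y<2. \<Sum>z<2 ^ k. cnj (dvec1 p (i div 2 ^ k) y * dvec p k (i mod 2 ^ k) z)
         * (dvec1 p (j div 2 ^ k) y * dvec p k (j mod 2 ^ k) z))"
    by (rule sum_div_mod) simp
  also have "\<dots> = ip {..<2} (dvec1 p (i div 2 ^ k)) (dvec1 p (j div 2 ^ k))
       * ip {..<2 ^ k} (dvec p k (i mod 2 ^ k)) (dvec p k (j mod 2 ^ k))"
    unfolding ip_def sum_product by (simp add: mult_ac)
  also have "\<dots> = of_real (dcoef p (Suc k) i j)"
    by (subst Suc.IH) (simp_all add: d)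
  finally show ?case .
qed

lemma nsq_dvec:
  assumes "0 \<le> p" "p \<le> 1" "i < 2 ^ k"
  shows "nsq {..<2 ^ k} (dvec p k i) = 1"
  using ip_dvec[OF assms(1,2,3,3)] ip_self[of "{..<2 ^ k}" "dvec p k i"] by simp

lemma nsq_dvec1:
  assumes "0 \<le> p" "p \<le> 1" "i < 2"
  shows "nsq {..<2} (dvec1 p i) = 1"
  using ip_dvec1[OF assms(1,2,3,3)] ip_self[of "{..<2}" "dvec1 p i"] by simp

section \<open>Environment entropy for one letter and for several\<close>

lemma trace_gram: "(\<Sum>a\<in>I. gram T c \<phi> a a) = of_real (\<Sum>t\<in>T. c t * nsq I (\<phi> t))"
proof -
  have "of_real (\<Sum>t\<in>T. c t * nsq I (\<phi> t)) = (\<Sum>t\<in>T. of_real (c t) * ip I (\<phi> t) (\<phi> t))"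
    by (simp add: ip_self)
  also have "\<dots> = (\<Sum>a\<in>I. gram T c \<phi> a a)"
    unfolding ip_def gram_def sum_distrib_left by (subst sum.swap) (simp add: mult_ac)
  finally show ?thesis ..
qed

lemma qubit_output_entropy_eq:
  assumes p: "0 \<le> p" "p \<le> 1" and P: "P 0 \<ge> 0" "P 1 \<ge> 0"
    and h: "has_ent {..<2} (gram {..<2} P (dvec1 p)) h"
  defines "T \<equiv> P 0 + P 1"
  defines "\<mu> \<equiv> P 1 / T"
  shows "0 \<le> T" "0 \<le> \<mu>" "\<mu> \<le> 1"
    and "h = T * H2 (gamma_fn \<mu> p) + eta T" "eta (P 0) + eta (P 1) = T * H2 \<mu> + eta T"
proof -
  define g where "g = gamma_fn \<mu> p"
  show T: "0 \<le> T" using P by (simp add: T_def)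
  show \<mu>: "0 \<le> \<mu>" "\<mu> \<le> 1" using P by (auto simp: \<mu>_def T_def divide_le_eq)
  \<comment> \<open>For total weight 0 the quotient \<open>\<mu>\<close> is 0 by the convention for
    division, and both equations still hold.\<close>
  have P': "P 1 = T * \<mu>" "P 0 = T * (1 - \<mu>)"
    using P by (cases "T = 0"; auto simp: \<mu>_def T_def right_diff_distrib)+
  note g = gamma_fn_range[OF p \<mu>, folded g_def]
  have split: "eta (T * x) + eta (T * (1 - x)) = T * H2 x + eta T" if "0 \<le> x" "x \<le> 1" for x
  proof -
    have "eta (T * x) = T * eta x + x * eta T" "eta (T * (1 - x)) = T * eta (1 - x) + (1 - x) * eta T"
      using T that by (auto intro: eta_mult)
    then show ?thesis by (simp add: H2_eta algebra_simps)
  qed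
  let ?s = "sqrt (1 - p/2)" and ?t = "sqrt (p/2)"
  have st: "?s * ?s = 1 - p/2" "?t * ?t = p/2" using p by auto
  have G: "gram {..<2} P (dvec1 p) a b = of_real (\<Sum>y\<in>{0,1}. P y
      * (if a = 0 then ?s else if y = 0 then ?t else - ?t) * (if b = 0 then ?s else if y = 0 then ?t else - ?t))" for a b
    by (simp add: gram_def two dvec1_def)
  have "h = eta (T * g) + eta (T * (1 - g))"
  proof (rule has_ent_qubit[OF h])
    have "P 0 * ?s * ?s + P 1 * ?s * ?s + (P 0 * ?t * ?t + P 1 * ?t * ?t) = T"
      unfolding mult.assoc st T_def by (simp add: algebra_simps)
    then show "gram {..<2} P (dvec1 p) 0 0 + gram {..<2} P (dvec1 p) 1 1 = of_real (T * g + T * (1 - g))"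
      unfolding G by (simp add: algebra_simps flip: of_real_add of_real_mult)
    \<comment> \<open>The determinant of a mixture of two vectors in dimension 2 is the product of
      the weights times the squared determinant of the pair; for \<open>(s, t)\<close> and
      \<open>(s, -t)\<close> the latter is \<open>4 * s^2 * t^2\<close>.\<close>
    have "(P 0 * s * s + P 1 * s * s) * (P 0 * t * t + P 1 * t * t)
        - (P 0 * s * t - P 1 * s * t) * (P 0 * t * s - P 1 * t * s)
      = 4 * P 0 * P 1 * (s * s) * (t * t)" for s t :: real
      by (simp add: algebra_simps)
    then have "(P 0 * ?s * ?s + P 1 * ?s * ?s) * (P 0 * ?t * ?t + P 1 * ?t * ?t)
        - (P 0 * ?s * ?t - P 1 * ?s * ?t) * (P 0 * ?t * ?s - P 1 * ?t * ?s)
      = 4 * P 0 * P 1 * (?s * ?s) * (?t * ?t)" .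
    also have "\<dots> = T * T * (4 * (p / 2) * (1 - p / 2) * \<mu> * (1 - \<mu>))"
      unfolding st P' by (simp add: algebra_simps)
    also have "\<dots> = T * g * (T * (1 - g))"
      unfolding g(4)[symmetric] by (simp add: mult_ac)
    finally show "gram {..<2} P (dvec1 p) 0 0 * gram {..<2} P (dvec1 p) 1 1
        - gram {..<2} P (dvec1 p) 0 1 * gram {..<2} P (dvec1 p) 1 0 = of_real (T * g * (T * (1 - g)))"
      unfolding G by (simp flip: of_real_add of_real_mult of_real_diff)
  qed
  also have "\<dots> = T * H2 g + eta T"
    using split[of g] g by simp
  finally show "h = T * H2 (gamma_fn \<mu> p) + eta T" by (simp add: g_def)
  show "eta (P 0) + eta (P 1) = T * H2 \<mu> + eta T"
    unfolding P' using split[of \<mu>] \<mu> by simp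
qed

text \<open>The affine bound multiplied by the total weight, which makes it usable for unnormalised
  distributions.\<close>

lemma qubit_output_entropy_ge:
  assumes p: "0 \<le> p" "p \<le> 1" and P: "P 0 \<ge> 0" "P 1 \<ge> 0"
    and h: "has_ent {..<2} (gram {..<2} P (dvec1 p)) h"
    and le: "\<And>\<mu>. 0 \<le> \<mu> \<Longrightarrow> \<mu> \<le> 1 \<Longrightarrow> m * H2 \<mu> + b \<le> H2 (gamma_fn \<mu> p)"
  shows "m * (eta (P 0) + eta (P 1) - eta (P 0 + P 1)) + b * (P 0 + P 1) \<le> h - eta (P 0 + P 1)"
proof -
  note E = qubit_output_entropy_eq[OF p P h]
  have "(P 0 + P 1) * (m * H2 (P 1 / (P 0 + P 1)) + b) \<le> (P 0 + P 1) * H2 (gamma_fn (P 1 / (P 0 + P 1)) p)"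
    by (intro mult_left_mono le E)
  then show ?thesis unfolding E(4,5) by (simp add: algebra_simps)
qed

text \<open>Any affine lower bound of the single-letter curve extends to \<open>k\<close> letters: revealing the first
  input letter instead of the first environment qubit can only lower the conditional entropy.\<close>
lemma environment_entropy_ge:
  assumes p: "0 \<le> p" "p \<le> 1"
    and le: "\<And>\<mu>. 0 \<le> \<mu> \<Longrightarrow> \<mu> \<le> 1 \<Longrightarrow> m * H2 \<mu> + b \<le> H2 (gamma_fn \<mu> p)"
    and d: "\<And>i. i < 2 ^ k \<Longrightarrow> d i \<ge> 0"
    and h: "has_ent {..<2 ^ k} (gram {..<2 ^ k} d (dvec p k)) h"
  shows "m * ((\<Sum>i<2 ^ k. eta (d i)) - eta (\<Sum>i<2 ^ k. d i)) + real k * b * (\<Sum>i<2 ^ k. d i)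
    \<le> h - eta (\<Sum>i<2 ^ k. d i)"
  using d h
proof (induction k arbitrary: d h)
  case 0
  have "has_ent {..<1} (gram {..<1} d (dvec p 0)) (\<Sum>i<1. eta (d i))"
    by (rule has_ent_cong[OF has_ent_diag[of "{..<1}" d]]) (use 0 in \<open>auto simp: gram_def\<close>)
  moreover have "has_ent {..<1} (gram {..<1} d (dvec p 0)) h"
    using 0(2) by (simp only: power_0)
  ultimately have "h = (\<Sum>i<1. eta (d i))"
    by (intro has_ent_unique[of "{..<1::nat}"]) auto
  then show ?case by simp
next
  case (Suc k)
  \<comment> \<open>\<open>c\<close> is the leading letter, and \<open>dc c\<close> the unnormalised
    distribution of the remaining ones, with total \<open>P c\<close>.\<close>
  define dc where "dc c i = d (c * 2 ^ k + i)" for c i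
  define P where "P c = (\<Sum>i<2 ^ k. dc c i)" for c
  define E where "E c = gram {..<2 ^ k} (dc c) (dvec p k)" for c
  have idx: "c * 2 ^ k + i < 2 ^ Suc k" if "c < 2" "i < 2 ^ k" for c i :: nat
    using that by (auto simp: less_2_cases_iff)
  have dc: "dc c i \<ge> 0" if "c < 2" "i < 2 ^ k" for c i
    unfolding dc_def by (rule Suc.prems(1)[OF idx[OF that]])
  have P0: "P c \<ge> 0" if "c < 2" for c
    unfolding P_def by (intro sum_nonneg dc that) simp
  have split: "(\<Sum>i<2 ^ Suc k. f (d i)) = (\<Sum>c<2. \<Sum>i<2 ^ k. f (dc c i))" for f :: "real \<Rightarrow> real"
    using sum_div_mod[of "2 ^ k" "\<lambda>c i. f (dc c i)" 2] unfolding dc_def div_mult_mod_eq by simp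
  have "\<exists>hE. has_ent {..<2 ^ k} (E c) hE" if "c < 2" for c
    unfolding E_def by (rule gram_has_ent) (use dc[OF that] in auto)
  then obtain hE where hE: "\<And>c. c < 2 \<Longrightarrow> has_ent {..<2 ^ k} (E c) (hE c)" by metis
  have "\<exists>h1. has_ent {..<2} (gram {..<2} P (dvec1 p)) h1"
    by (rule gram_has_ent) (use P0 in auto)
  then obtain h1 where h1: "has_ent {..<2} (gram {..<2} P (dvec1 p)) h1" by blast
  have bij: "bij_betw (\<lambda>(c,i). c * 2 ^ k + i) ({..<2} \<times> {..<2 ^ k}) {..<2 ^ Suc k :: nat}"
    using bij_betw_mult_add[of "2 ^ k" 2] by simp
  \<comment> \<open>\<open>A\<close> is the first environment qubit and \<open>I\<close> the other
    ones; given the first input letter \<open>c\<close> they are in a product state.\<close>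
  have "h1 + (\<Sum>c<2. hE c - eta (P c)) \<le> h"
  proof (rule has_ent_conditional)
    show "has_ent ({..<2} \<times> {..<2 ^ k}) (\<lambda>(x,i) (y,j). \<Sum>c<2. dvec1 p c x * cnj (dvec1 p c y) * E c i j) h"
    proof (rule has_ent_cong[OF has_ent_reindex[OF bij Suc.prems(2)]])
      fix a b :: "nat \<times> nat" assume "a \<in> {..<2} \<times> {..<2 ^ k}" "b \<in> {..<2} \<times> {..<2 ^ k}"
      then obtain x i y j where ab: "a = (x,i)" "b = (y,j)" "i < 2 ^ k" "j < 2 ^ k"
        by (metis lessThan_iff mem_Sigma_iff surj_pair)
      have "gram {..<2 ^ Suc k} d (dvec p (Suc k)) (x * 2 ^ k + i) (y * 2 ^ k + j)
          = (\<Sum>r<2 * 2 ^ k. of_real (dc (r div 2 ^ k) (r mod 2 ^ k)) * (dvec1 p (r div 2 ^ k) x * dvec p k (r mod 2 ^ k) i)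
              * cnj (dvec1 p (r div 2 ^ k) y * dvec p k (r mod 2 ^ k) j))"
        unfolding dc_def div_mult_mod_eq using ab(3,4) by (simp add: gram_def)
      also have "\<dots> = (\<Sum>c<2. \<Sum>i'<2 ^ k. of_real (dc c i') * (dvec1 p c x * dvec p k i' i)
              * cnj (dvec1 p c y * dvec p k i' j))"
        by (rule sum_div_mod) simp
      also have "\<dots> = (\<Sum>c<2. dvec1 p c x * cnj (dvec1 p c y) * E c i j)"
        by (simp add: E_def gram_def sum_distrib_left mult_ac)
      finally show "(case a of (x,i) \<Rightarrow> \<lambda>(y,j). \<Sum>c<2. dvec1 p c x * cnj (dvec1 p c y) * E c i j) b
          = gram {..<2 ^ Suc k} d (dvec p (Suc k)) (case a of (c,i) \<Rightarrow> c * 2 ^ k + i) (case b of (c,i) \<Rightarrow> c * 2 ^ k + i)"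
        by (simp add: ab)
    qed
    show "(\<Sum>i<2 ^ k. E c i i) = of_real (P c)" for c
      unfolding E_def trace_gram P_def by (simp add: nsq_dvec[OF p])
  qed (use hE h1 nsq_dvec1[OF p] in auto)
  then have "h1 + (hE 0 - eta (P 0)) + (hE 1 - eta (P 1)) \<le> h"
    by (simp add: two)
  moreover have "m * (eta (P 0) + eta (P 1) - eta (P 0 + P 1)) + b * (P 0 + P 1) \<le> h1 - eta (P 0 + P 1)"
    by (rule qubit_output_entropy_ge[OF p P0 P0 h1 le]) auto
  moreover have IH: "m * ((\<Sum>i<2 ^ k. eta (dc c i)) - eta (P c)) + real k * b * P c \<le> hE c - eta (P c)" if "c < 2" for c
    unfolding P_def by (rule Suc.IH) (use dc[OF that] hE[OF that] in \<open>auto simp: E_def\<close>)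
  note IH[of 0] IH[of 1]
  \<comment> \<open>The chain rule: the entropies \<open>eta (P 0)\<close> and
    \<open>eta (P 1)\<close> of the first letter cancel between the one-letter bound and the two
    induction hypotheses.\<close>
  moreover have "m * ((S0 + S1) - t) + real (Suc k) * b * (p0 + p1)
      = (m * (e0 + e1 - t) + b * (p0 + p1)) + (m * (S0 - e0) + real k * b * p0) + (m * (S1 - e1) + real k * b * p1)"
    for S0 S1 t p0 p1 e0 e1
    by (simp add: algebra_simps)
  note this[of "\<Sum>i<2 ^ k. eta (dc 0 i)" "\<Sum>i<2 ^ k. eta (dc 1 i)" "eta (P 0 + P 1)" "P 0" "P 1" "eta (P 0)" "eta (P 1)"]
  moreover have "(\<Sum>i<2 ^ Suc k. d i) = P 0 + P 1"
    using split[of "\<lambda>x. x"] by (simp add: P_def two)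
  moreover have "(\<Sum>i<2 ^ Suc k. eta (d i)) = (\<Sum>i<2 ^ k. eta (dc 0 i)) + (\<Sum>i<2 ^ k. eta (dc 1 i))"
    using split[of eta] by (simp add: two)
  ultimately show ?case by simp
qed

section \<open>Entropies of the output ensemble\<close>

text \<open>When both factors merely rescale matrix units, a single term of the fourfold sum
  contributes to an entry, so the Schur multipliers multiply.\<close>

lemma chan_tensor_schur:
  assumes M1: "\<And>i j. i < d1 \<Longrightarrow> j < d1 \<Longrightarrow> M1 (matunit d1 i j) = complex_of_real (g i j) \<cdot>\<^sub>m matunit d1 i j"
    and M2: "\<And>i j. i < d2 \<Longrightarrow> j < d2 \<Longrightarrow> M2 (matunit d2 i j) = complex_of_real (h i j) \<cdot>\<^sub>m matunit d2 i j"
    and rc: "r < d1 * d2" "c < d1 * d2"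
  shows "chan_tensor d1 d2 M1 M2 \<rho> $$ (r,c)
    = of_real (g (r div d2) (c div d2) * h (r mod d2) (c mod d2)) * \<rho> $$ (r,c)"
proof -
  have d2: "d2 > 0" using rc by (cases d2) auto
  have lt: "r div d2 < d1" "c div d2 < d1" "r mod d2 < d2" "c mod d2 < d2"
    using rc d2 by (auto simp: less_mult_imp_div_less)
  let ?H = "\<lambda>i j a b. complex_of_real (g i j) * complex_of_real (h a b)"
  have K: "kron (M1 (matunit d1 i j)) (M2 (matunit d2 a b)) $$ (r,c)
     = (if i = r div d2 then if j = c div d2 then if a = r mod d2 then if b = c mod d2 then ?H i j a b else 0 else 0 else 0 else 0)"
    if "i < d1" "j < d1" "a < d2" "b < d2" for i j a b
    unfolding M1[OF that(1,2)] M2[OF that(3,4)] kron_def using rc lt by (auto simp: matunit_def)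
  have "chan_tensor d1 d2 M1 M2 \<rho> $$ (r,c) = (\<Sum>i<d1. \<Sum>j<d1. \<Sum>a<d2. \<Sum>b<d2.
      \<rho> $$ (i * d2 + a, j * d2 + b) * kron (M1 (matunit d1 i j)) (M2 (matunit d2 a b)) $$ (r,c))"
    using rc by (simp add: chan_tensor_def)
  also have "\<dots> = (\<Sum>(i,j,a,b)\<in>{..<d1} \<times> {..<d1} \<times> {..<d2} \<times> {..<d2}.
      \<rho> $$ (i * d2 + a, j * d2 + b) * kron (M1 (matunit d1 i j)) (M2 (matunit d2 a b)) $$ (r,c))"
    by (simp only: sum.cartesian_product split_def fst_conv snd_conv)
  also have "\<dots> = (\<Sum>t\<in>{..<d1} \<times> {..<d1} \<times> {..<d2} \<times> {..<d2}.
      if t = (r div d2, c div d2, r mod d2, c mod d2)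
      then \<rho> $$ (r div d2 * d2 + r mod d2, c div d2 * d2 + c mod d2) * ?H (r div d2) (c div d2) (r mod d2) (c mod d2)
      else 0)"
    by (intro sum.cong refl) (auto simp: K split: if_splits)
  also have "\<dots> = \<rho> $$ (r div d2 * d2 + r mod d2, c div d2 * d2 + c mod d2)
      * ?H (r div d2) (c div d2) (r mod d2) (c mod d2)"
    using lt by (subst sum.delta) auto
  finally show ?thesis unfolding div_mult_mod_eq by simp
qed

lemma dephasing_matunit:
  assumes "i < 2" "j < 2"
  shows "dephasing p (matunit 2 i j) = complex_of_real (if i = j then 1 else 1 - p) \<cdot>\<^sub>m matunit 2 i j"
proof (rule eq_matI)
  fix r c assume "r < dim_row (complex_of_real (if i = j then 1 else 1 - p) \<cdot>\<^sub>m matunit 2 i j)"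
    "c < dim_col (complex_of_real (if i = j then 1 else 1 - p) \<cdot>\<^sub>m matunit 2 i j)"
  then have rc: "r < 2" "c < 2" by (simp_all add: matunit_def)
  then have Z: "(pauliZ * matunit 2 i j * pauliZ) $$ (r,c) = pauliZ $$ (r,r) * matunit 2 i j $$ (r,c) * pauliZ $$ (c,c)"
    by (auto simp: pauliZ_def matunit_def scalar_prod_def less_2_cases_iff numeral_2_eq_2)
  show "dephasing p (matunit 2 i j) $$ (r,c) = (complex_of_real (if i = j then 1 else 1 - p) \<cdot>\<^sub>m matunit 2 i j) $$ (r,c)"
  proof -
    have "dephasing p (matunit 2 i j) $$ (r,c) = of_real (1 - p) * matunit 2 i j $$ (r,c)
        + of_real (p / 2) * (matunit 2 i j $$ (r,c) + (pauliZ * matunit 2 i j * pauliZ) $$ (r,c))"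
      using rc by (simp add: dephasing_def pauliZ_def matunit_def)
    also have "\<dots> = (complex_of_real (if i = j then 1 else 1 - p) \<cdot>\<^sub>m matunit 2 i j) $$ (r,c)"
      unfolding Z using rc assms
      by (auto simp: pauliZ_def matunit_def less_2_cases_iff)
    finally show ?thesis .
  qed
qed (simp_all add: dephasing_def pauliZ_def matunit_def)

lemma dephasing_pow_matunit:
  assumes "i < 2 ^ k" "j < 2 ^ k"
  shows "dephasing_pow p k (matunit (2 ^ k) i j) = complex_of_real (dcoef p k i j) \<cdot>\<^sub>m matunit (2 ^ k) i j"
  using assms
proof (induction k arbitrary: i j)
  case 0
  then show ?case by (auto intro!: eq_matI simp: matunit_def)
next
  case (Suc k)
  show ?case
  proof (rule eq_matI)
    fix r c assume "r < dim_row (complex_of_real (dcoef p (Suc k) i j) \<cdot>\<^sub>m matunit (2 ^ Suc k) i j)"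
      "c < dim_col (complex_of_real (dcoef p (Suc k) i j) \<cdot>\<^sub>m matunit (2 ^ Suc k) i j)"
    then have rc: "r < 2 * 2 ^ k" "c < 2 * 2 ^ k" by (simp_all add: matunit_def)
    have "dephasing_pow p (Suc k) (matunit (2 ^ Suc k) i j) $$ (r,c)
       = of_real ((if r div 2 ^ k = c div 2 ^ k then 1 else 1 - p) * dcoef p k (r mod 2 ^ k) (c mod 2 ^ k))
           * matunit (2 ^ Suc k) i j $$ (r,c)"
      unfolding dephasing_pow.simps
      by (rule chan_tensor_schur[OF dephasing_matunit Suc.IH rc])
    also have "\<dots> = (complex_of_real (dcoef p (Suc k) i j) \<cdot>\<^sub>m matunit (2 ^ Suc k) i j) $$ (r,c)"
      using rc by (simp add: matunit_def)
    finally show "dephasing_pow p (Suc k) (matunit (2 ^ Suc k) i j) $$ (r,c)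
       = (complex_of_real (dcoef p (Suc k) i j) \<cdot>\<^sub>m matunit (2 ^ Suc k) i j) $$ (r,c)" .
  qed (simp_all add: matunit_def chan_tensor_def)
qed

definition entropy :: "'i set \<Rightarrow> ('i \<Rightarrow> 'i \<Rightarrow> complex) \<Rightarrow> real" where
  "entropy I M = (SOME h. has_ent I M h)"

lemma has_ent_entropy: "has_ent I M h \<Longrightarrow> has_ent I M (entropy I M)"
  unfolding entropy_def by (rule someI)

lemma entropy_eqI: "finite I \<Longrightarrow> has_ent I M h \<Longrightarrow> entropy I M = h"
  using has_ent_entropy has_ent_unique by blast

section \<open>States and reduced states of one ensemble\<close>

locale dephased_ensemble =
  fixes p :: real and k nx :: nat and px :: "nat \<Rightarrow> real" and da :: nat and v :: "nat \<Rightarrow> complex vec"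
  assumes p: "0 \<le> p" "p \<le> 1" and adm: "admissible k nx px da v"
begin

abbreviation n :: nat where "n \<equiv> 2 ^ k"

definition amp :: "nat \<Rightarrow> nat \<Rightarrow> nat \<Rightarrow> complex" where
  "amp x a i = vec_index (v x) (a * n + i)"

text \<open>The distribution of the channel input in the computational basis. Dephasing preserves
  it, as \<open>dcoef\<close> is 1 on the diagonal.\<close>

definition d :: "nat \<Rightarrow> nat \<Rightarrow> real" where
  "d x i = (\<Sum>a<da. (cmod (amp x a i))\<^sup>2)"

definition rhoAB :: "nat \<Rightarrow> nat \<times> nat \<Rightarrow> nat \<times> nat \<Rightarrow> complex" where
  "rhoAB x = (\<lambda>(a,i) (b,j). amp x a i * cnj (amp x b j) * of_real (dcoef p k i j))"

definition rhoB :: "nat \<Rightarrow> nat \<Rightarrow> nat \<Rightarrow> complex" where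
  "rhoB x i j = (\<Sum>a<da. rhoAB x (a,i) (a,j))"

definition rhoA :: "nat \<Rightarrow> nat \<Rightarrow> nat \<Rightarrow> complex" where
  "rhoA x a b = (\<Sum>i<n. rhoAB x (a,i) (b,i))"

lemma px: "x < nx \<Longrightarrow> px x \<ge> 0" "(\<Sum>x<nx. px x) = 1"
  using adm by (auto simp: admissible_def)

lemma d_nonneg: "d x i \<ge> 0"
  by (simp add: d_def sum_nonneg)

lemma sum_d: "x < nx \<Longrightarrow> (\<Sum>i<n. d x i) = 1"
proof -
  assume x: "x < nx"
  then have "unit_vector (da * n) (v x)" using adm by (auto simp: admissible_def)
  then have "1 = (\<Sum>r<da * n. (cmod (vec_index (v x) r))\<^sup>2)"
    by (simp add: unit_vector_def)
  also have "\<dots> = (\<Sum>r<da * n. (cmod (amp x (r div n) (r mod n)))\<^sup>2)"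
    unfolding amp_def div_mult_mod_eq ..
  also have "\<dots> = (\<Sum>a<da. \<Sum>i<n. (cmod (amp x a i))\<^sup>2)"
    by (rule sum_div_mod) simp
  also have "\<dots> = (\<Sum>i<n. d x i)"
    unfolding d_def by (rule sum.swap)
  finally show ?thesis by simp
qed

text \<open>\<open>z\<close> runs over a basis of the environment, so the mixture displays a
  purification; \<open>has_ent_rhoAB\<close> reads off the complementary marginal.\<close>

lemma rhoAB_gram:
  assumes "r \<in> {..<da} \<times> {..<n}" "c \<in> {..<da} \<times> {..<n}"
  shows "rhoAB x r c = gram {..<n} (\<lambda>_. 1) (\<lambda>z (a,i). amp x a i * dvec p k i z) r c"
proof -
  obtain a i b j where rc: "r = (a,i)" "c = (b,j)" by (metis surj_pair)
  then have "i < n" "j < n" using assms by auto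
  then have "of_real (dcoef p k i j) = (\<Sum>z<n. dvec p k i z * dvec p k j z)"
    using ip_dvec[OF p, of i k j] by (simp add: ip_def)
  then show ?thesis
    by (simp add: rc rhoAB_def gram_def sum_distrib_left mult_ac)
qed

lemma rhoB_gram:
  assumes "i < n" "j < n"
  shows "rhoB x i j = gram ({..<da} \<times> {..<n}) (\<lambda>_. 1) (\<lambda>(a,z) i. amp x a i * dvec p k i z) i j"
proof -
  have "rhoB x i j = (\<Sum>a<da. gram {..<n} (\<lambda>_. 1) (\<lambda>z (a,i). amp x a i * dvec p k i z) (a,i) (a,j))"
    unfolding rhoB_def using assms by (intro sum.cong refl rhoAB_gram) auto
  also have "\<dots> = gram ({..<da} \<times> {..<n}) (\<lambda>_. 1) (\<lambda>(a,z) i. amp x a i * dvec p k i z) i j"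
    unfolding gram_def sum.cartesian_product' by simp
  finally show ?thesis .
qed

lemma rhoA_gram: "rhoA x a b = gram {..<n} (\<lambda>_. 1) (\<lambda>i a. amp x a i) a b"
  by (simp add: rhoA_def rhoAB_def gram_def)

lemma cmod_sq: "z * cnj z = complex_of_real ((cmod z)\<^sup>2)"
  by (simp add: complex_norm_square del: of_real_power)

lemma rhoB_diag: "rhoB x i i = of_real (d x i)"
  unfolding rhoB_def d_def rhoAB_def of_real_sum by (simp only: prod.case dcoef_refl of_real_1 mult_1_right cmod_sq)

lemma trace_rhoB: "x < nx \<Longrightarrow> (\<Sum>i<n. rhoB x i i) = 1"
  using sum_d[of x] by (simp add: rhoB_diag flip: of_real_sum)

lemma trace_rhoA: "x < nx \<Longrightarrow> (\<Sum>a<da. rhoA x a a) = 1"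
proof -
  assume x: "x < nx"
  have "(\<Sum>a<da. rhoA x a a) = (\<Sum>i<n. rhoB x i i)"
    unfolding rhoA_def rhoB_def by (rule sum.swap)
  then show ?thesis using trace_rhoB[OF x] by simp
qed

lemma trace_rhoAB: "x < nx \<Longrightarrow> (\<Sum>r\<in>{..<da} \<times> {..<n}. rhoAB x r r) = 1"
  using trace_rhoA[of x] by (simp add: sum.cartesian_product' rhoA_def)

definition "hA x = entropy {..<da} (rhoA x)"
definition "hB x = entropy {..<n} (rhoB x)"
definition "hE x = entropy {..<n} (gram {..<n} (d x) (dvec p k))"

lemma has_ent_rhoA: "has_ent {..<da} (rhoA x) (hA x)"
proof -
  have "\<exists>h. has_ent {..<da} (gram {..<n} (\<lambda>_. 1) (\<lambda>i a. amp x a i)) h"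
    by (rule gram_has_ent) auto
  then obtain h where "has_ent {..<da} (gram {..<n} (\<lambda>_. 1) (\<lambda>i a. amp x a i)) h" ..
  then have "has_ent {..<da} (rhoA x) h" by (rule has_ent_cong) (simp add: rhoA_gram)
  then show ?thesis unfolding hA_def by (rule has_ent_entropy)
qed

lemma has_ent_rhoB: "has_ent {..<n} (rhoB x) (hB x)"
proof -
  have "\<exists>h. has_ent {..<n} (gram ({..<da} \<times> {..<n}) (\<lambda>_. 1) (\<lambda>(a,z) i. amp x a i * dvec p k i z)) h"
    by (rule gram_has_ent) auto
  then obtain h where "has_ent {..<n} (gram ({..<da} \<times> {..<n}) (\<lambda>_. 1) (\<lambda>(a,z) i. amp x a i * dvec p k i z)) h" ..
  then have "has_ent {..<n} (rhoB x) h" by (rule has_ent_cong) (simp add: rhoB_gram)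
  then show ?thesis unfolding hB_def by (rule has_ent_entropy)
qed

lemma has_ent_environment: "has_ent {..<n} (gram {..<n} (d x) (dvec p k)) (hE x)"
proof -
  have "\<exists>h. has_ent {..<n} (gram {..<n} (d x) (dvec p k)) h"
    by (rule gram_has_ent) (auto simp: d_nonneg)
  then show ?thesis unfolding hE_def by (auto intro: has_ent_entropy)
qed

text \<open>The output on \<open>AB\<close> and the environment are the two marginals of a pure state.\<close>
lemma has_ent_rhoAB: "has_ent ({..<da} \<times> {..<n}) (rhoAB x) (hE x)"
proof -
  let ?I = "{..<da} \<times> {..<n}"
  let ?\<phi> = "\<lambda>z (a,i). amp x a i * dvec p k i z"
  have "\<exists>h. has_ent ?I (gram {..<n} (\<lambda>_. 1) ?\<phi>) h"
    by (rule gram_has_ent) auto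
  then obtain h where h: "has_ent ?I (gram {..<n} (\<lambda>_. 1) ?\<phi>) h" ..
  have "gram {..<n} (d x) (dvec p k) y z = gram ?I (\<lambda>_. 1) (\<lambda>r z. cnj (?\<phi> z r)) y z" for y z
  proof -
    have "gram ?I (\<lambda>_. 1) (\<lambda>r z. cnj (?\<phi> z r)) y z
      = (\<Sum>a<da. \<Sum>i<n. (amp x a i * cnj (amp x a i)) * (dvec p k i y * dvec p k i z))"
      unfolding gram_def sum.cartesian_product' by (simp add: mult_ac)
    also have "\<dots> = (\<Sum>i<n. \<Sum>a<da. of_real ((cmod (amp x a i))\<^sup>2) * (dvec p k i y * dvec p k i z))"
      unfolding cmod_sq by (rule sum.swap)
    also have "\<dots> = gram {..<n} (d x) (dvec p k) y z"
      unfolding gram_def d_def of_real_sum sum_distrib_right by (simp add: mult_ac)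
    finally show ?thesis ..
  qed
  then have dual: "has_ent {..<n} (gram ?I (\<lambda>_. 1) (\<lambda>r z. cnj (?\<phi> z r))) (hE x)"
    by (rule has_ent_cong[OF has_ent_environment, OF sym])
  have "h = hE x"
    by (rule has_ent_dual[OF _ _ h dual]) auto
  then have "has_ent ?I (gram {..<n} (\<lambda>_. 1) ?\<phi>) (hE x)"
    using h by simp
  then show ?thesis
    by (rule has_ent_cong) (rule rhoAB_gram)
qed

lemma state_entry:
  assumes "x < nx" "y < nx" "a < da" "b < da" "i < n" "j < n"
  shows "state_XAB p k nx px da v $$ ((x * da + a) * n + i, (y * da + b) * n + j)
    = (if x = y then of_real (px x) * rhoAB x (a,i) (b,j) else 0)"
proof -
  define D where "D = da * n"
  have D: "D > 0" using assms by (simp add: D_def)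
  have lt: "a * n + i < D" "b * n + j < D"
    using assms by (auto simp: D_def intro: mult_add_less)
  have lt': "x * D + (a * n + i) < nx * D" "y * D + (b * n + j) < nx * D"
    using lt assms(1,2) by (auto intro: mult_add_less)
  \<comment> \<open>\<open>marg3\<close> groups the indices as \<open>((x, a), i)\<close>, the
    nested products in \<open>state_XAB\<close> as \<open>(x, (a, i))\<close>.\<close>
  have idx: "(x * da + a) * n + i = x * D + (a * n + i)" "(y * da + b) * n + j = y * D + (b * n + j)"
    by (simp_all add: D_def algebra_simps)
  let ?M = "\<lambda>x. chan_tensor da n (\<lambda>\<rho>. \<rho>) (dephasing_pow p k) (proj_vec (v x))"
  have dim: "dim_row (?M x) = D" "dim_col (?M x) = D" for x
    by (simp_all add: chan_tensor_def D_def)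
  have vx: "dim_vec (v x) = D"
    using adm assms(1) by (auto simp: admissible_def unit_vector_def D_def)
  have M: "?M x $$ (a * n + i, b * n + j) = rhoAB x (a,i) (b,j)"
  proof -
    have "?M x $$ (a * n + i, b * n + j)
      = of_real (1 * dcoef p k ((a * n + i) mod n) ((b * n + j) mod n)) * proj_vec (v x) $$ (a * n + i, b * n + j)"
      by (rule chan_tensor_schur[where g = "\<lambda>_ _. 1" and h = "dcoef p k"])
         (use lt in \<open>auto simp: dephasing_pow_matunit D_def intro!: eq_matI\<close>)
    then show ?thesis
      using lt assms by (simp add: proj_vec_def vx rhoAB_def amp_def mult_ac)
  qed
  have "state_XAB p k nx px da v $$ ((x * da + a) * n + i, (y * da + b) * n + j)
    = (\<Sum>z<nx. of_real (px z) * (kron (matunit nx z z) (?M z) $$ (x * D + (a * n + i), y * D + (b * n + j))))"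
    unfolding idx state_XAB_def D_def[symmetric] using lt' by simp
  also have "\<dots> = (\<Sum>z<nx. if z = x then (if x = y then of_real (px x) * ?M x $$ (a * n + i, b * n + j) else 0) else 0)"
  proof (intro sum.cong refl)
    fix z assume z: "z \<in> {..<nx}"
    have "kron (matunit nx z z) (?M z) $$ (x * D + (a * n + i), y * D + (b * n + j))
       = matunit nx z z $$ (x, y) * ?M z $$ (a * n + i, b * n + j)"
      unfolding kron_def using lt' lt D dim by (simp add: matunit_def)
    then show "of_real (px z) * (kron (matunit nx z z) (?M z) $$ (x * D + (a * n + i), y * D + (b * n + j)))
      = (if z = x then (if x = y then of_real (px x) * ?M x $$ (a * n + i, b * n + j) else 0) else 0)"
      using assms(1,2) by (auto simp: matunit_def)
  qed
  finally show ?thesis unfolding M using assms(1) by simp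
qed

end

section \<open>Marginal entropies of the classical-quantum state\<close>

context dephased_ensemble
begin

abbreviation "\<rho> \<equiv> state_XAB p k nx px da v"

lemma da_pos: "da > 0"
  using adm by (auto simp: admissible_def)

lemma ent_X: "ent p k nx px da v True False False = (\<Sum>x<nx. eta (px x))"
proof -
  have "marg3 nx da n True False False \<rho> = mat nx nx (\<lambda>(x,y). if x = y then of_real (px x) else 0)"
  proof (rule eq_matI)
    fix x y assume "x < dim_row (mat nx nx (\<lambda>(x,y). if x = y then complex_of_real (px x) else 0))"
      "y < dim_col (mat nx nx (\<lambda>(x,y). if x = y then complex_of_real (px x) else 0))"
    then have xy: "x < nx" "y < nx" by simp_all
    then have "marg3 nx da n True False False \<rho> $$ (x,y) = (\<Sum>a<da. \<Sum>i<n. \<rho> $$ ((x * da + a) * n + i, (y * da + a) * n + i))"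
      by (simp add: marg3_def Let_def)
    also have "\<dots> = (\<Sum>a<da. \<Sum>i<n. if x = y then of_real (px x) * rhoAB x (a,i) (a,i) else 0)"
      using xy by (intro sum.cong refl state_entry) auto
    also have "\<dots> = (if x = y then of_real (px x) * (\<Sum>a<da. rhoA x a a) else 0)"
      by (simp add: rhoA_def sum_distrib_left)
    finally show "marg3 nx da n True False False \<rho> $$ (x,y)
        = mat nx nx (\<lambda>(x,y). if x = y then complex_of_real (px x) else 0) $$ (x,y)"
      using xy by (simp add: trace_rhoA)
  qed (simp_all add: marg3_def Let_def)
  then show ?thesis
    unfolding ent_def using vn_entropy_eqI[OF has_ent_diag[of "{..<nx}" px]] px(1) by simp
qed

lemma ent_XB: "ent p k nx px da v True False True = (\<Sum>x<nx. eta (px x)) + (\<Sum>x<nx. px x * hB x)"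
proof -
  let ?M = "\<lambda>(x,i) (y,j). if x = y then of_real (px x) * rhoB x i j else 0"
  have M: "has_ent ({..<nx} \<times> {..<n}) ?M ((\<Sum>x<nx. eta (px x)) + (\<Sum>x<nx. px x * hB x))"
    by (rule has_ent_block) (use px trace_rhoB has_ent_rhoB in auto)
  let ?R = "mat (nx * n) (nx * n) (\<lambda>(r,c). ?M (r div n, r mod n) (c div n, c mod n))"
  have "marg3 nx da n True False True \<rho> = ?R"
  proof (rule eq_matI)
    fix r c assume "r < dim_row ?R" "c < dim_col ?R"
    then have rc: "r < nx * n" "c < nx * n" by simp_all
    then have lt: "r div n < nx" "c div n < nx" by (simp_all add: less_mult_imp_div_less)
    have "marg3 nx da n True False True \<rho> $$ (r,c)
      = (\<Sum>a<da. \<rho> $$ ((r div n * da + a) * n + r mod n, (c div n * da + a) * n + c mod n))"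
      using rc by (simp add: marg3_def Let_def)
    also have "\<dots> = (\<Sum>a<da. if r div n = c div n then of_real (px (r div n)) * rhoAB (r div n) (a, r mod n) (a, c mod n) else 0)"
      using lt by (intro sum.cong refl state_entry) auto
    also have "\<dots> = ?M (r div n, r mod n) (c div n, c mod n)"
      by (simp add: rhoB_def sum_distrib_left)
    finally show "marg3 nx da n True False True \<rho> $$ (r,c) = ?R $$ (r,c)"
      using rc by simp
  qed (simp_all add: marg3_def Let_def)
  then show ?thesis
    unfolding ent_def using vn_entropy_reindex[OF bij_betw_div_mod M] by simp
qed

lemma ent_XA: "ent p k nx px da v True True False = (\<Sum>x<nx. eta (px x)) + (\<Sum>x<nx. px x * hA x)"
proof -
  let ?M = "\<lambda>(x,a) (y,b). if x = y then of_real (px x) * rhoA x a b else 0"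
  have M: "has_ent ({..<nx} \<times> {..<da}) ?M ((\<Sum>x<nx. eta (px x)) + (\<Sum>x<nx. px x * hA x))"
    by (rule has_ent_block) (use px trace_rhoA has_ent_rhoA in auto)
  let ?R = "mat (nx * da) (nx * da) (\<lambda>(r,c). ?M (r div da, r mod da) (c div da, c mod da))"
  have "marg3 nx da n True True False \<rho> = ?R"
  proof (rule eq_matI)
    fix r c assume "r < dim_row ?R" "c < dim_col ?R"
    then have rc: "r < nx * da" "c < nx * da" by simp_all
    then have lt: "r div da < nx" "c div da < nx" by (simp_all add: less_mult_imp_div_less)
    have "marg3 nx da n True True False \<rho> $$ (r,c)
      = (\<Sum>i<n. \<rho> $$ ((r div da * da + r mod da) * n + i, (c div da * da + c mod da) * n + i))"
      using rc by (simp add: marg3_def Let_def)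
    also have "\<dots> = (\<Sum>i<n. if r div da = c div da then of_real (px (r div da)) * rhoAB (r div da) (r mod da, i) (c mod da, i) else 0)"
      using lt da_pos by (intro sum.cong refl state_entry) auto
    also have "\<dots> = ?M (r div da, r mod da) (c div da, c mod da)"
      by (simp add: rhoA_def sum_distrib_left)
    finally show "marg3 nx da n True True False \<rho> $$ (r,c) = ?R $$ (r,c)"
      using rc by simp
  qed (simp_all add: marg3_def Let_def)
  then show ?thesis
    unfolding ent_def using vn_entropy_reindex[OF bij_betw_div_mod[OF da_pos] M] by simp
qed

lemma ent_XAB: "ent p k nx px da v True True True = (\<Sum>x<nx. eta (px x)) + (\<Sum>x<nx. px x * hE x)"
proof -
  let ?M = "\<lambda>(x,s) (y,t). if x = y then of_real (px x) * rhoAB x s t else 0"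
  have M: "has_ent ({..<nx} \<times> ({..<da} \<times> {..<n})) ?M ((\<Sum>x<nx. eta (px x)) + (\<Sum>x<nx. px x * hE x))"
    by (rule has_ent_block) (use px trace_rhoAB has_ent_rhoAB in auto)
  let ?g = "\<lambda>r. (r div n div da, (r div n mod da, r mod n))"
  have bij: "bij_betw ?g {..<nx * da * n} ({..<nx} \<times> ({..<da} \<times> {..<n}))"
  proof (rule bij_betwI[where g = "\<lambda>(x,(a,i)). (x * da + a) * n + i"])
    show "?g \<in> {..<nx * da * n} \<rightarrow> {..<nx} \<times> ({..<da} \<times> {..<n})"
      using da_pos by (auto simp: less_mult_imp_div_less)
    show "(\<lambda>(x,(a,i)). (x * da + a) * n + i) \<in> {..<nx} \<times> ({..<da} \<times> {..<n}) \<rightarrow> {..<nx * da * n}"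
      by (auto intro!: mult_add_less)
    show "(case ?g r of (x,(a,i)) \<Rightarrow> (x * da + a) * n + i) = r" for r
      by (simp only: prod.case div_mult_mod_eq)
  qed (use da_pos in auto)
  let ?R = "mat (nx * da * n) (nx * da * n) (\<lambda>(r,c). ?M (?g r) (?g c))"
  have "marg3 nx da n True True True \<rho> = ?R"
  proof (rule eq_matI)
    fix r c assume "r < dim_row ?R" "c < dim_col ?R"
    then have rc: "r < nx * da * n" "c < nx * da * n" by simp_all
    then have lt: "r div n div da < nx" "c div n div da < nx" by (simp_all add: less_mult_imp_div_less)
    have swap: "r div (da * n) = r div n div da" for r
      by (simp add: div_mult2_eq mult.commute[of da])
    have "marg3 nx da n True True True \<rho> $$ (r,c)
      = \<rho> $$ ((r div n div da * da + r div n mod da) * n + r mod n, (c div n div da * da + c div n mod da) * n + c mod n)"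
      using rc by (simp add: marg3_def Let_def swap)
    also have "\<dots> = ?M (?g r) (?g c)"
      unfolding prod.case using lt da_pos by (intro state_entry) auto
    finally show "marg3 nx da n True True True \<rho> $$ (r,c) = ?R $$ (r,c)"
      using rc by simp
  qed (simp_all add: marg3_def Let_def)
  then show ?thesis
    unfolding ent_def using vn_entropy_reindex[OF bij M] by simp
qed

definition rhoB_avg :: "nat \<Rightarrow> nat \<Rightarrow> complex" where
  "rhoB_avg i j = (\<Sum>x<nx. of_real (px x) * rhoB x i j)"

lemma ent_B: "ent p k nx px da v False False True = vn_entropy (mat n n (\<lambda>(i,j). rhoB_avg i j))"
proof -
  let ?R = "mat n n (\<lambda>(i,j). rhoB_avg i j)"
  have "marg3 nx da n False False True \<rho> = ?R"
  proof (rule eq_matI)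
    fix i j assume "i < dim_row ?R" "j < dim_col ?R"
    then have ij: "i < n" "j < n" by simp_all
    then have "marg3 nx da n False False True \<rho> $$ (i,j)
      = (\<Sum>x<nx. \<Sum>a<da. \<rho> $$ ((x * da + a) * n + i, (x * da + a) * n + j))"
      by (simp add: marg3_def Let_def)
    also have "\<dots> = (\<Sum>x<nx. \<Sum>a<da. if x = x then of_real (px x) * rhoAB x (a,i) (a,j) else 0)"
      using ij by (intro sum.cong refl state_entry) auto
    finally show "marg3 nx da n False False True \<rho> $$ (i,j) = ?R $$ (i,j)"
      using ij by (simp add: rhoB_avg_def rhoB_def sum_distrib_left)
  qed (simp_all add: marg3_def Let_def)
  then show ?thesis by (simp add: ent_def)
qed

text \<open>The diagonal of the average output is a probability distribution on \<open>2 ^ k\<close>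
  points, and its Shannon entropy bounds the entropy of the state.\<close>

lemma ent_B_le: "ent p k nx px da v False False True \<le> k"
proof -
  let ?T = "{..<nx} \<times> ({..<da} \<times> {..<n})"
  have "rhoB_avg i j = gram ?T (\<lambda>(x,t). px x) (\<lambda>(x,(a,z)) i. amp x a i * dvec p k i z) i j" if "i < n" "j < n" for i j
    using that by (simp add: rhoB_avg_def rhoB_gram gram_def sum.cartesian_product' sum_distrib_left mult.assoc)
  then have h: "has_ent {..<n} rhoB_avg (vn_entropy (mat n n (\<lambda>(i,j). rhoB_avg i j)))"
    by (intro vn_entropy_has_ent[where T = ?T and c = "\<lambda>(x,t). px x"]) (auto simp: px)
  define D where "D i = (\<Sum>x<nx. px x * d x i)" for i
  have D: "Re (rhoB_avg i i) = D i" for i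
    by (simp add: rhoB_avg_def rhoB_diag D_def)
  have "(\<Sum>i<n. D i) = (\<Sum>x<nx. px x * (\<Sum>i<n. d x i))"
    unfolding D_def sum_distrib_left by (rule sum.swap)
  also have "\<dots> = 1" using px(2) by (simp add: sum_d)
  finally have "(\<Sum>i<n. eta (D i)) \<le> log 2 (card {..<n})"
    by (intro Shannon_entropy_le) (auto simp: D_def d_nonneg px intro!: sum_nonneg)
  then have "(\<Sum>i<n. eta (D i)) \<le> k"
    by (simp add: log_nat_power)
  then show ?thesis
    using has_ent_le_diagonal[OF _ h] by (simp add: ent_B D)
qed

text \<open>The entropy of the classical register cancels in all four quantities.\<close>

lemma
  shows mutinf_X_B_eq: "mutinf_X_B p k nx px da v = ent p k nx px da v False False True - (\<Sum>x<nx. px x * hB x)"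
    and coh_A_BX_eq: "coh_A_BX p k nx px da v = (\<Sum>x<nx. px x * hB x) - (\<Sum>x<nx. px x * hE x)"
    and mutinf_AX_B_eq: "mutinf_AX_B p k nx px da v
      = (\<Sum>x<nx. px x * hA x) + ent p k nx px da v False False True - (\<Sum>x<nx. px x * hE x)"
    and condent_A_X_eq: "condent_A_X p k nx px da v = (\<Sum>x<nx. px x * hA x)"
  by (simp_all add: mutinf_X_B_def coh_A_BX_def mutinf_AX_B_def condent_A_X_def ent_X ent_XA ent_XB ent_XAB)

section \<open>Converse bounds for one ensemble\<close>

lemma hB_bounds:
  assumes "x < nx"
  shows "0 \<le> hB x" "hB x \<le> (\<Sum>i<n. eta (d x i))"
  using has_ent_nonneg[OF has_ent_rhoB trace_rhoB[OF assms]] has_ent_le_diagonal[OF _ has_ent_rhoB, of x]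
  by (simp_all add: rhoB_diag)

text \<open>\<open>rhoA x\<close> is a mixture over the input basis of vectors with square norms
  \<open>d x i\<close>, so the mixture bound applies; for \<open>rhoB x\<close> the same bound comes
  from its diagonal.\<close>

lemma hA_bounds:
  assumes "x < nx"
  shows "0 \<le> hA x" "hA x \<le> (\<Sum>i<n. eta (d x i))"
proof -
  show "0 \<le> hA x" by (rule has_ent_nonneg[OF has_ent_rhoA trace_rhoA[OF assms]])
  have "hA x \<le> (\<Sum>i<n. eta (nsq {..<da} (\<lambda>a. amp x a i)))"
    by (rule has_ent_le[OF _ _ has_ent_rhoA]) (auto simp: rhoA_gram)
  then show "hA x \<le> (\<Sum>i<n. eta (d x i))" by (simp add: nsq_def d_def)
qed

text \<open>Used with \<open>h = hB\<close> for the CQ region and with \<open>h = hA\<close> for the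
  CE region. Each affine bound of the environment entropy is averaged over \<open>x\<close> and
  divided by \<open>k\<close>, after which \<open>output_entropy_ge_of_affine\<close> returns to the
  curve.\<close>

lemma trade_off_bound:
  assumes k: "k \<ge> 1"
    and h: "\<And>x. x < nx \<Longrightarrow> 0 \<le> h x" "\<And>x. x < nx \<Longrightarrow> h x \<le> (\<Sum>i<n. eta (d x i))"
  shows "\<exists>\<mu>\<in>{0..1/2}. H2 \<mu> = (\<Sum>x<nx. px x * h x) / k \<and> H2 (gamma_fn \<mu> p) \<le> (\<Sum>x<nx. px x * hE x) / k"
proof (rule output_entropy_ge_of_affine[OF p])
  have "h x \<le> k" if x: "x < nx" for x
  proof -
    have "h x \<le> log 2 (card {..<n})"
      using h(2)[OF x] Shannon_entropy_le[of "{..<n}" "d x"] sum_d[OF x] d_nonneg by fastforce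
    then show ?thesis by (simp add: log_nat_power)
  qed
  then have "(\<Sum>x<nx. px x * h x) \<le> (\<Sum>x<nx. px x * k)"
    using px(1) by (intro sum_mono mult_left_mono) auto
  also have "\<dots> = k" using px(2) by (simp flip: sum_distrib_right)
  finally show "(\<Sum>x<nx. px x * h x) / k \<le> 1" using k by simp
  show "0 \<le> (\<Sum>x<nx. px x * h x) / k"
    using px(1) h(1) by (intro divide_nonneg_nonneg sum_nonneg mult_nonneg_nonneg) auto
  fix m b :: real
  assume m: "m \<ge> 0" and le: "\<And>\<mu>. 0 \<le> \<mu> \<Longrightarrow> \<mu> \<le> 1 \<Longrightarrow> m * H2 \<mu> + b \<le> H2 (gamma_fn \<mu> p)"
  \<comment> \<open>Since \<open>m \<ge> 0\<close>, the Shannon entropy of \<open>d x\<close> may be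
    lowered to \<open>h x\<close>.\<close>
  have "m * h x + k * b \<le> hE x" if x: "x < nx" for x
  proof -
    have "m * h x \<le> m * (\<Sum>i<n. eta (d x i))" using m h(2)[OF x] by (intro mult_left_mono)
    moreover have "m * ((\<Sum>i<n. eta (d x i)) - eta (\<Sum>i<n. d x i)) + real k * b * (\<Sum>i<n. d x i)
        \<le> hE x - eta (\<Sum>i<n. d x i)"
      by (rule environment_entropy_ge[OF p le d_nonneg has_ent_environment])
    ultimately show ?thesis by (simp add: sum_d[OF x])
  qed
  then have "(\<Sum>x<nx. px x * (m * h x + k * b)) \<le> (\<Sum>x<nx. px x * hE x)"
    using px(1) by (intro sum_mono mult_left_mono) auto
  moreover have "(\<Sum>x<nx. px x * (m * h x + k * b)) = m * (\<Sum>x<nx. px x * h x) + k * b"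
  proof -
    have "(\<Sum>x<nx. px x * (m * h x + k * b)) = m * (\<Sum>x<nx. px x * h x) + (\<Sum>x<nx. px x) * (k * b)"
      unfolding sum_distrib_left sum_distrib_right sum.distrib[symmetric]
      by (intro sum.cong refl) (simp add: algebra_simps)
    then show ?thesis using px(2) by simp
  qed
  ultimately have "(m * (\<Sum>x<nx. px x * h x) + k * b) / k \<le> (\<Sum>x<nx. px x * hE x) / k"
    using k by (intro divide_right_mono) auto
  then show "m * ((\<Sum>x<nx. px x * h x) / k) + b \<le> (\<Sum>x<nx. px x * hE x) / k"
    using k by (simp add: add_divide_distrib)
qed

end

lemma CQ_one_shot_dominated:
  assumes p: "0 \<le> p" "p \<le> 1" and k: "k \<ge> 1" and CQ: "(C, Q) \<in> CQ_one_shot p k"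
  shows "\<exists>\<mu>\<in>{0..1/2}. C / k \<le> 1 - H2 \<mu> \<and> Q / k \<le> H2 \<mu> - H2 (gamma_fn \<mu> p)"
proof -
  obtain nx px da v where adm: "admissible k nx px da v" and C: "C \<le> mutinf_X_B p k nx px da v"
    and Q: "Q \<le> coh_A_BX p k nx px da v"
    using CQ unfolding CQ_one_shot_def by blast
  interpret dephased_ensemble p k nx px da v by unfold_locales (use p adm in auto)
  obtain \<mu> where \<mu>: "\<mu> \<in> {0..1/2}" "H2 \<mu> = (\<Sum>x<nx. px x * hB x) / k"
    "H2 (gamma_fn \<mu> p) \<le> (\<Sum>x<nx. px x * hE x) / k"
    using trade_off_bound[OF k hB_bounds] by blast
  have "C / k \<le> (k - (\<Sum>x<nx. px x * hB x)) / k"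
    using C ent_B_le k by (intro divide_right_mono) (auto simp: mutinf_X_B_eq)
  moreover have "Q / k \<le> ((\<Sum>x<nx. px x * hB x) - (\<Sum>x<nx. px x * hE x)) / k"
    using Q k by (intro divide_right_mono) (auto simp: coh_A_BX_eq)
  ultimately show ?thesis
    using \<mu> k by (intro bexI[of _ \<mu>]) (auto simp: diff_divide_distrib)
qed

lemma CE_one_shot_dominated:
  assumes p: "0 \<le> p" "p \<le> 1" and k: "k \<ge> 1" and CE: "(C, E) \<in> CE_one_shot p k"
  shows "\<exists>\<mu>\<in>{0..1/2}. C / k \<le> 1 + H2 \<mu> - H2 (gamma_fn \<mu> p) \<and> H2 \<mu> \<le> E / k"
proof -
  obtain nx px da v where adm: "admissible k nx px da v" and C: "C \<le> mutinf_AX_B p k nx px da v"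
    and E: "E \<ge> condent_A_X p k nx px da v"
    using CE unfolding CE_one_shot_def by blast
  interpret dephased_ensemble p k nx px da v by unfold_locales (use p adm in auto)
  obtain \<mu> where \<mu>: "\<mu> \<in> {0..1/2}" "H2 \<mu> = (\<Sum>x<nx. px x * hA x) / k"
    "H2 (gamma_fn \<mu> p) \<le> (\<Sum>x<nx. px x * hE x) / k"
    using trade_off_bound[OF k hA_bounds] by blast
  have "C / k \<le> ((\<Sum>x<nx. px x * hA x) + k - (\<Sum>x<nx. px x * hE x)) / k"
    using C ent_B_le k by (intro divide_right_mono) (auto simp: mutinf_AX_B_eq)
  moreover have "(\<Sum>x<nx. px x * hA x) / k \<le> E / k"
    using E k by (intro divide_right_mono) (auto simp: condent_A_X_eq)
  ultimately show ?thesis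
    using \<mu> k by (intro bexI[of _ \<mu>]) (auto simp: diff_divide_distrib add_divide_distrib)
qed

section \<open>Attainability and the trade-off curves\<close>

lemma H2_antimono:
  assumes "1/2 \<le> a" "a \<le> b" "b \<le> 1"
  shows "H2 b \<le> H2 a"
proof -
  let ?g = "\<lambda>x. H2 ((1 + x) / 2)"
  have "?g (2 * b - 1) \<le> ?g (2 * a - 1)"
  proof (rule DERIV_nonpos_imp_decreasing_open[of "2 * a - 1" "2 * b - 1" ?g])
    fix x assume x: "2 * a - 1 < x" "x < 2 * b - 1"
    then have "0 < x" "x < 1" using assms by auto
    then show "\<exists>y. (?g has_real_derivative y) (at x) \<and> y \<le> 0"
      using H2_derivative[of x] artanh_real_pos[of x]
      by (intro exI[of _ "- artanh x / ln 2"]) auto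
  next
    show "continuous_on {2 * a - 1..2 * b - 1} ?g"
      by (rule continuous_on_compose2[OF continuous_on_H2]) (use assms in \<open>auto intro!: continuous_intros\<close>)
  qed (use assms in auto)
  then show ?thesis by simp
qed

lemma H2_gamma_le:
  assumes p: "0 \<le> p" "p \<le> 1" and \<mu>: "0 \<le> \<mu>" "\<mu> \<le> 1/2"
  shows "H2 (gamma_fn \<mu> p) \<le> H2 \<mu>"
proof -
  have "1 - \<mu> \<le> gamma_fn \<mu> p" "gamma_fn \<mu> p \<le> 1"
    using gamma_fn_range(2,3)[OF p, of \<mu>] \<mu> by auto
  then have "H2 (gamma_fn \<mu> p) \<le> H2 (1 - \<mu>)" using \<mu> by (intro H2_antimono) auto
  then show ?thesis by (simp add: H2_flip)
qed

text \<open>The uniform ensemble of the two states obtained from each other by a bit flip on the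
  channel input; their Schmidt coefficients are \<open>\<mu>\<close> and \<open>1 - \<mu>\<close>.\<close>
lemma optimal_ensemble:
  assumes p: "0 \<le> p" "p \<le> 1" and \<mu>: "0 \<le> \<mu>" "\<mu> \<le> 1/2"
  obtains px v where "admissible 1 2 px 2 v"
    "mutinf_X_B p 1 2 px 2 v = 1 - H2 \<mu>" "coh_A_BX p 1 2 px 2 v = H2 \<mu> - H2 (gamma_fn \<mu> p)"
    "mutinf_AX_B p 1 2 px 2 v = 1 + H2 \<mu> - H2 (gamma_fn \<mu> p)" "condent_A_X p 1 2 px 2 v = H2 \<mu>"
proof -
  note One_nat_def [simp del]
  have less_two: "x < 2 \<longleftrightarrow> x = 0 \<or> x = 1" for x :: nat by auto
  define w where "w x i = (if x = i then 1 - \<mu> else \<mu>)" for x i :: nat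
  define px where "px x = (1 / 2 :: real)" for x :: nat
  \<comment> \<open>The index is \<open>r = a * 2 + i\<close>, so only \<open>a = i\<close>
    survives: the reference copies the input bit, and \<open>rhoA x\<close>, \<open>rhoB x\<close>
    are both diagonal with entries \<open>w x\<close>.\<close>
  define v where "v x = vec 4 (\<lambda>r. if r div 2 = r mod 2 then complex_of_real (sqrt (w x (r mod 2))) else 0)" for x
  have w: "w x i \<ge> 0" for x i using \<mu> by (simp add: w_def)
  have w_sum: "w x 0 + w x 1 = 1" if "x < 2" for x
    using that by (auto simp: w_def less_two)
  have four: "{..<4::nat} = {0,1,2,3}" by auto
  have adm: "admissible 1 2 px 2 v"
    unfolding admissible_def
  proof (intro conjI allI impI)
    fix x :: nat assume x: "x < 2"
    have "(\<Sum>r<4. (cmod (vec_index (v x) r))\<^sup>2) = 1"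
      using w_sum[OF x] w[of x] by (simp add: four v_def)
    then show "unit_vector (2 * 2 ^ 1) (v x)"
      by (simp add: unit_vector_def v_def)
  qed (auto simp: px_def)
  interpret dephased_ensemble p 1 2 px 2 v by unfold_locales (use p adm in auto)
  have amp: "amp x a i = (if a = i then of_real (sqrt (w x i)) else 0)" if "x < 2" "a < 2" "i < 2" for x a i
    using that unfolding amp_def by (auto simp: v_def less_two)
  have d: "d x i = w x i" if "x < 2" "i < 2" for x i
    using that w by (auto simp: d_def two amp less_two)
  have rB: "rhoB x i j = (if i = j then of_real (w x i) else 0)" if "x < 2" "i < 2" "j < 2" for x i j
    using that w[of x] by (auto simp: rhoB_def rhoAB_def two amp less_two simp flip: of_real_mult)
  have rA: "rhoA x a b = (if a = b then of_real (w x a) else 0)" if "x < 2" "a < 2" "b < 2" for x a b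
    using that w[of x] by (auto simp: rhoA_def rhoAB_def two amp less_two simp flip: of_real_mult)
  have ew: "(\<Sum>i<2. eta (w x i)) = H2 \<mu>" if "x < 2" for x
    using that by (auto simp: two w_def H2_eta less_two)
  have wd: "has_ent {..<2} (\<lambda>i j. if i = j then of_real (w x i) else 0) (H2 \<mu>)" if "x < 2" for x
    using has_ent_diag[of "{..<2}" "w x"] w ew[OF that] by simp
  have hB: "hB x = H2 \<mu>" if x: "x < 2" for x
    unfolding hB_def power_one_right by (rule entropy_eqI[OF _ has_ent_cong[OF wd[OF x]]]) (use x rB in auto)
  have hA: "hA x = H2 \<mu>" if x: "x < 2" for x
    unfolding hA_def by (rule entropy_eqI[OF _ has_ent_cong[OF wd[OF x]]]) (use x rA in auto)
  have hE: "hE x = H2 (gamma_fn \<mu> p)" if x: "x < 2" for x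
  proof -
    have "has_ent {..<2} (gram {..<2} (w x) (dvec1 p)) (hE x)"
    proof (rule has_ent_cong[OF has_ent_environment[of x, unfolded power_one_right]])
      have "dvec p 1 i z = dvec1 p i z" for i z by (simp add: One_nat_def)
      then show "gram {..<2} (w x) (dvec1 p) y z = gram {..<2} (d x) (dvec p 1) y z" for y z
        using x d by (simp add: gram_def)
    qed
    from qubit_output_entropy_eq(4)[OF p w w this] have "hE x = H2 (gamma_fn (w x 1) p)"
      unfolding w_sum[OF x] by simp
    moreover have "gamma_fn (w x 1) p = gamma_fn \<mu> p"
      by (auto simp: w_def gamma_fn_def mult_ac)
    ultimately show ?thesis by simp
  qed
  \<comment> \<open>The two output diagonals average to 1/2, so the average output is maximally
    mixed and \<open>ent_B_le\<close> is attained.\<close>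
  have B: "ent p 1 2 px 2 v False False True = 1"
  proof -
    have half: "has_ent {..<2::nat} (\<lambda>i j. if i = j then of_real (1/2) else 0) (\<Sum>i<2::nat. eta (1/2))"
      by (rule has_ent_diag) auto
    have "has_ent {..<2} rhoB_avg (\<Sum>i<2::nat. eta (1/2))"
    proof (rule has_ent_cong[OF half])
      fix i j :: nat assume "i \<in> {..<2}" "j \<in> {..<2}"
      then show "rhoB_avg i j = (if i = j then of_real (1/2) else 0)"
        by (auto simp: rhoB_avg_def two rB px_def w_def)
    qed
    from vn_entropy_eqI[OF this] show ?thesis
      unfolding ent_B power_one_right by (simp add: eta_def log_divide)
  qed
  have half_sum: "(\<Sum>x<2. px x * c) = c" for c by (simp add: px_def)
  have sums: "(\<Sum>x<2. px x * hB x) = H2 \<mu>" "(\<Sum>x<2. px x * hA x) = H2 \<mu>" "(\<Sum>x<2. px x * hE x) = H2 (gamma_fn \<mu> p)"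
    using hB hA hE half_sum by simp_all
  show thesis
    by (rule that[OF adm]) (simp_all add: mutinf_X_B_eq coh_A_BX_eq mutinf_AX_B_eq condent_A_X_eq B sums)
qed

text \<open>The dominated set is the sum of a closed cone and a compact curve, hence closed. The
  sign \<open>s\<close> is 1 for CQ and -1 for CE, where less entanglement is better.\<close>

lemma closure_dominated:
  fixes c :: "real \<Rightarrow> real \<times> real"
  assumes c: "continuous_on {0..1/2} c"
    and U: "U \<subseteq> {z. \<exists>\<mu>\<in>{0..1/2}. fst z \<le> fst (c \<mu>) \<and> s * snd z \<le> s * snd (c \<mu>)}"
    and z: "z \<in> closure U"
  shows "\<exists>\<mu>\<in>{0..1/2}. fst z \<le> fst (c \<mu>) \<and> s * snd z \<le> s * snd (c \<mu>)"
proof -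
  let ?W = "{w :: real \<times> real. fst w \<le> 0 \<and> s * snd w \<le> 0}"
  let ?D = "{z. \<exists>\<mu>\<in>{0..1/2}. fst z \<le> fst (c \<mu>) \<and> s * snd z \<le> s * snd (c \<mu>)}"
  have "closed ?W"
    by (intro closed_Collect_conj closed_Collect_le continuous_intros)
  moreover have "compact (c ` {0..1/2})"
    by (intro compact_continuous_image c) auto
  ultimately have "closed (\<Union>x\<in>?W. \<Union>y\<in>c ` {0..1/2}. {x + y})"
    by (rule closed_compact_sums)
  also have "(\<Union>x\<in>?W. \<Union>y\<in>c ` {0..1/2}. {x + y}) = ?D"
  proof (intro equalityI subsetI)
    fix z assume "z \<in> (\<Union>x\<in>?W. \<Union>y\<in>c ` {0..1/2}. {x + y})"
    then obtain w \<mu> where "w \<in> ?W" "\<mu> \<in> {0..1/2}" "z = w + c \<mu>" by blast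
    then show "z \<in> ?D" by (intro CollectI bexI[of _ \<mu>]) (auto simp: distrib_left)
  next
    fix z assume "z \<in> ?D"
    then obtain \<mu> where "\<mu> \<in> {0..1/2}" "fst z \<le> fst (c \<mu>)" "s * snd z \<le> s * snd (c \<mu>)" by blast
    then have "z - c \<mu> \<in> ?W" "\<mu> \<in> {0..1/2}" "z = (z - c \<mu>) + c \<mu>"
      by (auto simp: right_diff_distrib)
    then show "z \<in> (\<Union>x\<in>?W. \<Union>y\<in>c ` {0..1/2}. {x + y})" by blast
  qed
  finally have "closure U \<subseteq> ?D" using U by (intro closure_minimal)
  then show ?thesis using z by blast
qed

text \<open>The region lies below the curve and contains it. For the second part both coordinates
  must be nonnegative, hence \<open>H2_le_1\<close> and \<open>H2_gamma_le\<close>.\<close>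

lemma CQ_region_characterization:
  assumes p: "0 \<le> p" "p \<le> 1"
  shows "(C, Q) \<in> CQ_region p \<Longrightarrow> \<exists>\<mu>\<in>{0..1/2}. C \<le> 1 - H2 \<mu> \<and> Q \<le> H2 \<mu> - H2 (gamma_fn \<mu> p)"
    and "\<mu> \<in> {0..1/2} \<Longrightarrow> (1 - H2 \<mu>, H2 \<mu> - H2 (gamma_fn \<mu> p)) \<in> CQ_region p"
proof -
  let ?c = "\<lambda>\<mu>. (1 - H2 \<mu>, H2 \<mu> - H2 (gamma_fn \<mu> p))"
  let ?U = "\<Union>k\<in>{1..}. (\<lambda>(C, Q). (C / real k, Q / real k)) ` CQ_one_shot p k"
  have "continuous_on {0..1/2} ?c"
    by (intro continuous_intros continuous_on_H2_half continuous_on_H2_gamma p)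
  moreover have "?U \<subseteq> {z. \<exists>\<mu>\<in>{0..1/2}. fst z \<le> fst (?c \<mu>) \<and> 1 * snd z \<le> 1 * snd (?c \<mu>)}"
    using CQ_one_shot_dominated[OF p] by auto
  moreover assume "(C, Q) \<in> CQ_region p"
  then have "(C, Q) \<in> closure ?U" by (simp add: CQ_region_def)
  ultimately have "\<exists>\<mu>\<in>{0..1/2}. fst (C, Q) \<le> fst (?c \<mu>) \<and> 1 * snd (C, Q) \<le> 1 * snd (?c \<mu>)"
    by (rule closure_dominated)
  then show "\<exists>\<mu>\<in>{0..1/2}. C \<le> 1 - H2 \<mu> \<and> Q \<le> H2 \<mu> - H2 (gamma_fn \<mu> p)" by simp
next
  assume "\<mu> \<in> {0..1/2}"
  then have \<mu>: "0 \<le> \<mu>" "\<mu> \<le> 1/2" by auto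
  obtain px v where "admissible 1 2 px 2 v" "mutinf_X_B p 1 2 px 2 v = 1 - H2 \<mu>"
    "coh_A_BX p 1 2 px 2 v = H2 \<mu> - H2 (gamma_fn \<mu> p)"
    using optimal_ensemble[OF p \<mu>] by metis
  moreover have "H2 \<mu> \<le> 1" "H2 (gamma_fn \<mu> p) \<le> H2 \<mu>"
    using H2_le_1 H2_gamma_le[OF p \<mu>] \<mu> by auto
  ultimately have "(1 - H2 \<mu>, H2 \<mu> - H2 (gamma_fn \<mu> p)) \<in> CQ_one_shot p 1"
    unfolding CQ_one_shot_def by fastforce
  then show "(1 - H2 \<mu>, H2 \<mu> - H2 (gamma_fn \<mu> p)) \<in> CQ_region p"
    unfolding CQ_region_def by (intro closure_subset[THEN subsetD] UN_I[of 1]) force+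
qed

lemma CE_region_characterization:
  assumes p: "0 \<le> p" "p \<le> 1"
  shows "(C, E) \<in> CE_region p \<Longrightarrow> \<exists>\<mu>\<in>{0..1/2}. C \<le> 1 + H2 \<mu> - H2 (gamma_fn \<mu> p) \<and> H2 \<mu> \<le> E"
    and "\<mu> \<in> {0..1/2} \<Longrightarrow> (1 + H2 \<mu> - H2 (gamma_fn \<mu> p), H2 \<mu>) \<in> CE_region p"
proof -
  let ?c = "\<lambda>\<mu>. (1 + H2 \<mu> - H2 (gamma_fn \<mu> p), H2 \<mu>)"
  let ?U = "\<Union>k\<in>{1..}. (\<lambda>(C, E). (C / real k, E / real k)) ` CE_one_shot p k"
  have "continuous_on {0..1/2} ?c"
    by (intro continuous_intros continuous_on_H2_half continuous_on_H2_gamma p)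
  moreover have "?U \<subseteq> {z. \<exists>\<mu>\<in>{0..1/2}. fst z \<le> fst (?c \<mu>) \<and> (- 1) * snd z \<le> (- 1) * snd (?c \<mu>)}"
    using CE_one_shot_dominated[OF p] by auto
  moreover assume "(C, E) \<in> CE_region p"
  then have "(C, E) \<in> closure ?U" by (simp add: CE_region_def)
  ultimately have "\<exists>\<mu>\<in>{0..1/2}. fst (C, E) \<le> fst (?c \<mu>) \<and> (- 1) * snd (C, E) \<le> (- 1) * snd (?c \<mu>)"
    by (rule closure_dominated)
  then show "\<exists>\<mu>\<in>{0..1/2}. C \<le> 1 + H2 \<mu> - H2 (gamma_fn \<mu> p) \<and> H2 \<mu> \<le> E" by simp
next
  assume "\<mu> \<in> {0..1/2}"
  then have \<mu>: "0 \<le> \<mu>" "\<mu> \<le> 1/2" by auto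
  obtain px v where "admissible 1 2 px 2 v" "mutinf_AX_B p 1 2 px 2 v = 1 + H2 \<mu> - H2 (gamma_fn \<mu> p)"
    "condent_A_X p 1 2 px 2 v = H2 \<mu>"
    using optimal_ensemble[OF p \<mu>] by metis
  moreover have "H2 (gamma_fn \<mu> p) \<le> H2 \<mu>"
    using H2_gamma_le[OF p \<mu>] .
  ultimately have "(1 + H2 \<mu> - H2 (gamma_fn \<mu> p), H2 \<mu>) \<in> CE_one_shot p 1"
    unfolding CE_one_shot_def by fastforce
  then show "(1 + H2 \<mu> - H2 (gamma_fn \<mu> p), H2 \<mu>) \<in> CE_region p"
    unfolding CE_region_def by (intro closure_subset[THEN subsetD] UN_I[of 1]) force+
qed

theorem mainTheorem13:
  fixes p :: real
  assumes "0 \<le> p" and "p \<le> 1"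
  shows "(\<forall>(C, Q) \<in> CQ_tradeoff p. \<exists>\<mu>\<in>{0..1/2}.
            C = 1 - H2 \<mu> \<and> Q = H2 \<mu> - H2 (gamma_fn \<mu> p))
       \<and> (\<forall>(C, E) \<in> CE_tradeoff p. \<exists>\<mu>\<in>{0..1/2}.
            C = 1 + H2 \<mu> - H2 (gamma_fn \<mu> p) \<and> E = H2 \<mu>)"
proof (intro conjI ballI, safe)
  fix C Q assume CQ: "(C, Q) \<in> CQ_tradeoff p"
  then have "(C, Q) \<in> CQ_region p" by (simp add: CQ_tradeoff_def)
  from CQ_region_characterization(1)[OF assms this] obtain \<mu> where
    \<mu>: "\<mu> \<in> {0..1/2}" "C \<le> 1 - H2 \<mu>" "Q \<le> H2 \<mu> - H2 (gamma_fn \<mu> p)" by blast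
  \<comment> \<open>The curve point lies in the region and dominates a Pareto-optimal point, so the
    two coincide.\<close>
  have "(1 - H2 \<mu>, H2 \<mu> - H2 (gamma_fn \<mu> p)) = (C, Q)"
    using CQ CQ_region_characterization(2)[OF assms \<mu>(1)] \<mu>(2,3) unfolding CQ_tradeoff_def by blast
  then show "\<exists>\<mu>\<in>{0..1/2}. C = 1 - H2 \<mu> \<and> Q = H2 \<mu> - H2 (gamma_fn \<mu> p)"
    using \<mu>(1) by blast
next
  fix C E assume CE: "(C, E) \<in> CE_tradeoff p"
  then have "(C, E) \<in> CE_region p" by (simp add: CE_tradeoff_def)
  from CE_region_characterization(1)[OF assms this] obtain \<mu> where
    \<mu>: "\<mu> \<in> {0..1/2}" "C \<le> 1 + H2 \<mu> - H2 (gamma_fn \<mu> p)" "H2 \<mu> \<le> E" by blast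
  have "(1 + H2 \<mu> - H2 (gamma_fn \<mu> p), H2 \<mu>) = (C, E)"
    using CE CE_region_characterization(2)[OF assms \<mu>(1)] \<mu>(2,3) unfolding CE_tradeoff_def by blast
  then show "\<exists>\<mu>\<in>{0..1/2}. C = 1 + H2 \<mu> - H2 (gamma_fn \<mu> p) \<and> E = H2 \<mu>"
    using \<mu>(1) by blast
qed

end
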